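(* Let $G$ be a finitely generated group, and let $H$ be a subgroup of $G$. If $H$ is acylindrically hyperbolic, equationally Noetherian and existentially closed in $G$, then $G$ is acylindrically hyperbolic.
   Context: Equationally Noetherian: a group $G$ is called equationally Noetherian if for every $n$ and every infinite system $\Sigma$ of equations $w(x_1,\ldots,x_n)=1$ in finitely many variables (with $w$ in the free group on $x_1,\ldots,x_n$), the set of solutions of $\Sigma$ in $G$ coincides with the set of solutions in $G$ of some finite subsystem of $\Sigma$. Existentially closed: let $H$ be a subgroup of a group $G$. One says that $H$ is existentially closed in $G$ if for every existential first-order formula $\phi(\boldsymbol{x})$ in the language of groups and every tuple $\boldsymbol{h}\in H^p$ with $p=|\boldsymbol{x}|$, the sentence $\phi(\boldsymbol{h})$ is satisfied by $H$ if and only if it is satisfied by $G$. Equivalently, any finite disjunction of finite systems of equations and inequations with constants in $H$ has a solution in $H$ if and only if it has a solution in $G$. Acylindrical action: an action of a group $G$ by isometries on a metric space $(X,d)$ is called acylindrical if for every $\varepsilon\geq 0$ there exist $N>0$ and $R>0$ such that for every two points $x,y\in X$ with $d(x,y)\geq R$ there are at most $N$ elements $g\in G$ such that $d(x,gx)\leq\varepsilon$ and $d(y,gy)\leq\varepsilon$. Loxodromic elements: let $G$ act by isometries on a $\delta$-hyperbolic (in the sense of Gromov, geodesic) metric space $(X,d)$. An element $g\in G$ is loxodromic if the map $\mathbb{Z}\to X$, $n\mapsto g^n x$, is a quasi-isometric embedding for some (equivalently, any) $x\in X$. A loxodromic element $g$ has exactly two limit points $g^{+\infty},g^{-\infty}$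 on the Gromov boundary $\partial_\infty X$. Two loxodromic elements $g,h$ are independent if $\{g^{\pm\infty}\}$ and $\{h^{\pm\infty}\}$ are disjoint. Acylindrically hyperbolic: a group $G$ is acylindrically hyperbolic if it admits an acylindrical action by isometries on some $\delta$-hyperbolic metric space such that $G$ contains two independent loxodromic elements for this action. *)

theory Defs
  imports
    "HOL-Analysis.Abstract_Metric_Spaces"
    "HOL-Algebra.Generated_Groups"
    "HOL-Algebra.Group_Action"
begin

definition finitely_generated_group :: "('g, 'm) monoid_scheme \<Rightarrow> bool" where
  "finitely_generated_group G \<longleftrightarrow>
     group G \<and> (\<exists>S. finite S \<and> S \<subseteq> carrier G \<and> generate G S = carrier G)"


section \<open>Equationally Noetherian groups\<close>

text \<open>
  Words are lists of letters; \<open>(i, True)\<close> stands for the generator \<open>x\<^sub>i\<close> and \<open>(i, False)\<close> for its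
  inverse. Elements of the free group on \<open>x\<^sub>0, \<dots>, x\<^sub>n\<^sub>-\<^sub>1\<close> are represented by their unique
  reduced words.
\<close>

type_synonym word = "(nat \<times> bool) list"

definition free_group_words :: "nat \<Rightarrow> word set" where
  "free_group_words n =
     {w. fst ` set w \<subseteq> {..<n} \<and>
         successively (\<lambda>a b. \<not> (fst a = fst b \<and> snd a \<noteq> snd b)) w}"

fun word_value :: "('g, 'm) monoid_scheme \<Rightarrow> (nat \<Rightarrow> 'g) \<Rightarrow> word \<Rightarrow> 'g" where
  "word_value G x [] = \<one>\<^bsub>G\<^esub>"
| "word_value G x ((i, b) # w) =
     (if b then x i else inv\<^bsub>G\<^esub> (x i)) \<otimes>\<^bsub>G\<^esub> word_value G x w"

definition solutions :: "('g, 'm) monoid_scheme \<Rightarrow> nat \<Rightarrow> word set \<Rightarrow> (nat \<Rightarrow> 'g) set" where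
  "solutions G n \<Sigma> =
     {x \<in> {..<n} \<rightarrow>\<^sub>E carrier G. \<forall>w\<in>\<Sigma>. word_value G x w = \<one>\<^bsub>G\<^esub>}"

definition equationally_noetherian :: "('g, 'm) monoid_scheme \<Rightarrow> bool" where
  "equationally_noetherian G \<longleftrightarrow>
     (\<forall>n \<Sigma>. \<Sigma> \<subseteq> free_group_words n \<and> infinite \<Sigma> \<longrightarrow>
        (\<exists>\<Sigma>\<^sub>0. \<Sigma>\<^sub>0 \<subseteq> \<Sigma> \<and> finite \<Sigma>\<^sub>0 \<and> solutions G n \<Sigma> = solutions G n \<Sigma>\<^sub>0))"


section \<open>First-order formulas in the language of groups\<close>

datatype gterm = Var nat | One | Mult gterm gterm | Inv gterm

datatype gformula =
    Eq gterm gterm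
  | Neg gformula
  | Conj gformula gformula
  | Disj gformula gformula
  | Ex nat gformula
  | All nat gformula

primrec term_value :: "('g, 'm) monoid_scheme \<Rightarrow> (nat \<Rightarrow> 'g) \<Rightarrow> gterm \<Rightarrow> 'g" where
  "term_value G h (Var i) = h i"
| "term_value G h One = \<one>\<^bsub>G\<^esub>"
| "term_value G h (Mult s t) = term_value G h s \<otimes>\<^bsub>G\<^esub> term_value G h t"
| "term_value G h (Inv t) = inv\<^bsub>G\<^esub> (term_value G h t)"

primrec satisfies :: "('g, 'm) monoid_scheme \<Rightarrow> (nat \<Rightarrow> 'g) \<Rightarrow> gformula \<Rightarrow> bool" where
  "satisfies G h (Eq s t) \<longleftrightarrow> term_value G h s = term_value G h t"
| "satisfies G h (Neg \<phi>) \<longleftrightarrow> \<not> satisfies G h \<phi>"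
| "satisfies G h (Conj \<phi> \<psi>) \<longleftrightarrow> satisfies G h \<phi> \<and> satisfies G h \<psi>"
| "satisfies G h (Disj \<phi> \<psi>) \<longleftrightarrow> satisfies G h \<phi> \<or> satisfies G h \<psi>"
| "satisfies G h (Ex i \<phi>) \<longleftrightarrow> (\<exists>a\<in>carrier G. satisfies G (h(i := a)) \<phi>)"
| "satisfies G h (All i \<phi>) \<longleftrightarrow> (\<forall>a\<in>carrier G. satisfies G (h(i := a)) \<phi>)"

primrec quantifier_free :: "gformula \<Rightarrow> bool" where
  "quantifier_free (Eq s t) \<longleftrightarrow> True"
| "quantifier_free (Neg \<phi>) \<longleftrightarrow> quantifier_free \<phi>"
| "quantifier_free (Conj \<phi> \<psi>) \<longleftrightarrow> quantifier_free \<phi> \<and> quantifier_free \<psi>"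
| "quantifier_free (Disj \<phi> \<psi>) \<longleftrightarrow> quantifier_free \<phi> \<and> quantifier_free \<psi>"
| "quantifier_free (Ex i \<phi>) \<longleftrightarrow> False"
| "quantifier_free (All i \<phi>) \<longleftrightarrow> False"

inductive existential :: "gformula \<Rightarrow> bool" where
  matrix: "quantifier_free \<phi> \<Longrightarrow> existential \<phi>"
| prefix: "existential \<phi> \<Longrightarrow> existential (Ex i \<phi>)"

text \<open>
  A tuple of elements of \<open>H\<close> is given by an assignment \<open>h\<close> of all variables; only the values at
  the finitely many free variables of \<open>\<phi>\<close> matter.
\<close>

definition existentially_closed_in :: "'g set \<Rightarrow> ('g, 'm) monoid_scheme \<Rightarrow> bool" where
  "existentially_closed_in H G \<longleftrightarrow>
     subgroup H G \<and>
     (\<forall>\<phi> h. existential \<phi> \<and> range h \<subseteq> H \<longrightarrow>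
        (satisfies (G\<lparr>carrier := H\<rparr>) h \<phi> \<longleftrightarrow> satisfies G h \<phi>))"


section \<open>Hyperbolic spaces and their boundary\<close>

definition geodesic_space :: "'x set \<Rightarrow> ('x \<Rightarrow> 'x \<Rightarrow> real) \<Rightarrow> bool" where
  "geodesic_space M d \<longleftrightarrow>
     Metric_space M d \<and>
     (\<forall>x\<in>M. \<forall>y\<in>M. \<exists>\<gamma>. \<gamma> \<in> {0..d x y} \<rightarrow> M \<and> \<gamma> 0 = x \<and> \<gamma> (d x y) = y \<and>
        (\<forall>s\<in>{0..d x y}. \<forall>t\<in>{0..d x y}. d (\<gamma> s) (\<gamma> t) = \<bar>s - t\<bar>))"

definition gromov_product :: "('x \<Rightarrow> 'x \<Rightarrow> real) \<Rightarrow> 'x \<Rightarrow> 'x \<Rightarrow> 'x \<Rightarrow> real" where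
  "gromov_product d p x y = (d p x + d p y - d x y) / 2"

definition hyperbolic_space :: "real \<Rightarrow> 'x set \<Rightarrow> ('x \<Rightarrow> 'x \<Rightarrow> real) \<Rightarrow> bool" where
  "hyperbolic_space \<delta> M d \<longleftrightarrow>
     0 \<le> \<delta> \<and> geodesic_space M d \<and>
     (\<forall>p\<in>M. \<forall>x\<in>M. \<forall>y\<in>M. \<forall>z\<in>M.
        gromov_product d p x z \<ge> min (gromov_product d p x y) (gromov_product d p y z) - \<delta>)"

text \<open>
  The boundary consists of classes of sequences converging at infinity. In a hyperbolic space the
  conditions below do not depend on the basepoint \<open>p\<close>.
\<close>

definition gromov_equiv ::
  "'x set \<Rightarrow> ('x \<Rightarrow> 'x \<Rightarrow> real) \<Rightarrow> (nat \<Rightarrow> 'x) \<Rightarrow> (nat \<Rightarrow> 'x) \<Rightarrow> bool" where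
  "gromov_equiv M d u v \<longleftrightarrow>
     (\<forall>p\<in>M. filterlim (\<lambda>(m, n). gromov_product d p (u m) (v n)) at_top
        (sequentially \<times>\<^sub>F sequentially))"

definition gromov_sequences :: "'x set \<Rightarrow> ('x \<Rightarrow> 'x \<Rightarrow> real) \<Rightarrow> (nat \<Rightarrow> 'x) set" where
  "gromov_sequences M d = {u. range u \<subseteq> M \<and> gromov_equiv M d u u}"

definition gromov_boundary :: "'x set \<Rightarrow> ('x \<Rightarrow> 'x \<Rightarrow> real) \<Rightarrow> (nat \<Rightarrow> 'x) set set" where
  "gromov_boundary M d =
     gromov_sequences M d //
       {(u, v). u \<in> gromov_sequences M d \<and> v \<in> gromov_sequences M d \<and> gromov_equiv M d u v}"


section \<open>Acylindrically hyperbolic groups\<close>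

definition isometric_action ::
  "('g, 'm) monoid_scheme \<Rightarrow> 'x set \<Rightarrow> ('x \<Rightarrow> 'x \<Rightarrow> real) \<Rightarrow> ('g \<Rightarrow> 'x \<Rightarrow> 'x) \<Rightarrow> bool" where
  "isometric_action G M d \<alpha> \<longleftrightarrow>
     Metric_space M d \<and> group_action G M \<alpha> \<and>
     (\<forall>g\<in>carrier G. \<forall>x\<in>M. \<forall>y\<in>M. d (\<alpha> g x) (\<alpha> g y) = d x y)"

definition acylindrical_action ::
  "('g, 'm) monoid_scheme \<Rightarrow> 'x set \<Rightarrow> ('x \<Rightarrow> 'x \<Rightarrow> real) \<Rightarrow> ('g \<Rightarrow> 'x \<Rightarrow> 'x) \<Rightarrow> bool" where
  "acylindrical_action G M d \<alpha> \<longleftrightarrow>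
     isometric_action G M d \<alpha> \<and>
     (\<forall>\<epsilon>\<ge>0. \<exists>N::nat. \<exists>R::real. N > 0 \<and> R > 0 \<and>
        (\<forall>x\<in>M. \<forall>y\<in>M. d x y \<ge> R \<longrightarrow>
           finite {g \<in> carrier G. d x (\<alpha> g x) \<le> \<epsilon> \<and> d y (\<alpha> g y) \<le> \<epsilon>} \<and>
           card {g \<in> carrier G. d x (\<alpha> g x) \<le> \<epsilon> \<and> d y (\<alpha> g y) \<le> \<epsilon>} \<le> N))"

definition loxodromic ::
  "('g, 'm) monoid_scheme \<Rightarrow> 'x set \<Rightarrow> ('x \<Rightarrow> 'x \<Rightarrow> real) \<Rightarrow> ('g \<Rightarrow> 'x \<Rightarrow> 'x) \<Rightarrow> 'g \<Rightarrow> bool" where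
  "loxodromic G M d \<alpha> g \<longleftrightarrow>
     g \<in> carrier G \<and>
     (\<exists>x\<in>M. \<exists>K\<ge>1. \<exists>C\<ge>0. \<forall>m n :: int.
        \<bar>real_of_int m - real_of_int n\<bar> / K - C \<le> d (\<alpha> (g [^]\<^bsub>G\<^esub> m) x) (\<alpha> (g [^]\<^bsub>G\<^esub> n) x) \<and>
        d (\<alpha> (g [^]\<^bsub>G\<^esub> m) x) (\<alpha> (g [^]\<^bsub>G\<^esub> n) x) \<le> K * \<bar>real_of_int m - real_of_int n\<bar> + C)"

text \<open>
  The set \<open>{g\<^sup>+\<^sup>\<infinity>, g\<^sup>-\<^sup>\<infinity>}\<close>. The boundary points defined by the two half orbits of a loxodromic
  element do not depend on the choice of \<open>x\<close>.
\<close>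

definition limit_points ::
  "('g, 'm) monoid_scheme \<Rightarrow> 'x set \<Rightarrow> ('x \<Rightarrow> 'x \<Rightarrow> real) \<Rightarrow> ('g \<Rightarrow> 'x \<Rightarrow> 'x) \<Rightarrow> 'g
     \<Rightarrow> (nat \<Rightarrow> 'x) set set" where
  "limit_points G M d \<alpha> g =
     {\<xi> \<in> gromov_boundary M d. \<exists>x\<in>M.
        (\<lambda>n. \<alpha> (g [^]\<^bsub>G\<^esub> int n) x) \<in> \<xi> \<or> (\<lambda>n. \<alpha> (g [^]\<^bsub>G\<^esub> (- int n)) x) \<in> \<xi>}"

definition independent_loxodromics ::
  "('g, 'm) monoid_scheme \<Rightarrow> 'x set \<Rightarrow> ('x \<Rightarrow> 'x \<Rightarrow> real) \<Rightarrow> ('g \<Rightarrow> 'x \<Rightarrow> 'x) \<Rightarrow> 'g \<Rightarrow> 'g \<Rightarrow> bool" where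
  "independent_loxodromics G M d \<alpha> g h \<longleftrightarrow>
     loxodromic G M d \<alpha> g \<and> loxodromic G M d \<alpha> h \<and>
     limit_points G M d \<alpha> g \<inter> limit_points G M d \<alpha> h = {}"

text \<open>
  HOL cannot quantify existentially over types, so the type \<open>'x\<close> containing the points of the
  hyperbolic space is a parameter. For a group with elements in \<open>'g\<close>, the choice
  \<open>'x = 'g \<times> real\<close> loses no generality. Indeed, given a suitable action of \<open>G\<close> on an arbitrary
  space, start with one orbit and repeatedly add, for all pairs of points already present, one
  geodesic together with its translates. The union of these countably many stages is a
  \<open>G\<close>-invariant geodesic subspace with at most \<open>|'g \<times> real|\<close> points. It inherits the
  four-point inequality, acylindricity, and the independent loxodromic elements.
\<close>

definition acylindrically_hyperbolic :: "'x itself \<Rightarrow> ('g, 'm) monoid_scheme \<Rightarrow> bool" where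
  "acylindrically_hyperbolic (_ :: 'x itself) G \<longleftrightarrow>
     (\<exists>\<delta> (M :: 'x set) d \<alpha>.
        hyperbolic_space \<delta> M d \<and> acylindrical_action G M d \<alpha> \<and>
        (\<exists>g h. independent_loxodromics G M d \<alpha> g h))"

end

theory Submission
  imports Defs "HOL-Complex_Analysis.Great_Picard" "HOL-Real_Asymp.Real_Asymp"
begin

text \<open>
  Finite generation, the Noetherian property and existential closedness yield homomorphisms
  \<open>\<phi>\<^sub>n : G \<rightarrow> H\<close> that fix two independent loxodromic elements \<open>h\<^sub>1, h\<^sub>2\<close> and are eventually injective on
  every finite set. Let \<open>a\<^sub>n\<close> be the displacement of a base point of the hyperbolic space \<open>X\<close> of \<open>H\<close>
  under the \<open>\<phi>\<^sub>n\<close>-images of the generators of \<open>G\<close>.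

  If \<open>a\<^sub>n\<close> is bounded along a subsequence, the actions of \<open>G\<close> on \<open>X\<close> through \<open>\<phi>\<^sub>n\<close> have a limit without
  rescaling, and acylindricity passes to the limit because the \<open>\<phi>\<^sub>n\<close> are eventually injective.

  Otherwise, rescaling by \<open>a\<^sub>n\<close> gives an action of \<open>G\<close> on a real tree fixing a point under \<open>h\<^sub>1\<close> and \<open>h\<^sub>2\<close>.
  By acylindricity of \<open>X\<close>, stabilizers of tripods are finite, elements almost fixing a long part of
  an axis have only finitely many commutators with its translation, and \<open>h\<^sub>1, h\<^sub>2\<close> have no powers fixing a
  common direction. Ping-pong then produces a segment \<open>\<sigma>\<close> on the axis of an element \<open>b\<close> such that only
  finitely many elements almost fix \<open>\<sigma>\<close>. The maximal number of disjoint translates of \<open>\<sigma>\<close> between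
  two points is a hyperbolic metric up to bounded error, on which \<open>G\<close> acts acylindrically and \<open>b\<close> is loxodromic.

  In both cases the limit is a countable, coarsely geodesic space; its injective hull is geodesic,
  satisfies the same four-point inequality and lies at bounded distance.
\<close>

text \<open>The obstacle is that the action on the limit tree need not be acylindrical: infinitely
  many elements may fix an arc, acting on the unrescaled segments as translations by amounts
  negligible against \<open>a_n\<close>. Two such translations commute up to a bounded error, which
  is where the commutators come from, and a translation cannot be coherent along all three legs of a
  tripod. A segment that runs along two different axes in succession leaves no room for either
  phenomenon, and the counting metric only sees translates of such a segment. Nor is the base point
  chosen to minimise displacement, so a global fixed point elsewhere in the tree must be excluded.
  \<open>h\<^sub>1\<close> and \<open>h\<^sub>2\<close> do this: they fix the base point, some
  generator \<open>s\<close> moves it, and suitable rotations about the base point and about its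
  translate by \<open>s\<close> have a product that translates. Limits are taken over a countable
  family of sequences by a diagonal argument, not as an ultraproduct: real functions on a countable
  set inject into the reals, so that the injective hull can be realised on the type
  \<open>'g \<times> real\<close> of the conclusion.\<close>

section \<open>Four-point hyperbolicity and divergent sequences\<close>

text \<open>Base-point-free form of the inequality between Gromov products: of the three sums of
  opposite distances the two largest differ by at most \<open>2 * \<delta>\<close>. This form passes
  easily to limits and to the hull; for \<delta> = 0 it describes subsets of real trees.\<close>

definition four_point :: "'x set \<Rightarrow> ('x \<Rightarrow> 'x \<Rightarrow> real) \<Rightarrow> real \<Rightarrow> bool" where
  "four_point M d \<delta> \<longleftrightarrow>
     (\<forall>x\<in>M. \<forall>y\<in>M. \<forall>z\<in>M. \<forall>w\<in>M. d x y + d z w \<le> max (d x z + d y w) (d x w + d y z) + 2 * \<delta>)"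

lemma four_pointD:
  "four_point M d \<delta> \<Longrightarrow> x \<in> M \<Longrightarrow> y \<in> M \<Longrightarrow> z \<in> M \<Longrightarrow> w \<in> M \<Longrightarrow>
     d x y + d z w \<le> max (d x z + d y w) (d x w + d y z) + 2 * \<delta>"
  by (auto simp: four_point_def)

lemma hyperbolic_space_iff:
  "hyperbolic_space \<delta> M d \<longleftrightarrow> 0 \<le> \<delta> \<and> geodesic_space M d \<and> four_point M d \<delta>"
proof (cases "geodesic_space M d")
  case True
  then interpret Metric_space M d by (simp add: geodesic_space_def)
  have "(\<forall>p\<in>M. \<forall>x\<in>M. \<forall>y\<in>M. \<forall>z\<in>M.
        gromov_product d p x z \<ge> min (gromov_product d p x y) (gromov_product d p y z) - \<delta>)
     \<longleftrightarrow> four_point M d \<delta>" (is "?A \<longleftrightarrow> ?B")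
  proof
    assume A: ?A
    show ?B unfolding four_point_def
    proof (intro ballI)
      fix x y z w assume m: "x \<in> M" "y \<in> M" "z \<in> M" "w \<in> M"
      have "gromov_product d w x y \<ge> min (gromov_product d w x z) (gromov_product d w z y) - \<delta>"
        using A m by blast
      then show "d x y + d z w \<le> max (d x z + d y w) (d x w + d y z) + 2 * \<delta>"
        using commute[of x w] commute[of y w] commute[of z w] commute[of y z]
        by (auto simp: gromov_product_def min_def max_def field_simps split: if_splits)
    qed
  next
    assume B: ?B
    show ?A
    proof (intro ballI)
      fix w x z y assume m: "w \<in> M" "x \<in> M" "z \<in> M" "y \<in> M"
      have "d x y + d z w \<le> max (d x z + d y w) (d x w + d y z) + 2 * \<delta>"
        using four_pointD[OF B] m by blast
      then show "gromov_product d w x y \<ge> min (gromov_product d w x z) (gromov_product d w z y) - \<delta>"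
        using commute[of x w] commute[of y w] commute[of z w] commute[of y z]
        by (auto simp: gromov_product_def min_def max_def field_simps split: if_splits)
    qed
  qed
  with True show ?thesis by (simp add: hyperbolic_space_def)
qed (simp add: hyperbolic_space_def)

lemma filterlim_at_top_seq_prod_iff:
  fixes f :: "nat \<Rightarrow> nat \<Rightarrow> real"
  shows "filterlim (\<lambda>(m, n). f m n) at_top (sequentially \<times>\<^sub>F sequentially) \<longleftrightarrow>
    (\<forall>C. \<exists>N. \<forall>m\<ge>N. \<forall>n\<ge>N. C \<le> f m n)"
  by (simp add: filterlim_at_top eventually_prod_sequentially) blast

lemma gromov_equiv_iff:
  "gromov_equiv M d u v \<longleftrightarrow> (\<forall>p\<in>M. \<forall>C. \<exists>N. \<forall>m\<ge>N. \<forall>n\<ge>N. C \<le> gromov_product d p (u m) (v n))"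
  by (simp add: gromov_equiv_def filterlim_at_top_seq_prod_iff)

text \<open>\<open>gromov_equiv\<close> at a single base point. Having no carrier set, it also makes
  sense for the limit pseudometrics and the counting metric below.\<close>

definition diverges_together :: "('x \<Rightarrow> 'x \<Rightarrow> real) \<Rightarrow> 'x \<Rightarrow> (nat \<Rightarrow> 'x) \<Rightarrow> (nat \<Rightarrow> 'x) \<Rightarrow> bool" where
  "diverges_together d p u v \<longleftrightarrow> (\<forall>C. \<exists>N. \<forall>m\<ge>N. \<forall>n\<ge>N. C \<le> gromov_product d p (u m) (v n))"

context Metric_space
begin

lemma gromov_product_commute: "gromov_product d p x y = gromov_product d p y x"
  by (simp add: gromov_product_def commute)

lemma gromov_product_change:
  assumes "p \<in> M" "q \<in> M" "x \<in> M" "y \<in> M" "x' \<in> M" "y' \<in> M"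
  shows "gromov_product d p x y \<ge> gromov_product d q x' y' - d p q - d x x' - d y y'"
proof -
  have "d q x' \<le> d q p + (d p x + d x x')" "d q y' \<le> d q p + (d p y + d y y')"
    "d x y \<le> d x x' + (d x' y' + d y' y)"
    using assms triangle by (meson add_left_mono order_trans)+
  then show ?thesis using commute[of p q] commute[of y y'] by (simp add: gromov_product_def field_simps)
qed

lemma diverges_together_change:
  assumes "diverges_together d p u v" "p \<in> M" "q \<in> M" "range u \<subseteq> M" "range v \<subseteq> M"
    "range u' \<subseteq> M" "range v' \<subseteq> M" "\<And>n. d (u' n) (u n) \<le> B" "\<And>n. d (v' n) (v n) \<le> B"
  shows "diverges_together d q u' v'"
  unfolding diverges_together_def
proof
  fix C
  obtain N where N: "\<And>m n. m \<ge> N \<Longrightarrow> n \<ge> N \<Longrightarrow> C + d q p + 2 * B \<le> gromov_product d p (u m) (v n)"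
    using assms(1) unfolding diverges_together_def by meson
  have "C \<le> gromov_product d q (u' m) (v' n)" if "m \<ge> N" "n \<ge> N" for m n
  proof -
    have "gromov_product d q (u' m) (v' n) \<ge> gromov_product d p (u m) (v n) - d q p - d (u' m) (u m) - d (v' n) (v n)"
      using assms by (intro gromov_product_change) auto
    with N[OF that] assms(8)[of m] assms(9)[of n] show ?thesis by linarith
  qed
  then show "\<exists>N. \<forall>m\<ge>N. \<forall>n\<ge>N. C \<le> gromov_product d q (u' m) (v' n)" by blast
qed

lemma gromov_equiv_iff_diverges:
  assumes "p \<in> M" "range u \<subseteq> M" "range v \<subseteq> M"
  shows "gromov_equiv M d u v \<longleftrightarrow> diverges_together d p u v"
proof
  assume "diverges_together d p u v"
  then have "diverges_together d q u v" if "q \<in> M" for q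
    using diverges_together_change[of p u v q u v 0] assms that by (simp add: image_subset_iff)
  then show "gromov_equiv M d u v" by (simp add: gromov_equiv_iff diverges_together_def)
qed (use assms in \<open>simp add: gromov_equiv_iff diverges_together_def\<close>)

lemma diverges_together_sym: "diverges_together d p u v \<Longrightarrow> diverges_together d p v u"
  unfolding diverges_together_def by (metis gromov_product_commute)

text \<open>One late term of \<open>w\<close> serves as intermediate point for all late terms of
  \<open>u\<close> and \<open>v\<close>, at the cost of \<delta>.\<close>

lemma diverges_together_trans:
  assumes "four_point M d \<delta>" "p \<in> M" "range u \<subseteq> M" "range v \<subseteq> M" "range w \<subseteq> M"
    "diverges_together d p u w" "diverges_together d p w v"
  shows "diverges_together d p u v"
  unfolding diverges_together_def
proof
  fix C
  obtain N1 where N1: "\<And>m n. m \<ge> N1 \<Longrightarrow> n \<ge> N1 \<Longrightarrow> C + \<delta> \<le> gromov_product d p (u m) (w n)"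
    using assms unfolding diverges_together_def by meson
  obtain N2 where N2: "\<And>m n. m \<ge> N2 \<Longrightarrow> n \<ge> N2 \<Longrightarrow> C + \<delta> \<le> gromov_product d p (w m) (v n)"
    using assms unfolding diverges_together_def by meson
  have "C \<le> gromov_product d p (u m) (v n)" if "m \<ge> max N1 N2" "n \<ge> max N1 N2" for m n
  proof -
    let ?k = "max N1 N2"
    have "d (u m) (v n) + d (w ?k) p \<le> max (d (u m) (w ?k) + d (v n) p) (d (u m) p + d (v n) (w ?k)) + 2 * \<delta>"
      by (rule four_pointD[OF assms(1)]) (use assms in auto)
    moreover have "C + \<delta> \<le> gromov_product d p (u m) (w ?k)" "C + \<delta> \<le> gromov_product d p (w ?k) (v n)"
      using N1[of m ?k] N2[of ?k n] that by auto
    ultimately show ?thesis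
      using commute[of p "u m"] commute[of p "v n"] commute[of p "w ?k"] commute[of "v n" "w ?k"]
      by (auto simp: gromov_product_def max_def field_simps split: if_splits)
  qed
  then show "\<exists>N. \<forall>m\<ge>N. \<forall>n\<ge>N. C \<le> gromov_product d p (u m) (v n)" by blast
qed

end

text \<open>\<open>Bij M\<close> contains only functions that are undefined outside
  \<open>M\<close>, hence the restriction.\<close>

lemma group_actionI:
  assumes "group G" and closed: "\<And>g x. g \<in> carrier G \<Longrightarrow> x \<in> M \<Longrightarrow> a g x \<in> M"
    and one: "\<And>x. x \<in> M \<Longrightarrow> a \<one>\<^bsub>G\<^esub> x = x"
    and mult: "\<And>g h x. g \<in> carrier G \<Longrightarrow> h \<in> carrier G \<Longrightarrow> x \<in> M \<Longrightarrow> a (g \<otimes>\<^bsub>G\<^esub> h) x = a g (a h x)"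
  shows "group_action G M (\<lambda>g. restrict (a g) M)"
proof -
  interpret group G by fact
  have bij: "restrict (a g) M \<in> Bij M" if "g \<in> carrier G" for g
  proof -
    have "bij_betw (a g) M M"
      by (rule bij_betwI[where g = "a (inv\<^bsub>G\<^esub> g)"])
        (use that closed one mult in \<open>auto simp flip: mult\<close>)
    then show ?thesis
      by (simp add: Bij_def bij_betw_restrict_eq)
  qed
  have "(\<lambda>g. restrict (a g) M) \<in> hom G (BijGroup M)"
    by (rule homI) (use bij closed mult in \<open>auto simp: BijGroup_def compose_def restrict_def fun_eq_iff\<close>)
  then show ?thesis
    by (simp add: group_action_def group_hom_def group_hom_axioms_def assms group_BijGroup)
qed

lemma group_action_facts:
  assumes "group_action G M a"
  shows "g \<in> carrier G \<Longrightarrow> x \<in> M \<Longrightarrow> a g x \<in> M"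
    and "x \<in> M \<Longrightarrow> a \<one>\<^bsub>G\<^esub> x = x"
    and "g \<in> carrier G \<Longrightarrow> h \<in> carrier G \<Longrightarrow> x \<in> M \<Longrightarrow> a (g \<otimes>\<^bsub>G\<^esub> h) x = a g (a h x)"
proof -
  interpret group_action G M a by fact
  show "g \<in> carrier G \<Longrightarrow> x \<in> M \<Longrightarrow> a g x \<in> M" using element_image by blast
  show "x \<in> M \<Longrightarrow> a \<one>\<^bsub>G\<^esub> x = x" using id_eq_one by (metis restrict_apply')
  show "g \<in> carrier G \<Longrightarrow> h \<in> carrier G \<Longrightarrow> x \<in> M \<Longrightarrow> a (g \<otimes>\<^bsub>G\<^esub> h) x = a g (a h x)"
    using composition_rule by blast
qed

section \<open>Isometric actions and loxodromic elements\<close>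

locale isometric_group_action = group G + Metric_space M d
  for G :: "('g, 'm) monoid_scheme" (structure) and M :: "'x set" and d +
  fixes \<alpha> :: "'g \<Rightarrow> 'x \<Rightarrow> 'x"
  assumes act_closed [simp]: "g \<in> carrier G \<Longrightarrow> x \<in> M \<Longrightarrow> \<alpha> g x \<in> M"
    and act_one [simp]: "x \<in> M \<Longrightarrow> \<alpha> \<one> x = x"
    and act_mult: "g \<in> carrier G \<Longrightarrow> h \<in> carrier G \<Longrightarrow> x \<in> M \<Longrightarrow> \<alpha> (g \<otimes> h) x = \<alpha> g (\<alpha> h x)"
    and act_dist [simp]: "g \<in> carrier G \<Longrightarrow> x \<in> M \<Longrightarrow> y \<in> M \<Longrightarrow> d (\<alpha> g x) (\<alpha> g y) = d x y"
begin

text \<open>The sign \<open>s = 1\<close> or \<open>s = -1\<close> selects one of the two half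
  orbits, so that the four pairs of ends of two loxodromics are treated at once.\<close>

definition orbit_seq :: "'g \<Rightarrow> int \<Rightarrow> 'x \<Rightarrow> nat \<Rightarrow> 'x" where
  "orbit_seq g s x n = \<alpha> (g [^] (s * int n)) x"

lemma range_orbit_seq: "g \<in> carrier G \<Longrightarrow> x \<in> M \<Longrightarrow> range (orbit_seq g s x) \<subseteq> M"
  by (auto simp: orbit_seq_def)

lemma dist_orbit_seq: "g \<in> carrier G \<Longrightarrow> x \<in> M \<Longrightarrow> y \<in> M \<Longrightarrow> d (orbit_seq g s x n) (orbit_seq g s y n) = d x y"
  by (simp add: orbit_seq_def)

lemma dist_translates:
  assumes "g \<in> carrier G" "h \<in> carrier G" "x \<in> M" "y \<in> M"
  shows "d (\<alpha> g x) (\<alpha> h y) = d x (\<alpha> (inv g \<otimes> h) y)"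
proof -
  have "d (\<alpha> g x) (\<alpha> h y) = d (\<alpha> g x) (\<alpha> g (\<alpha> (inv g \<otimes> h) y))"
    using assms by (simp flip: act_mult add: m_assoc[symmetric])
  then show ?thesis using assms by simp
qed

lemma limit_pointsE:
  assumes "\<xi> \<in> limit_points G M d \<alpha> g"
  obtains s x where "s \<in> {1, -1}" "x \<in> M" "orbit_seq g s x \<in> \<xi>"
proof -
  obtain x where x: "x \<in> M" "(\<lambda>n. \<alpha> (g [^] int n) x) \<in> \<xi> \<or> (\<lambda>n. \<alpha> (g [^] (- int n)) x) \<in> \<xi>"
    using assms by (auto simp: limit_points_def)
  have "orbit_seq g 1 x = (\<lambda>n. \<alpha> (g [^] int n) x)" "orbit_seq g (-1) x = (\<lambda>n. \<alpha> (g [^] (- int n)) x)"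
    by (auto simp: orbit_seq_def)
  with x that[of 1 x] that[of "-1" x] show thesis by auto
qed

lemma limit_pointsI:
  assumes "\<xi> \<in> gromov_boundary M d" "s \<in> {1, -1}" "x \<in> M" "orbit_seq g s x \<in> \<xi>"
  shows "\<xi> \<in> limit_points G M d \<alpha> g"
proof -
  have "orbit_seq g 1 x = (\<lambda>n. \<alpha> (g [^] int n) x)" "orbit_seq g (-1) x = (\<lambda>n. \<alpha> (g [^] (- int n)) x)"
    by (auto simp: orbit_seq_def)
  with assms show ?thesis by (auto simp: limit_points_def)
qed

text \<open>A common limit point is a class that contains a half orbit of \<open>g\<close> and one
  of \<open>h\<close>, with unknown starting points; moving both starting points to \<open>x\<close>
  changes the sequences by a bounded amount.\<close>

lemma independent_loxodromicsI:
  assumes hyp: "four_point M d \<delta>" and g: "loxodromic G M d \<alpha> g" and h: "loxodromic G M d \<alpha> h" and "x \<in> M"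
    and ndiv: "\<And>s t. s \<in> {1, -1} \<Longrightarrow> t \<in> {1, -1} \<Longrightarrow>
      \<not> diverges_together d x (orbit_seq g s x) (orbit_seq h t x)"
  shows "independent_loxodromics G M d \<alpha> g h"
proof -
  have gh: "g \<in> carrier G" "h \<in> carrier G" using g h by (auto simp: loxodromic_def)
  have False if \<xi>: "\<xi> \<in> limit_points G M d \<alpha> g" "\<xi> \<in> limit_points G M d \<alpha> h" for \<xi>
  proof -
    obtain s y where s: "s \<in> {1, -1}" "y \<in> M" "orbit_seq g s y \<in> \<xi>" using limit_pointsE[OF \<xi>(1)] .
    obtain t z where t: "t \<in> {1, -1}" "z \<in> M" "orbit_seq h t z \<in> \<xi>" using limit_pointsE[OF \<xi>(2)] .
    have "\<xi> \<in> gromov_boundary M d" using \<xi> by (simp add: limit_points_def)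
    then obtain w where w: "w \<in> gromov_sequences M d"
      "\<And>u. u \<in> \<xi> \<Longrightarrow> gromov_equiv M d w u"
      unfolding gromov_boundary_def by (auto elim!: quotientE)
    have rw: "range w \<subseteq> M" using w by (simp add: gromov_sequences_def)
    note r = rw range_orbit_seq[OF gh(1) s(2)] range_orbit_seq[OF gh(2) t(2)]
      range_orbit_seq[OF gh(1) \<open>x \<in> M\<close>] range_orbit_seq[OF gh(2) \<open>x \<in> M\<close>]
    have "diverges_together d x w (orbit_seq g s y)" "diverges_together d x w (orbit_seq h t z)"
      using w(2)[OF s(3)] w(2)[OF t(3)] by (simp_all add: gromov_equiv_iff_diverges[OF \<open>x \<in> M\<close>] r)
    then have "diverges_together d x (orbit_seq g s y) (orbit_seq h t z)"
      using diverges_together_trans[OF hyp \<open>x \<in> M\<close>] diverges_together_sym r by metis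
    then have "diverges_together d x (orbit_seq g s x) (orbit_seq h t x)"
      by (rule diverges_together_change[where B = "max (d x y) (d x z)"])
        (use r \<open>x \<in> M\<close> s t gh in \<open>auto simp: dist_orbit_seq\<close>)
    with ndiv s t show False by blast
  qed
  with g h show ?thesis by (auto simp: independent_loxodromics_def)
qed

text \<open>
  If \<open>a k = d x (g\<^sup>k x)\<close> satisfies \<open>a (2 N) \<ge> a N + \<mu>\<close> with \<open>\<mu> > 2 \<delta>\<close>, then by the four-point
  inequality \<open>a (j N)\<close> increases by at least \<open>\<mu> - 2 \<delta>\<close> at each step, so no stability of
  quasi-geodesics is needed.
\<close>

lemma loxodromic_orbit_diverges:
  assumes hyp: "four_point M d \<delta>" and lox: "loxodromic G M d \<alpha> g" and x: "x \<in> M" and s: "s \<in> {1, -1}"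
  shows "diverges_together d x (orbit_seq g s x) (orbit_seq g s x)"
proof -
  have g: "g \<in> carrier G" using lox by (simp add: loxodromic_def)
  define a where "a k = d x (\<alpha> (g [^] (k::int)) x)" for k
  have dist: "d (\<alpha> (g [^] (i::int)) x) (\<alpha> (g [^] (j::int)) x) = a (j - i)" for i j
    using dist_translates[of "g [^] i" "g [^] j" x x] g x
    by (simp add: a_def int_pow_neg[symmetric] int_pow_mult[symmetric])
  have a0: "a 0 = 0" using x by (simp add: a_def)
  have a_minus: "a (- k) = a k" for k using dist[of k 0] dist[of 0 k] commute x g by (metis diff_0 diff_zero)
  have a_abs: "a \<bar>k\<bar> = a k" for k using a_minus[of k] by (simp add: abs_if)
  have a_nonneg: "a k \<ge> 0" for k by (simp add: a_def)
  have a_tri: "a (i + j) \<le> a i + a j" for i j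
    using triangle[of x "\<alpha> (g [^] i) x" "\<alpha> (g [^] (i + j)) x"] x g dist[of i "i + j"] by (simp add: a_def)
  have a_four: "a (j - i) + a (l - k) \<le> max (a (k - i) + a (l - j)) (a (l - i) + a (k - j)) + 2 * \<delta>" for i j k l
    using four_pointD[OF hyp, of "\<alpha> (g [^] i) x" "\<alpha> (g [^] j) x" "\<alpha> (g [^] k) x" "\<alpha> (g [^] l) x"] x g
    by (simp add: dist)
  obtain y K C where y: "y \<in> M" "K \<ge> 1" and K: "\<And>m n :: int.
      \<bar>real_of_int m - real_of_int n\<bar> / K - C \<le> d (\<alpha> (g [^] m) y) (\<alpha> (g [^] n) y)"
    using lox unfolding loxodromic_def by blast
  have a_lower: "\<bar>real_of_int m\<bar> / K - (C + 2 * d x y) \<le> a m" for m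
  proof -
    have "d (\<alpha> (g [^] (0::int)) y) (\<alpha> (g [^] m) y) \<le> d y x + (a m + d x y)"
      using triangle[of y x "\<alpha> (g [^] m) y"] triangle[of x "\<alpha> (g [^] m) x" "\<alpha> (g [^] m) y"] x y g
      by (simp add: a_def)
    with K[of 0 m] commute[of x y] show ?thesis by simp
  qed
  define \<mu> where "\<mu> = 2 * \<bar>\<delta>\<bar> + 1"
  \<comment> \<open>Otherwise \<open>a (2 ^ k)\<close> would grow at most linearly in
    \<open>k\<close>, against the linear lower bound for \<open>a\<close>.\<close>
  have "\<exists>N. N > 0 \<and> a (2 * N) \<ge> a N + \<mu>"
  proof (rule ccontr)
    assume "\<not> ?thesis"
    then have less: "a (2 * N) \<le> a N + \<mu>" if "N > 0" for N using that by force
    have pow: "a (2 ^ k) \<le> a 1 + real k * \<mu>" for k :: nat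
    proof (induction k)
      case (Suc k)
      then show ?case using less[of "2 ^ k"] by (simp add: algebra_simps)
    qed simp
    have "2 ^ k / K \<le> C + 2 * d x y + a 1 + real k * \<mu>" for k :: nat
      using a_lower[of "2 ^ k"] pow[of k] by simp
    then have *: "2 ^ k \<le> K * (C + 2 * d x y + a 1) + (K * \<mu>) * real k" for k :: nat
      using y by (simp add: field_simps)
    have "eventually (\<lambda>k. A + B * real k < 2 ^ k) sequentially" for A B :: real
      by real_asymp
    then obtain k where "K * (C + 2 * d x y + a 1) + (K * \<mu>) * real k < 2 ^ k"
      by (metis (no_types, lifting) eventually_sequentially order_refl)
    with *[of k] show False by simp
  qed
  then obtain N where N: "N > 0" "a (2 * N) \<ge> a N + \<mu>" by blast
  define b where "b j = a (int j * N)" for j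
  define \<nu> where "\<nu> = \<mu> - 2 * \<bar>\<delta>\<bar>"
  have \<nu>: "\<nu> \<ge> 1" by (simp add: \<nu>_def \<mu>_def)
  have step: "b (Suc j) \<ge> b j + \<nu>" for j
  proof (induction j)
    case 0
    have "a (2 * N) \<le> 2 * a N" using a_tri[of N N] by simp
    then show ?case using N a_nonneg[of N] a0 by (simp add: b_def \<nu>_def \<mu>_def)
  next
    case (Suc j)
    have "a (int (Suc j) * N) + a (2 * N) \<le> max (a (int j * N) + a N) (a (int (Suc (Suc j)) * N) + a (- N)) + 2 * \<delta>"
      using a_four[of 0 "int (Suc j) * N" "int j * N" "int (Suc (Suc j)) * N"]
        a_minus[of "N * 2"] a_minus[of "N + N * int j"]
      by (simp add: algebra_simps)
    then show ?case using N Suc \<nu> by (auto simp: b_def \<nu>_def \<mu>_def a_minus max_def split: if_splits)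
  qed
  have steps: "b (j + i) \<ge> b j + \<nu> * real i" for i j
  proof (induction i)
    case (Suc i)
    then show ?case using step[of "j + i"] by (simp add: algebra_simps)
  qed simp
  \<comment> \<open>Bounds the error of replacing an index by the multiple of \<open>N\<close> below
    it.\<close>
  define c where "c = (\<Sum>r\<in>{0..<N}. a r)"
  have c: "a r \<le> c" if "0 \<le> r" "r < N" for r
    unfolding c_def by (rule member_le_sum) (use that a_nonneg in auto)
  have c': "\<bar>a (int m) - b (m div nat N)\<bar> \<le> c" for m
  proof -
    define q where "q = int (m div nat N) * N"
    have e: "int m = q + int m mod N" using N
      by (simp add: q_def zdiv_int)
    have "a (int m) \<le> a q + a (int m mod N)" using a_tri[of q "int m mod N"] e by simp
    moreover have "a q \<le> a (int m) + a (int m mod N)"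
      using a_tri[of "int m" "- (int m mod N)"] e a_minus by (metis add_diff_cancel_right' diff_conv_add_uminus)
    moreover have "a (int m mod N) \<le> c" using N by (intro c) auto
    ultimately show ?thesis by (simp add: b_def q_def)
  qed
  \<comment> \<open>The left side is twice the Gromov product of the orbit points with indices
    \<open>m\<close> and \<open>n\<close>. Up to remainders, \<open>steps\<close> is used from
    \<open>l\<close> to \<open>j\<close>, which exceeds \<open>l\<close> by at least
    \<open>i\<close>, and from \<open>0\<close> to \<open>i\<close>.\<close>
  have grow: "a (int m) + a (int n) - a (int n - int m) \<ge> 2 * \<nu> * real (m div nat N) - 4 * c" if "m \<le> n" for m n
  proof -
    define i j where "i = m div nat N" and "j = n div nat N"
    have "i \<le> j" using that by (simp add: i_def j_def div_le_mono)
    define l where "l = (n - m) div nat N"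
    have "a (int n - int m) \<le> b l + c" using c'[of "n - m"] that by (simp add: of_nat_diff l_def)
    moreover have "i + l \<le> j"
      using div_add1_eq[of m "n - m" "nat N"] that by (simp add: i_def j_def l_def)
    then have "b l + \<nu> * real i \<le> b j"
      using steps[of l i] steps[of "l + i" "j - (l + i)"] \<nu> by (smt (verit) add.commute le_add_diff_inverse mult_nonneg_nonneg of_nat_0_le_iff)
    moreover have "b i \<ge> \<nu> * real i" using steps[of 0 i] a0 by (simp add: b_def)
    ultimately show ?thesis using c'[of m] c'[of n] unfolding i_def j_def by linarith
  qed
  show ?thesis unfolding diverges_together_def
  proof
    fix Z
    obtain k where k: "real k \<ge> Z + 2 * \<bar>c\<bar>" using real_arch_simple by blast
    have "2 * Z \<le> a (int m) + a (int n) - a (int n - int m)"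
      if "m \<ge> k * nat N" "n \<ge> k * nat N" "m \<le> n" for m n
    proof -
      have "k \<le> m div nat N" using that N by (simp add: less_eq_div_iff_mult_less_eq)
      then have "real k \<le> \<nu> * real (m div nat N)" using \<nu>
        by (smt (verit) mult_le_cancel_right1 of_nat_0_le_iff of_nat_mono)
      with grow[OF that(3)] k show ?thesis by linarith
    qed
    note half = this
    have "Z \<le> gromov_product d x (orbit_seq g s x m) (orbit_seq g s x n)"
      if mn: "m \<ge> k * nat N" "n \<ge> k * nat N" for m n
    proof -
      have "d x (orbit_seq g s x m) = a (int m)" for m
        using s a_minus by (auto simp: orbit_seq_def a_def)
      moreover have "d (orbit_seq g s x m) (orbit_seq g s x n) = a (int n - int m)"
        using s a_minus[of "int n - int m"] by (auto simp: orbit_seq_def dist)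
      ultimately show ?thesis
        using half[of m n] half[of n m] mn a_minus[of "int n - int m"]
        by (cases "m \<le> n") (simp_all add: gromov_product_def)
    qed
    then show "\<exists>N. \<forall>m\<ge>N. \<forall>n\<ge>N. Z \<le> gromov_product d x (orbit_seq g s x m) (orbit_seq g s x n)" by blast
  qed
qed

text \<open>Half orbits of loxodromics converge at infinity, so the class of the half orbit of
  \<open>g\<close> is a boundary point; were it also the class of the half orbit of
  \<open>h\<close>, it would be a common limit point.\<close>

lemma independent_not_diverge:
  assumes hyp: "four_point M d \<delta>" and ind: "independent_loxodromics G M d \<alpha> g h"
    and x: "x \<in> M" and s: "s \<in> {1, -1}" and t: "t \<in> {1, -1}"
  shows "\<not> diverges_together d x (orbit_seq g s x) (orbit_seq h t x)"
proof
  assume div: "diverges_together d x (orbit_seq g s x) (orbit_seq h t x)"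
  have lox: "loxodromic G M d \<alpha> g" "loxodromic G M d \<alpha> h" using ind by (auto simp: independent_loxodromics_def)
  then have gh: "g \<in> carrier G" "h \<in> carrier G" by (auto simp: loxodromic_def)
  let ?u = "orbit_seq g s x" and ?v = "orbit_seq h t x"
  note r = range_orbit_seq[OF gh(1) x, of s] range_orbit_seq[OF gh(2) x, of t]
  have eq: "gromov_equiv M d ?u ?u" "gromov_equiv M d ?v ?v" "gromov_equiv M d ?u ?v"
    using loxodromic_orbit_diverges[OF hyp lox(1) x s] loxodromic_orbit_diverges[OF hyp lox(2) x t] div
    by (simp_all add: gromov_equiv_iff_diverges[OF x] r)
  define R where "R = {(u, v). u \<in> gromov_sequences M d \<and> v \<in> gromov_sequences M d \<and> gromov_equiv M d u v}"
  have uv: "?u \<in> gromov_sequences M d" "?v \<in> gromov_sequences M d"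
    using eq r by (auto simp: gromov_sequences_def)
  then have "R `` {?u} \<in> gromov_boundary M d"
    unfolding gromov_boundary_def R_def by (rule_tac quotientI)
  moreover have "?u \<in> R `` {?u}" "?v \<in> R `` {?u}" using uv eq by (auto simp: R_def)
  ultimately have "R `` {?u} \<in> limit_points G M d \<alpha> g \<inter> limit_points G M d \<alpha> h"
    using limit_pointsI s t x by blast
  then show False using ind by (auto simp: independent_loxodromics_def)
qed

lemma loxodromic_dist_unbounded:
  assumes "loxodromic G M d \<alpha> g" "x \<in> M"
  obtains K C where "K > 0" "\<And>m :: int. \<bar>real_of_int m\<bar> / K - C \<le> d x (\<alpha> (g [^] m) x)"
proof -
  have g: "g \<in> carrier G" using assms by (simp add: loxodromic_def)
  obtain y K C where y: "y \<in> M" "K \<ge> 1" and K: "\<And>m n :: int.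
      \<bar>real_of_int m - real_of_int n\<bar> / K - C \<le> d (\<alpha> (g [^] m) y) (\<alpha> (g [^] n) y)"
    using assms unfolding loxodromic_def by blast
  have "\<bar>real_of_int m\<bar> / K - (C + 2 * d x y) \<le> d x (\<alpha> (g [^] m) x)" for m
  proof -
    have "d (\<alpha> (g [^] (0::int)) y) (\<alpha> (g [^] m) y) \<le> d y x + (d x (\<alpha> (g [^] m) x) + d x y)"
      using triangle[of y x "\<alpha> (g [^] m) y"] triangle[of x "\<alpha> (g [^] m) x" "\<alpha> (g [^] m) y"] assms y g
      by simp
    with K[of 0 m] commute[of x y] show ?thesis by simp
  qed
  with y that[of K "C + 2 * d x y"] show thesis by simp
qed

lemma loxodromic_pow_eq:
  assumes "loxodromic G M d \<alpha> g" "g [^] (m::int) = g [^] (n::int)"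
  shows "m = n"
proof (rule ccontr)
  assume "m \<noteq> n"
  have g: "g \<in> carrier G" using assms by (simp add: loxodromic_def)
  obtain x where x: "x \<in> M" using assms by (auto simp: loxodromic_def)
  obtain K C where K: "K > 0" "\<And>m :: int. \<bar>real_of_int m\<bar> / K - C \<le> d x (\<alpha> (g [^] m) x)"
    using loxodromic_dist_unbounded[OF assms(1) x] by blast
  have "g [^] (m - n) = \<one>" using assms g by (simp add: int_pow_diff)
  then have one: "g [^] ((m - n) * k) = \<one>" for k :: int by (metis g int_pow_one int_pow_pow)
  obtain k :: nat where k: "real k > K * C" using reals_Archimedean2 by blast
  have "\<bar>real_of_int ((m - n) * int k)\<bar> \<le> K * C"
    using K(2)[of "(m - n) * int k"] x K(1) unfolding one by (simp add: field_simps)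
  moreover have "real k \<le> \<bar>real_of_int ((m - n) * int k)\<bar>"
    using \<open>m \<noteq> n\<close> by (simp add: abs_mult mult_le_cancel_right1 flip: of_int_diff) linarith
  ultimately show False using k by linarith
qed

text \<open>If \<open>n\<close> is nonzero, then so is \<open>m\<close>, and the half orbits in the
  directions \<open>sgn m\<close> and \<open>sgn n\<close> share infinitely many points. Such a
  shared point, taken late enough, links late terms of both, which would give \<open>g\<close> and
  \<open>h\<close> a common end.\<close>

lemma independent_pow_neq:
  assumes hyp: "four_point M d \<delta>" and ind: "independent_loxodromics G M d \<alpha> g h"
    and eq: "g [^] (m::int) = h [^] (n::int)"
  shows "n = 0"
proof (rule ccontr)
  assume n: "n \<noteq> 0"
  have lox: "loxodromic G M d \<alpha> g" "loxodromic G M d \<alpha> h" using ind by (auto simp: independent_loxodromics_def)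
  then have gh: "g \<in> carrier G" "h \<in> carrier G" by (auto simp: loxodromic_def)
  obtain x where x: "x \<in> M" using lox by (auto simp: loxodromic_def)
  have m: "m \<noteq> 0" using loxodromic_pow_eq[OF lox(2), of n 0] eq n by auto
  define s t where "s = sgn m" and "t = sgn n"
  have st: "s \<in> {1, -1}" "t \<in> {1, -1}" using m n by (auto simp: s_def t_def sgn_if)
  have pow: "g [^] (s * int (nat \<bar>m\<bar> * k)) = h [^] (t * int (nat \<bar>n\<bar> * k))" for k
  proof -
    have "s * int (nat \<bar>m\<bar> * k) = m * int k" "t * int (nat \<bar>n\<bar> * k) = n * int k"
      by (simp_all add: s_def t_def mult.assoc[symmetric] linordered_idom_class.mult_sgn_abs)
    then show ?thesis using eq gh by (metis int_pow_pow)
  qed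
  note u = loxodromic_orbit_diverges[OF hyp lox(1) x st(1)] and v = loxodromic_orbit_diverges[OF hyp lox(2) x st(2)]
  have "diverges_together d x (orbit_seq g s x) (orbit_seq h t x)"
    unfolding diverges_together_def
  proof
    fix C
    obtain N1 where N1: "\<And>i j. i \<ge> N1 \<Longrightarrow> j \<ge> N1 \<Longrightarrow> C + \<delta> \<le> gromov_product d x (orbit_seq g s x i) (orbit_seq g s x j)"
      using u unfolding diverges_together_def by meson
    obtain N2 where N2: "\<And>i j. i \<ge> N2 \<Longrightarrow> j \<ge> N2 \<Longrightarrow> C + \<delta> \<le> gromov_product d x (orbit_seq h t x i) (orbit_seq h t x j)"
      using v unfolding diverges_together_def by meson
    have "C \<le> gromov_product d x (orbit_seq g s x i) (orbit_seq h t x j)" if "i \<ge> max N1 N2" "j \<ge> max N1 N2" for i j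
    proof -
      let ?k = "max N1 N2" let ?w = "orbit_seq g s x (nat \<bar>m\<bar> * ?k)"
      have w: "?w = orbit_seq h t x (nat \<bar>n\<bar> * ?k)" using pow by (simp add: orbit_seq_def)
      have le: "?k \<le> nat \<bar>m\<bar> * ?k" "?k \<le> nat \<bar>n\<bar> * ?k" using m n by (simp_all del: max.bounded_iff) linarith+
      have "d (orbit_seq g s x i) (orbit_seq h t x j) + d ?w x
        \<le> max (d (orbit_seq g s x i) ?w + d (orbit_seq h t x j) x) (d (orbit_seq g s x i) x + d (orbit_seq h t x j) ?w) + 2 * \<delta>"
        by (rule four_pointD[OF hyp]) (use x gh in \<open>auto simp: orbit_seq_def\<close>)
      moreover have "C + \<delta> \<le> gromov_product d x (orbit_seq g s x i) ?w" using N1[of i "nat \<bar>m\<bar> * ?k"] that le by auto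
      moreover have "C + \<delta> \<le> gromov_product d x ?w (orbit_seq h t x j)"
        unfolding w using N2[of "nat \<bar>n\<bar> * ?k" j] that le by auto
      ultimately show ?thesis
        using commute[of x "orbit_seq g s x i"] commute[of x "orbit_seq h t x j"] commute[of x ?w] commute[of ?w "orbit_seq h t x j"]
        unfolding gromov_product_def max_def by argo
    qed
    then show "\<exists>N. \<forall>i\<ge>N. \<forall>j\<ge>N. C \<le> gromov_product d x (orbit_seq g s x i) (orbit_seq h t x j)" by blast
  qed
  then show False using independent_not_diverge[OF hyp ind x st] by blast
qed

end

section \<open>The injective hull\<close>

locale pseudo_metric_space =
  fixes V :: "'v set" and D :: "'v \<Rightarrow> 'v \<Rightarrow> real"
  assumes D_refl [simp]: "p \<in> V \<Longrightarrow> D p p = 0"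
    and D_sym: "p \<in> V \<Longrightarrow> q \<in> V \<Longrightarrow> D p q = D q p"
    and D_triangle: "p \<in> V \<Longrightarrow> q \<in> V \<Longrightarrow> r \<in> V \<Longrightarrow> D p r \<le> D p q + D q r"
begin

lemma D_nonneg: "p \<in> V \<Longrightarrow> q \<in> V \<Longrightarrow> 0 \<le> D p q"
  using D_triangle[of p q p] D_sym[of p q] by auto

text \<open>The value 0 outside \<open>V\<close> makes a function determined by its values on
  \<open>V\<close>, so that equality of points of the hull is equality of functions.\<close>

definition upper :: "('v \<Rightarrow> real) set" where
  "upper = {f. (\<forall>x. x \<notin> V \<longrightarrow> f x = 0) \<and> (\<forall>x\<in>V. \<forall>y\<in>V. D x y \<le> f x + f y)}"

text \<open>The injective hull, or tight span: the pointwise minimal elements of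
  \<open>upper\<close>. Minimality means that no slack is left at any \<open>x\<close>; on an
  infinite \<open>V\<close> the optimal partner \<open>y\<close> is only approached, hence
  \<open>e\<close>.\<close>

definition tight :: "('v \<Rightarrow> real) set" where
  "tight = {f \<in> upper. \<forall>x\<in>V. \<forall>e>0. \<exists>y\<in>V. f x + f y < D x y + e}"

text \<open>The outer absolute value keeps the distance nonnegative for arbitrary functions, where
  the supremum may be unspecified; \<open>Metric_space\<close> asks for this outside the carrier
  too.\<close>

definition hull_dist :: "('v \<Rightarrow> real) \<Rightarrow> ('v \<Rightarrow> real) \<Rightarrow> real" where
  "hull_dist f g = \<bar>SUP x\<in>V. \<bar>f x - g x\<bar>\<bar>"

definition embed :: "'v \<Rightarrow> 'v \<Rightarrow> real" where
  "embed v x = (if x \<in> V then D v x else 0)"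

lemma upperD: "f \<in> upper \<Longrightarrow> x \<in> V \<Longrightarrow> y \<in> V \<Longrightarrow> D x y \<le> f x + f y"
  by (simp add: upper_def)

lemma upper_outside: "f \<in> upper \<Longrightarrow> x \<notin> V \<Longrightarrow> f x = 0"
  by (simp add: upper_def)

lemma hull_upper: "f \<in> tight \<Longrightarrow> f \<in> upper"
  by (simp add: tight_def)

lemma hull_tight: "f \<in> tight \<Longrightarrow> x \<in> V \<Longrightarrow> e > 0 \<Longrightarrow> \<exists>y\<in>V. f x + f y < D x y + e"
  by (simp add: tight_def)

lemma upper_nonneg: "f \<in> upper \<Longrightarrow> x \<in> V \<Longrightarrow> 0 \<le> f x"
  using upperD[of f x x] by simp

lemma hull_lipschitz:
  assumes "f \<in> tight" "x \<in> V" "y \<in> V"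
  shows "f x \<le> D x y + f y"
proof (rule field_le_epsilon)
  fix e :: real assume "e > 0"
  then obtain z where z: "z \<in> V" "f x + f z < D x z + e" using hull_tight assms by blast
  then show "f x \<le> D x y + f y + e"
    using upperD[OF hull_upper, OF assms(1,3) z(1)] D_triangle[of x y z] assms by linarith
qed

lemma hull_diff_bound:
  assumes "f \<in> tight" "g \<in> tight" "x \<in> V" "p \<in> V"
  shows "\<bar>f x - g x\<bar> \<le> f p + g p"
  using hull_lipschitz[OF assms(1,3,4)] hull_lipschitz[OF assms(2,3,4)]
    upperD[OF hull_upper, OF assms(1,3,4)] upperD[OF hull_upper, OF assms(2,3,4)]
  by linarith

lemma hull_dist_bdd: "f \<in> tight \<Longrightarrow> g \<in> tight \<Longrightarrow> bdd_above ((\<lambda>x. \<bar>f x - g x\<bar>) ` V)"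
proof (cases "V = {}")
  case False
  assume "f \<in> tight" "g \<in> tight"
  moreover obtain p where "p \<in> V" using False by blast
  ultimately show ?thesis using hull_diff_bound by (intro bdd_aboveI2[of _ _ "f p + g p"]) blast
qed simp

lemma hull_dist_ge: "f \<in> tight \<Longrightarrow> g \<in> tight \<Longrightarrow> x \<in> V \<Longrightarrow> \<bar>f x - g x\<bar> \<le> hull_dist f g"
  unfolding hull_dist_def by (rule order_trans[OF cSUP_upper[OF _ hull_dist_bdd] abs_ge_self])

lemma hull_dist_ge': "f \<in> tight \<Longrightarrow> g \<in> tight \<Longrightarrow> x \<in> V \<Longrightarrow> y \<in> V \<Longrightarrow> D x y - f x - g y \<le> hull_dist f g"
  using hull_dist_ge[of f g x] upperD[OF hull_upper, of g x y] by linarith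

end

locale pseudo_metric_space_nonempty = pseudo_metric_space V D for V :: "'v set" and D +
  assumes V_nonempty: "V \<noteq> {}"
begin

lemma hull_dist_le:
  assumes "\<And>x. x \<in> V \<Longrightarrow> \<bar>f x - g x\<bar> \<le> c"
  shows "hull_dist f g \<le> c"
proof -
  obtain p where p: "p \<in> V" using V_nonempty by blast
  have "(SUP x\<in>V. \<bar>f x - g x\<bar>) \<le> c"
    using assms p by (intro cSUP_least) auto
  moreover have "\<bar>f p - g p\<bar> \<le> (SUP x\<in>V. \<bar>f x - g x\<bar>)"
    using p assms by (intro cSUP_upper bdd_aboveI[of _ c]) auto
  ultimately show ?thesis unfolding hull_dist_def by linarith
qed

text \<open>Together with \<open>hull_dist_ge'\<close> this exhibits the hull distance as a supremum
  of expressions \<open>D x y - f x - g y\<close>. A point where \<open>f\<close> and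
  \<open>g\<close> differ most is paired with a nearly optimal partner for the larger of the
  two.\<close>

lemma hull_dist_attained:
  assumes "f \<in> tight" "g \<in> tight" "e > 0"
  obtains x y where "x \<in> V" "y \<in> V" "hull_dist f g < D x y - f x - g y + e"
proof -
  have "\<exists>x\<in>V. hull_dist f g - e / 2 < \<bar>f x - g x\<bar>"
  proof (rule ccontr)
    assume "\<not> ?thesis"
    then have "hull_dist f g \<le> hull_dist f g - e / 2" by (intro hull_dist_le) (simp add: not_less)
    with assms show False by simp
  qed
  then obtain x where x: "x \<in> V" "hull_dist f g - e / 2 < \<bar>f x - g x\<bar>" by blast
  obtain y where y: "y \<in> V" "f x + f y < D x y + e / 2" using hull_tight[of f x "e/2"] assms x by auto
  obtain z where z: "z \<in> V" "g x + g z < D x z + e / 2" using hull_tight[of g x "e/2"] assms x by auto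
  show thesis
  proof (cases "f x \<ge> g x")
    case True
    then have "hull_dist f g < D y x - f y - g x + e" using x y D_sym[of x y] by linarith
    with that x y show thesis by blast
  next
    case False
    then have "hull_dist f g < D x z - f x - g z + e" using x z by linarith
    with that x z show thesis by blast
  qed
qed

sublocale tight: Metric_space tight hull_dist
proof
  show nonneg: "0 \<le> hull_dist f g" for f g by (simp add: hull_dist_def)
  show "hull_dist f g = hull_dist g f" for f g
    by (simp add: hull_dist_def abs_minus_commute)
  show "hull_dist f g = 0 \<longleftrightarrow> f = g" if fg: "f \<in> tight" "g \<in> tight" for f g
  proof
    assume 0: "hull_dist f g = 0"
    show "f = g"
    proof
      fix x show "f x = g x"
        using hull_dist_ge[OF fg, of x] 0 upper_outside[OF hull_upper, of f x] upper_outside[OF hull_upper, of g x] fg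
        by (cases "x \<in> V") auto
    qed
  next
    assume "f = g"
    then show "hull_dist f g = 0" using hull_dist_le[of f g 0] nonneg[of f g] by simp
  qed
  show "hull_dist f h \<le> hull_dist f g + hull_dist g h" if "f \<in> tight" "g \<in> tight" "h \<in> tight" for f g h
    by (rule hull_dist_le) (use hull_dist_ge[OF that(1,2)] hull_dist_ge[OF that(2,3)] in fastforce)
qed

lemma embed_hull: "v \<in> V \<Longrightarrow> embed v \<in> tight"
proof -
  assume v: "v \<in> V"
  have "D x y \<le> D v x + D v y" if "x \<in> V" "y \<in> V" for x y
    using D_triangle[of x v y] D_sym[of v x] that v by simp
  then have "embed v \<in> upper" by (simp add: upper_def embed_def)
  moreover have "\<exists>y\<in>V. embed v x + embed v y < D x y + e" if "x \<in> V" "e > 0" for x e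
    using v that D_sym by (intro bexI[of _ v]) (auto simp: embed_def)
  ultimately show ?thesis by (simp add: tight_def)
qed

lemma hull_dist_embed:
  assumes "v \<in> V" "f \<in> tight"
  shows "hull_dist (embed v) f = f v"
proof (rule antisym)
  show "hull_dist (embed v) f \<le> f v"
  proof (rule hull_dist_le)
    fix x assume x: "x \<in> V"
    then show "\<bar>embed v x - f x\<bar> \<le> f v"
      using hull_lipschitz[OF assms(2) x assms(1)] upperD[OF hull_upper[OF assms(2)] assms(1) x] D_sym[OF x assms(1)]
      by (simp add: embed_def)
  qed
  show "f v \<le> hull_dist (embed v) f"
    using hull_dist_ge[OF embed_hull assms(2), of v v] assms upper_nonneg[OF hull_upper, of f v] by (simp add: embed_def)
qed

lemma hull_dist_embed_embed: "v \<in> V \<Longrightarrow> w \<in> V \<Longrightarrow> hull_dist (embed v) (embed w) = D v w"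
  using hull_dist_embed[of v "embed w"] embed_hull D_sym by (simp add: embed_def)

text \<open>Apply the inequality of \<open>V\<close> to nearly optimal points. Each of the three
  sums carries the same correction \<open>f x + g y + h z + k w\<close>, so it cancels and \<delta>
  does not grow.\<close>

lemma four_point_hull:
  assumes "four_point V D \<delta>"
  shows "four_point tight hull_dist \<delta>"
  unfolding four_point_def
proof (intro ballI, rule field_le_epsilon)
  fix f g h k and e :: real assume m: "f \<in> tight" "g \<in> tight" "h \<in> tight" "k \<in> tight" and "e > 0"
  obtain x y where xy: "x \<in> V" "y \<in> V" "hull_dist f g < D x y - f x - g y + e / 2"
    using hull_dist_attained[OF m(1,2)] \<open>e > 0\<close> half_gt_zero by metis
  obtain z w where zw: "z \<in> V" "w \<in> V" "hull_dist h k < D z w - h z - k w + e / 2"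
    using hull_dist_attained[OF m(3,4)] \<open>e > 0\<close> half_gt_zero by metis
  show "hull_dist f g + hull_dist h k \<le> max (hull_dist f h + hull_dist g k) (hull_dist f k + hull_dist g h) + 2 * \<delta> + e"
    using xy(3) zw(3) four_pointD[OF assms xy(1,2) zw(1,2)]
      hull_dist_ge'[OF m(1,3) xy(1) zw(1)] hull_dist_ge'[OF m(2,4) xy(2) zw(2)]
      hull_dist_ge'[OF m(1,4) xy(1) zw(2)] hull_dist_ge'[OF m(2,3) xy(2) zw(1)]
    unfolding max_def by argo
qed

section \<open>Retracting \<open>upper\<close> onto the injective hull\<close>

definition conjugate :: "('v \<Rightarrow> real) \<Rightarrow> 'v \<Rightarrow> real" where
  "conjugate f x = (if x \<in> V then SUP z\<in>V. D x z - f z else 0)"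

text \<open>\<open>conjugate f x\<close> is the least value at \<open>x\<close> compatible with the
  values of \<open>f\<close> elsewhere. Lowering all values to it at once may leave
  \<open>upper\<close>; going halfway never does.\<close>

definition halfway :: "('v \<Rightarrow> real) \<Rightarrow> 'v \<Rightarrow> real" where
  "halfway f x = (f x + conjugate f x) / 2"

text \<open>An explicit limit is preferred to an arbitrary minimal function below \<open>f\<close>,
  because each step is 1-Lipschitz for the supremum distance and the limit inherits this.\<close>

definition retraction :: "('v \<Rightarrow> real) \<Rightarrow> 'v \<Rightarrow> real" where
  "retraction f x = lim (\<lambda>n. (halfway ^^ n) f x)"

lemma conjugate_le: "(\<And>z. z \<in> V \<Longrightarrow> D x z - f z \<le> c) \<Longrightarrow> x \<in> V \<Longrightarrow> conjugate f x \<le> c"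
  using V_nonempty by (auto simp: conjugate_def intro!: cSUP_least)

lemma conjugate_ge:
  assumes "f \<in> upper" "x \<in> V" "z \<in> V" shows "D x z - f z \<le> conjugate f x"
proof -
  have "bdd_above ((\<lambda>z. D x z - f z) ` V)"
    by (rule bdd_aboveI[of _ "f x"]) (use upperD[OF assms(1,2)] in fastforce)
  then show ?thesis using assms by (auto simp: conjugate_def intro: cSUP_upper)
qed

lemma conjugate_le_self: "f \<in> upper \<Longrightarrow> conjugate f x \<le> f x"
  using conjugate_le[of x f "f x"] upperD[of f x] upper_outside[of f x]
  by (cases "x \<in> V") (fastforce simp: conjugate_def)+

lemma halfway_upper:
  assumes f: "f \<in> upper" shows "halfway f \<in> upper"
proof -
  have "D x y \<le> halfway f x + halfway f y" if "x \<in> V" "y \<in> V" for x y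
    using conjugate_ge[OF f that] conjugate_ge[OF f that(2,1)] D_sym[OF that] by (simp add: halfway_def field_simps)
  then show ?thesis using f by (auto simp: upper_def halfway_def conjugate_def)
qed

lemma halfway_le: "f \<in> upper \<Longrightarrow> halfway f x \<le> f x"
  using conjugate_le_self[of f x] by (simp add: halfway_def)

lemma iterate_upper: "f \<in> upper \<Longrightarrow> (halfway ^^ n) f \<in> upper"
  by (induction n) (auto intro: halfway_upper)

lemma iterate_decseq: "f \<in> upper \<Longrightarrow> decseq (\<lambda>n. (halfway ^^ n) f x)"
  by (rule decseq_SucI) (simp add: halfway_le iterate_upper)

lemma iterate_nonneg: "f \<in> upper \<Longrightarrow> 0 \<le> (halfway ^^ n) f x"
  by (metis iterate_upper order_refl upper_nonneg upper_outside)

lemma iterate_tendsto: "f \<in> upper \<Longrightarrow> (\<lambda>n. (halfway ^^ n) f x) \<longlonglongrightarrow> retraction f x"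
  unfolding retraction_def
  using decseq_convergent[of "\<lambda>n. (halfway ^^ n) f x" 0] iterate_decseq[of f x] iterate_nonneg[of f _ x] by (metis limI)

text \<open>The conjugate grows as the function shrinks, so each step at least halves the gap at
  \<open>x\<close>. A vanishing gap is tightness.\<close>

lemma iterate_gap:
  assumes "f \<in> upper" "x \<in> V"
  shows "(halfway ^^ n) f x - conjugate ((halfway ^^ n) f) x \<le> (f x - conjugate f x) / 2 ^ n"
proof (induction n)
  case (Suc n)
  let ?g = "(halfway ^^ n) f"
  have g: "?g \<in> upper" by (rule iterate_upper) fact
  have "conjugate ?g x \<le> conjugate (halfway ?g) x"
  proof (rule conjugate_le)
    fix z assume "z \<in> V"
    then show "D x z - ?g z \<le> conjugate (halfway ?g) x"
      using conjugate_ge[OF halfway_upper[OF g] assms(2)] halfway_le[OF g, of z] by fastforce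
  qed (use assms in auto)
  then have "halfway ?g x - conjugate (halfway ?g) x \<le> (?g x - conjugate ?g x) / 2"
    by (simp add: halfway_def field_simps)
  with Suc show ?case by simp
qed simp

lemma retraction_hull:
  assumes f: "f \<in> upper" shows "retraction f \<in> tight"
proof -
  have "D x y \<le> retraction f x + retraction f y" if "x \<in> V" "y \<in> V" for x y
    by (rule LIMSEQ_le_const[OF tendsto_add[OF iterate_tendsto iterate_tendsto]])
      (use f that upperD[OF iterate_upper] in auto)
  moreover have "retraction f x = 0" if "x \<notin> V" for x
    using iterate_tendsto[OF f, of x] upper_outside[OF iterate_upper[OF f] that] by (simp add: LIMSEQ_const_iff)
  ultimately have up: "retraction f \<in> upper" by (simp add: upper_def)
  have "\<exists>y\<in>V. retraction f x + retraction f y < D x y + e" if x: "x \<in> V" and e: "e > 0" for x e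
  proof -
    have "(\<lambda>n. (f x - conjugate f x) / 2 ^ n) \<longlonglongrightarrow> 0"
      using tendsto_mult[OF tendsto_const[of "f x - conjugate f x"] LIMSEQ_realpow_zero[of "1/2"]]
      by (simp add: power_divide)
    then have "eventually (\<lambda>n. (f x - conjugate f x) / 2 ^ n < e / 2) sequentially"
      by (rule order_tendstoD) (use e in auto)
    then obtain n where n: "(f x - conjugate f x) / 2 ^ n < e / 2" by (auto simp: eventually_sequentially)
    let ?g = "(halfway ^^ n) f"
    have g: "?g \<in> upper" by (rule iterate_upper) fact
    have "\<not> conjugate ?g x \<le> ?g x - e / 2" using iterate_gap[OF f x, of n] n by linarith
    then obtain z where z: "z \<in> V" "D x z - ?g z > ?g x - e / 2"
      using conjugate_le[of x ?g "?g x - e / 2"] x by force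
    have "retraction f y \<le> ?g y" for y
      using decseq_ge[OF iterate_decseq[OF f] iterate_tendsto[OF f]] by blast
    from this[of x] this[of z] z e show ?thesis by (intro bexI[of _ z]) auto
  qed
  with up show ?thesis by (simp add: tight_def)
qed

lemma conjugate_lipschitz:
  assumes "f \<in> upper" "g \<in> upper" "\<And>x. x \<in> V \<Longrightarrow> \<bar>f x - g x\<bar> \<le> c" "x \<in> V"
  shows "\<bar>conjugate f x - conjugate g x\<bar> \<le> c"
proof -
  have "conjugate f x \<le> conjugate g x + c"
    by (rule conjugate_le) (use assms conjugate_ge[OF assms(2,4)] in \<open>fastforce simp: abs_le_iff\<close>)+
  moreover have "conjugate g x \<le> conjugate f x + c"
    by (rule conjugate_le) (use assms conjugate_ge[OF assms(1,4)] in \<open>fastforce simp: abs_le_iff\<close>)+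
  ultimately show ?thesis by linarith
qed

lemma retraction_lipschitz:
  assumes fg: "f \<in> upper" "g \<in> upper" and c: "\<And>x. x \<in> V \<Longrightarrow> \<bar>f x - g x\<bar> \<le> c" and x: "x \<in> V"
  shows "\<bar>retraction f x - retraction g x\<bar> \<le> c"
proof -
  have "\<bar>(halfway ^^ n) f x - (halfway ^^ n) g x\<bar> \<le> c" if "x \<in> V" for n x
    using that
  proof (induction n arbitrary: x)
    case (Suc n)
    let ?f = "(halfway ^^ n) f" and ?g = "(halfway ^^ n) g"
    have "\<bar>conjugate ?f x - conjugate ?g x\<bar> \<le> c"
      by (rule conjugate_lipschitz) (use Suc fg iterate_upper in auto)
    moreover have "\<bar>?f x - ?g x\<bar> \<le> c" using Suc by auto
    moreover have "halfway ?f x - halfway ?g x = (?f x - ?g x) / 2 + (conjugate ?f x - conjugate ?g x) / 2"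
      by (simp add: halfway_def field_simps)
    ultimately have "\<bar>halfway ?f x - halfway ?g x\<bar> \<le> c" unfolding abs_le_iff by argo
    then show ?case by simp
  qed (use c in auto)
  then show ?thesis
    by (intro LIMSEQ_le_const2[OF tendsto_rabs[OF tendsto_diff[OF iterate_tendsto iterate_tendsto]]])
      (use fg x in auto)
qed

lemma retraction_fixes:
  assumes f: "f \<in> tight" shows "retraction f = f"
proof -
  have "conjugate f x = f x" for x
  proof (cases "x \<in> V")
    case True
    have "f x \<le> conjugate f x"
    proof (rule field_le_epsilon)
      fix e :: real assume "e > 0"
      then obtain y where "y \<in> V" "f x + f y < D x y + e" using hull_tight[OF f True] by blast
      then show "f x \<le> conjugate f x + e" using conjugate_ge[OF hull_upper[OF f] True, of y] by linarith
    qed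
    then show ?thesis using conjugate_le_self[OF hull_upper[OF f], of x] by linarith
  qed (use upper_outside[OF hull_upper[OF f]] in \<open>simp add: conjugate_def\<close>)
  then have "halfway f = f" by (auto simp: halfway_def)
  then have "(halfway ^^ n) f = f" for n by (induction n) auto
  then show ?thesis by (auto simp: retraction_def)
qed

text \<open>\<open>upper\<close> is convex, so it contains the straight segment between two tight
  functions. The retraction fixes its ends and turns it into a 1-Lipschitz path whose parameter
  interval is exactly as long as the distance of the ends; such a path is a geodesic.\<close>

lemma geodesic_space_hull: "geodesic_space tight hull_dist"
proof -
  have "\<exists>\<gamma>. \<gamma> \<in> {0..hull_dist f g} \<rightarrow> tight \<and> \<gamma> 0 = f \<and> \<gamma> (hull_dist f g) = g \<and>
        (\<forall>s\<in>{0..hull_dist f g}. \<forall>t\<in>{0..hull_dist f g}. hull_dist (\<gamma> s) (\<gamma> t) = \<bar>s - t\<bar>)"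
    if fg: "f \<in> tight" "g \<in> tight" for f g
  proof (cases "f = g")
    case True
    then show ?thesis using fg by (intro exI[of _ "\<lambda>_. f"]) auto
  next
    case False
    define l where "l = hull_dist f g"
    have l: "l > 0" using False fg tight.mdist_pos_eq by (simp add: l_def)
    define c where "c t x = f x + t / l * (g x - f x)" for t x
    define \<gamma> where "\<gamma> t = retraction (c t)" for t
    have up: "c t \<in> upper" if "t \<in> {0..l}" for t
    proof -
      have "D x y \<le> c t x + c t y" if "x \<in> V" "y \<in> V" for x y
      proof -
        have t: "0 \<le> t / l" "0 \<le> 1 - t / l" using \<open>t \<in> {0..l}\<close> l by auto
        have "(1 - t / l) * D x y \<le> (1 - t / l) * (f x + f y)" "t / l * D x y \<le> t / l * (g x + g y)"
          using t upperD[OF hull_upper[OF fg(1)] that] upperD[OF hull_upper[OF fg(2)] that]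
          by (meson mult_left_mono)+
        then show ?thesis by (simp add: c_def algebra_simps)
      qed
      moreover have "f x = 0" "g x = 0" if "x \<notin> V" for x
        using upper_outside[OF hull_upper] fg that by blast+
      ultimately show ?thesis by (simp add: upper_def c_def)
    qed
    have ends: "\<gamma> 0 = f" "\<gamma> l = g"
    proof -
      have "c 0 = f" "c l = g" using l by (auto simp: c_def)
      then show "\<gamma> 0 = f" "\<gamma> l = g" using retraction_fixes fg by (simp_all add: \<gamma>_def)
    qed
    have lip: "hull_dist (\<gamma> s) (\<gamma> t) \<le> \<bar>s - t\<bar>" if st: "s \<in> {0..l}" "t \<in> {0..l}" for s t
    proof (rule hull_dist_le)
      fix x assume x: "x \<in> V"
      have "\<bar>c s y - c t y\<bar> \<le> \<bar>s - t\<bar>" if "y \<in> V" for y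
      proof -
        have "c s y - c t y = (s - t) / l * (g y - f y)" by (simp add: c_def algebra_simps diff_divide_distrib)
        then have "\<bar>c s y - c t y\<bar> = \<bar>s - t\<bar> * (\<bar>f y - g y\<bar> / l)"
          using l by (simp add: abs_mult abs_minus_commute)
        also have "\<dots> \<le> \<bar>s - t\<bar> * 1"
          using hull_dist_ge[OF fg that] l by (intro mult_left_mono) (auto simp: l_def)
        finally show ?thesis by simp
      qed
      then show "\<bar>\<gamma> s x - \<gamma> t x\<bar> \<le> \<bar>s - t\<bar>"
        unfolding \<gamma>_def using retraction_lipschitz[OF up up] st x by blast
    qed
    have mem: "\<gamma> t \<in> tight" if "t \<in> {0..l}" for t using retraction_hull[OF up[OF that]] by (simp add: \<gamma>_def)
    have le: "t - s \<le> hull_dist (\<gamma> s) (\<gamma> t)" if st: "s \<in> {0..l}" "t \<in> {0..l}" for s t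
    proof -
      have "l \<le> hull_dist (\<gamma> 0) (\<gamma> s) + (hull_dist (\<gamma> s) (\<gamma> t) + hull_dist (\<gamma> t) (\<gamma> l))"
        using fg tight.triangle[of "\<gamma> 0" "\<gamma> s" "\<gamma> l"] tight.triangle[of "\<gamma> s" "\<gamma> t" "\<gamma> l"] mem st l ends
        by (simp add: l_def)
      with lip[of 0 s] lip[of t l] st l show ?thesis by auto
    qed
    have "hull_dist (\<gamma> s) (\<gamma> t) = \<bar>s - t\<bar>" if st: "s \<in> {0..l}" "t \<in> {0..l}" for s t
      using lip[OF st] le[OF st] le[OF st(2,1)] tight.commute[of "\<gamma> s" "\<gamma> t"] by linarith
    then show ?thesis using mem ends by (intro exI[of _ \<gamma>]) (auto simp: l_def)
  qed
  then show ?thesis unfolding geodesic_space_def using tight.Metric_space_axioms by blast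
qed

end

section \<open>Actions on coarsely geodesic hyperbolic spaces\<close>

text \<open>A function on a countable set is determined by the rationals below each of its values,
  hence by a set of natural numbers, and there are as many of these as reals.\<close>

lemma functions_on_countable_into_reals:
  assumes "countable V"
  obtains e :: "('v \<Rightarrow> real) \<Rightarrow> real" where "inj_on e {f. \<forall>x. x \<notin> V \<longrightarrow> f x = 0}"
proof -
  obtain j :: "nat set \<Rightarrow> real" where j: "inj j"
    using nat_sets_eqpoll_reals by (auto simp: eqpoll_def bij_betw_def)
  define S where "S f = {prod_encode (to_nat_on V x, k) | x k. x \<in> V \<and> real_of_rat (nat_to_rat_surj k) < f x}"
    for f :: "'v \<Rightarrow> real"
  have mem: "prod_encode (to_nat_on V x, k) \<in> S f \<longleftrightarrow> real_of_rat (nat_to_rat_surj k) < f x" if "x \<in> V" for x k f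
    using that assms by (auto simp: S_def)
  have "inj_on S {f. \<forall>x. x \<notin> V \<longrightarrow> f x = 0}"
  proof (rule inj_onI, rule ext)
    fix f g x assume fg: "f \<in> {f. \<forall>x. x \<notin> V \<longrightarrow> f x = 0}" "g \<in> {f. \<forall>x. x \<notin> V \<longrightarrow> f x = 0}" "S f = S g"
    show "f x = g x"
    proof (cases "x \<in> V")
      case True
      then have iff: "real_of_rat (nat_to_rat_surj k) < f x \<longleftrightarrow> real_of_rat (nat_to_rat_surj k) < g x" for k
        using mem fg(3) by blast
      have le: "\<not> a < b" if "\<And>k. real_of_rat (nat_to_rat_surj k) < b \<longleftrightarrow> real_of_rat (nat_to_rat_surj k) < a" for a b :: real
      proof
        assume "a < b"
        then obtain q where q: "a < real_of_rat q" "real_of_rat q < b" using of_rat_dense by blast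
        obtain k where "q = nat_to_rat_surj k" using surj_nat_to_rat_surj by (metis surjD)
        with q that[of k] show False by simp
      qed
      show ?thesis using le[of "f x" "g x"] le[of "g x" "f x"] iff by fastforce
    qed (use fg in auto)
  qed
  then have "inj_on (j \<circ> S) {f. \<forall>x. x \<notin> V \<longrightarrow> f x = 0}"
    by (rule comp_inj_on) (rule inj_on_subset[OF j subset_UNIV])
  then show thesis by (rule that)
qed

text \<open>The action extends to the hull by precomposition with the inverse. With \<open>C\<close>
  bounding the distance from the hull to \<open>V\<close>, acylindricity at \<epsilon> follows from
  that of \<open>V\<close> at \<open>\<epsilon> + 2 * C\<close>. The dynamical hypotheses concern a
  single orbit, on which the hull distance is \<open>D\<close>.\<close>

lemma acylindrically_hyperbolicI:
  fixes G :: "('g, 'm) monoid_scheme" (structure) and V :: "'v set" and D :: "'v \<Rightarrow> 'v \<Rightarrow> real"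
    and \<beta> :: "'g \<Rightarrow> 'v \<Rightarrow> 'v"
  assumes "group G" and "countable V" and "pseudo_metric_space V D" and v0: "v0 \<in> V"
    and hyp: "four_point V D \<delta>" and \<delta>: "\<delta> \<ge> 0"
    and coarse: "\<And>p q t. p \<in> V \<Longrightarrow> q \<in> V \<Longrightarrow> 0 \<le> t \<Longrightarrow> t \<le> D p q \<Longrightarrow>
      \<exists>z\<in>V. D p z \<le> t + c \<and> D z q \<le> D p q - t + c"
    and closed: "\<And>g p. g \<in> carrier G \<Longrightarrow> p \<in> V \<Longrightarrow> \<beta> g p \<in> V"
    and one: "\<And>p. p \<in> V \<Longrightarrow> \<beta> \<one> p = p"
    and mult: "\<And>g h p. g \<in> carrier G \<Longrightarrow> h \<in> carrier G \<Longrightarrow> p \<in> V \<Longrightarrow> \<beta> (g \<otimes> h) p = \<beta> g (\<beta> h p)"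
    and dist: "\<And>g p q. g \<in> carrier G \<Longrightarrow> p \<in> V \<Longrightarrow> q \<in> V \<Longrightarrow> D (\<beta> g p) (\<beta> g q) = D p q"
    and acyl: "\<And>\<epsilon>. \<epsilon> \<ge> 0 \<Longrightarrow> \<exists>N::nat. \<exists>R. \<forall>x\<in>V. \<forall>y\<in>V. D x y \<ge> R \<longrightarrow>
      finite {g \<in> carrier G. D x (\<beta> g x) \<le> \<epsilon> \<and> D y (\<beta> g y) \<le> \<epsilon>} \<and>
      card {g \<in> carrier G. D x (\<beta> g x) \<le> \<epsilon> \<and> D y (\<beta> g y) \<le> \<epsilon>} \<le> N"
    and gh: "g \<in> carrier G" "h \<in> carrier G"
    and lox: "\<And>k. k \<in> {g, h} \<Longrightarrow> \<exists>K\<ge>1. \<exists>C\<ge>0. \<forall>m n :: int.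
        \<bar>real_of_int m - real_of_int n\<bar> / K - C \<le> D (\<beta> (k [^] m) v0) (\<beta> (k [^] n) v0) \<and>
        D (\<beta> (k [^] m) v0) (\<beta> (k [^] n) v0) \<le> K * \<bar>real_of_int m - real_of_int n\<bar> + C"
    and indep: "\<And>s t. s \<in> {1, -1} \<Longrightarrow> t \<in> {1, -1} \<Longrightarrow>
      \<not> diverges_together D v0 (\<lambda>n. \<beta> (g [^] (s * int n)) v0) (\<lambda>n. \<beta> (h [^] (t * int n)) v0)"
  shows "acylindrically_hyperbolic TYPE('g \<times> real) G"
proof -
  interpret group G by fact
  interpret pseudo_metric_space V D by fact
  interpret pseudo_metric_space_nonempty V D using v0 by unfold_locales auto
  define a where "a g f = (\<lambda>x. if x \<in> V then f (\<beta> (inv g) x) else 0)" for g and f :: "'v \<Rightarrow> real"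
  have a_tight: "a g f \<in> tight" if g: "g \<in> carrier G" and f: "f \<in> tight" for g f
  proof -
    have ig: "inv g \<in> carrier G" using g by simp
    have "D x y \<le> a g f x + a g f y" if "x \<in> V" "y \<in> V" for x y
      using upperD[OF hull_upper[OF f] closed[OF ig that(1)] closed[OF ig that(2)]] that dist[OF ig that]
      by (simp add: a_def)
    moreover have "\<exists>y\<in>V. a g f x + a g f y < D x y + e" if x: "x \<in> V" and e: "e > 0" for x e
    proof -
      obtain y where y: "y \<in> V" "f (\<beta> (inv g) x) + f y < D (\<beta> (inv g) x) y + e"
        using hull_tight[OF f closed[OF ig x] e] by blast
      have b: "\<beta> (inv g) (\<beta> g y) = y" using mult[OF ig g y(1)] g y one by simp
      have "D x (\<beta> g y) = D (\<beta> (inv g) x) y"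
        using dist[OF ig x closed[OF g y(1)]] b by simp
      then show ?thesis using y b x closed[OF g y(1)] by (intro bexI[of _ "\<beta> g y"]) (simp_all add: a_def)
    qed
    ultimately show ?thesis by (auto simp: tight_def upper_def a_def)
  qed
  have a_one: "a \<one> f = f" if "f \<in> tight" for f
    using upper_outside[OF hull_upper[OF that]] by (auto simp: a_def one)
  have a_mult: "a (g \<otimes> h) f = a g (a h f)" if "g \<in> carrier G" "h \<in> carrier G" for g h f
    using that by (auto simp: a_def inv_mult_group mult closed)
  have a_dist: "hull_dist (a g f) (a g f') = hull_dist f f'" if "g \<in> carrier G" "f \<in> tight" "f' \<in> tight" for g f f'
  proof -
    have le: "hull_dist (a g f) (a g f') \<le> hull_dist f f'" if "g \<in> carrier G" "f \<in> tight" "f' \<in> tight" for g f f'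
    proof (rule hull_dist_le)
      fix x assume "x \<in> V"
      then show "\<bar>a g f x - a g f' x\<bar> \<le> hull_dist f f'"
        using hull_dist_ge[OF that(2,3), of "\<beta> (inv g) x"] that closed by (simp add: a_def)
    qed
    have "hull_dist (a (inv g) (a g f)) (a (inv g) (a g f')) \<le> hull_dist (a g f) (a g f')"
      using that a_tight by (intro le) auto
    moreover have "a (inv g) (a g f) = f" if "f \<in> tight" for f
      using a_mult[of "inv g" g f] a_one that \<open>g \<in> carrier G\<close> by simp
    ultimately show ?thesis using le[OF that] that by simp
  qed
  have a_embed: "a g (embed v) = embed (\<beta> g v)" if "g \<in> carrier G" "v \<in> V" for g v
  proof
    fix x show "a g (embed v) x = embed (\<beta> g v) x"
    proof (cases "x \<in> V")
      case True
      have "D v (\<beta> (inv g) x) = D (\<beta> g v) (\<beta> g (\<beta> (inv g) x))"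
        using dist[of g v "\<beta> (inv g) x"] that True closed by simp
      also have "\<beta> g (\<beta> (inv g) x) = x" using mult[of g "inv g" x] that True one by simp
      finally show ?thesis using True that closed by (simp add: a_def embed_def)
    qed (simp add: a_def embed_def)
  qed
  \<comment> \<open>By tightness \<open>f\<close> lies almost between \<open>v0\<close> and some
    \<open>q\<close>. The coarse geodesic from \<open>v0\<close> to \<open>q\<close> has a point
    \<open>z\<close> at distance about \<open>f v0\<close> from \<open>v0\<close>, and the
    four-point inequality with a nearly optimal partner \<open>w\<close> of \<open>z\<close> bounds
    \<open>f z\<close>, which is the distance from \<open>z\<close> to \<open>f\<close>.\<close>
  have near: "\<exists>v\<in>V. f v \<le> 1 + \<bar>c\<bar> + 2 * \<delta>" if f: "f \<in> tight" for f
  proof -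
    obtain q where q: "q \<in> V" "f v0 + f q < D v0 q + 1" using hull_tight[OF f v0, of 1] by auto
    define t where "t = min (f v0) (D v0 q)"
    have t: "0 \<le> t" "t \<le> D v0 q" using upper_nonneg[OF hull_upper[OF f] v0] D_nonneg[OF v0 q(1)] by (auto simp: t_def)
    obtain z where z: "z \<in> V" "D v0 z \<le> t + c" "D z q \<le> D v0 q - t + c" using coarse[OF v0 q(1) t] by blast
    have up: "D v0 q \<le> f v0 + f q" using upperD[OF hull_upper[OF f] v0 q(1)] .
    have z': "D v0 z \<le> f v0 + c" "D z q \<le> f q + c"
      using z up upper_nonneg[OF hull_upper[OF f] q(1)] by (auto simp: t_def min_def split: if_splits)
    have "f z \<le> 1 + c + 2 * \<delta>"
    proof (rule field_le_epsilon)
      fix e :: real assume "e > 0"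
      then obtain w where w: "w \<in> V" "f z + f w < D z w + e" using hull_tight[OF f z(1)] by blast
      have "D z w + D v0 q \<le> max (D z v0 + D w q) (D z q + D w v0) + 2 * \<delta>"
        by (rule four_pointD[OF hyp z(1) w(1) v0 q(1)])
      then show "f z \<le> 1 + c + 2 * \<delta> + e"
        using w z' q(2) upperD[OF hull_upper[OF f] w(1) q(1)] upperD[OF hull_upper[OF f] w(1) v0] D_sym[OF v0 z(1)]
        unfolding max_def by argo
    qed
    then show ?thesis using z(1) by force
  qed
  obtain e :: "('v \<Rightarrow> real) \<Rightarrow> real" where e: "inj_on e {f. \<forall>x. x \<notin> V \<longrightarrow> f x = 0}"
    using functions_on_countable_into_reals[OF \<open>countable V\<close>] .
  \<comment> \<open>The first component is a dummy; \<open>e\<close> already separates the points of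
    the hull.\<close>
  define \<iota> :: "('v \<Rightarrow> real) \<Rightarrow> 'g \<times> real" where "\<iota> f = (\<one>, e f)" for f
  define M where "M = \<iota> ` tight"
  define \<kappa> where "\<kappa> = inv_into tight \<iota>"
  have "inj_on \<iota> tight"
    by (rule inj_onI) (use e upper_outside[OF hull_upper] in \<open>auto simp: \<iota>_def inj_on_def\<close>)
  then have \<kappa>\<iota> [simp]: "\<kappa> (\<iota> f) = f" if "f \<in> tight" for f using that by (simp add: \<kappa>_def)
  have \<kappa>_mem [simp]: "\<kappa> x \<in> tight" if "x \<in> M" for x using that by (auto simp: M_def)
  have \<iota>_mem [simp]: "\<iota> f \<in> M" if "f \<in> tight" for f using that by (simp add: M_def)
  have \<iota>\<kappa> [simp]: "\<iota> (\<kappa> x) = x" if "x \<in> M" for x using that by (auto simp: M_def)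
  define d where "d x y = hull_dist (\<kappa> x) (\<kappa> y)" for x y
  define b where "b g x = \<iota> (a g (\<kappa> x))" for g x
  define \<alpha> where "\<alpha> g = restrict (b g) M" for g
  have "Metric_space M d"
  proof
    show "0 \<le> d x y" "d x y = d y x" for x y by (simp_all add: d_def tight.commute)
    show "d x y = 0 \<longleftrightarrow> x = y" if "x \<in> M" "y \<in> M" for x y
      using that tight.zero[of "\<kappa> x" "\<kappa> y"] \<iota>\<kappa> by (metis \<kappa>_mem d_def)
    show "d x z \<le> d x y + d y z" if "x \<in> M" "y \<in> M" "z \<in> M" for x y z
      using that by (simp add: d_def tight.triangle)
  qed
  interpret act: isometric_group_action G M d \<alpha>
  proof (intro isometric_group_action.intro isometric_group_action_axioms.intro)
    show "group G" "Metric_space M d" by fact+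
    show "\<alpha> g x \<in> M" if "g \<in> carrier G" "x \<in> M" for g x
      using that by (simp add: \<alpha>_def b_def a_tight)
    show "\<alpha> \<one> x = x" if "x \<in> M" for x using that by (simp add: \<alpha>_def b_def a_one)
    show "\<alpha> (g \<otimes> h) x = \<alpha> g (\<alpha> h x)" if "g \<in> carrier G" "h \<in> carrier G" "x \<in> M" for g h x
      using that by (simp add: \<alpha>_def b_def a_mult a_tight)
    show "d (\<alpha> g x) (\<alpha> g y) = d x y" if "g \<in> carrier G" "x \<in> M" "y \<in> M" for g x y
      using that by (simp add: \<alpha>_def b_def d_def a_dist a_tight)
  qed
  have four: "four_point M d \<delta>"
    using four_point_hull[OF hyp] by (simp add: four_point_def d_def)
  have "geodesic_space M d"
  proof -
    have "\<exists>\<gamma>. \<gamma> \<in> {0..d x y} \<rightarrow> M \<and> \<gamma> 0 = x \<and> \<gamma> (d x y) = y \<and>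
        (\<forall>s\<in>{0..d x y}. \<forall>t\<in>{0..d x y}. d (\<gamma> s) (\<gamma> t) = \<bar>s - t\<bar>)" if xy: "x \<in> M" "y \<in> M" for x y
    proof -
      obtain \<gamma> where "\<gamma> \<in> {0..d x y} \<rightarrow> tight" "\<gamma> 0 = \<kappa> x" "\<gamma> (d x y) = \<kappa> y"
        "\<forall>s\<in>{0..d x y}. \<forall>t\<in>{0..d x y}. hull_dist (\<gamma> s) (\<gamma> t) = \<bar>s - t\<bar>"
        using geodesic_space_hull[unfolded geodesic_space_def, THEN conjunct2, rule_format, OF \<kappa>_mem \<kappa>_mem, OF xy]
        unfolding d_def by blast
      then show ?thesis using xy by (intro exI[of _ "\<iota> \<circ> \<gamma>"]) (auto simp: d_def Pi_iff)
    qed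
    with \<open>Metric_space M d\<close> show ?thesis by (simp add: geodesic_space_def)
  qed
  then have hyperbolic: "hyperbolic_space \<delta> M d" using four \<delta> by (simp add: hyperbolic_space_iff)
  have iso: "isometric_action G M d \<alpha>"
  proof -
    have "group_action G M (\<lambda>g. restrict (b g) M)"
      by (rule group_actionI) (auto simp: b_def a_tight a_one a_mult group_axioms)
    then have "group_action G M \<alpha>" by (simp add: \<alpha>_def[abs_def])
    then show ?thesis by (simp add: isometric_action_def \<open>Metric_space M d\<close>)
  qed
  have "acylindrical_action G M d \<alpha>"
    unfolding acylindrical_action_def
  proof (intro conjI iso allI impI)
    fix \<epsilon> :: real assume "0 \<le> \<epsilon>"
    define C where "C = 1 + \<bar>c\<bar> + 2 * \<delta>"
    have C: "C \<ge> 0" using \<delta> by (simp add: C_def)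
    obtain N R where NR: "\<And>x y. x \<in> V \<Longrightarrow> y \<in> V \<Longrightarrow> D x y \<ge> R \<Longrightarrow>
      finite {g \<in> carrier G. D x (\<beta> g x) \<le> \<epsilon> + 2 * C \<and> D y (\<beta> g y) \<le> \<epsilon> + 2 * C} \<and>
      card {g \<in> carrier G. D x (\<beta> g x) \<le> \<epsilon> + 2 * C \<and> D y (\<beta> g y) \<le> \<epsilon> + 2 * C} \<le> N"
    proof -
      have "0 \<le> \<epsilon> + 2 * C" using \<open>0 \<le> \<epsilon>\<close> C by simp
      from acyl[OF this] that show thesis by blast
    qed
    have "finite {g \<in> carrier G. d x (\<alpha> g x) \<le> \<epsilon> \<and> d y (\<alpha> g y) \<le> \<epsilon>} \<and>
           card {g \<in> carrier G. d x (\<alpha> g x) \<le> \<epsilon> \<and> d y (\<alpha> g y) \<le> \<epsilon>} \<le> max 1 N"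
      if xy: "x \<in> M" "y \<in> M" and R: "d x y \<ge> max 1 (R + 2 * C)" for x y
    proof -
      obtain v where v: "v \<in> V" "(\<kappa> x) v \<le> C" using near[of "\<kappa> x"] xy by (auto simp: C_def)
      obtain w where w: "w \<in> V" "(\<kappa> y) w \<le> C" using near[of "\<kappa> y"] xy by (auto simp: C_def)
      have dv: "hull_dist (embed v) (\<kappa> x) \<le> C" "hull_dist (embed w) (\<kappa> y) \<le> C"
        using v w xy by (simp_all add: hull_dist_embed)
      have "d x y \<le> hull_dist (\<kappa> x) (embed v) + (hull_dist (embed v) (embed w) + hull_dist (embed w) (\<kappa> y))"
        using tight.triangle[of "\<kappa> x" "embed v" "\<kappa> y"] tight.triangle[of "embed v" "embed w" "\<kappa> y"] v w xy
        by (simp add: d_def embed_hull)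
      then have "D v w \<ge> R" using R dv v w by (simp add: hull_dist_embed_embed tight.commute)
      note fin = NR[OF v(1) w(1) this]
      have mv: "D v (\<beta> g v) \<le> \<epsilon> + 2 * C"
        if v: "v \<in> V" "hull_dist (embed v) (\<kappa> x) \<le> C" and x: "x \<in> M" "d x (\<alpha> g x) \<le> \<epsilon>" and g: "g \<in> carrier G"
        for g v x
      proof -
        have "D v (\<beta> g v) = hull_dist (embed v) (a g (embed v))"
          using v g by (simp add: a_embed hull_dist_embed_embed closed)
        also have "\<dots> \<le> hull_dist (embed v) (\<kappa> x) + (hull_dist (\<kappa> x) (a g (\<kappa> x)) + hull_dist (a g (\<kappa> x)) (a g (embed v)))"
          using tight.triangle[of "embed v" "\<kappa> x" "a g (embed v)"] tight.triangle[of "\<kappa> x" "a g (\<kappa> x)" "a g (embed v)"] v g x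
          by (simp add: embed_hull a_tight)
        also have "hull_dist (a g (\<kappa> x)) (a g (embed v)) = hull_dist (embed v) (\<kappa> x)"
          using a_dist[OF g] v x by (simp add: embed_hull tight.commute)
        also have "hull_dist (\<kappa> x) (a g (\<kappa> x)) \<le> \<epsilon>" using x g by (simp add: d_def \<alpha>_def b_def a_tight)
        finally show ?thesis using v by linarith
      qed
      have "{g \<in> carrier G. d x (\<alpha> g x) \<le> \<epsilon> \<and> d y (\<alpha> g y) \<le> \<epsilon>} \<subseteq>
        {g \<in> carrier G. D v (\<beta> g v) \<le> \<epsilon> + 2 * C \<and> D w (\<beta> g w) \<le> \<epsilon> + 2 * C}"
        using mv[OF v(1) dv(1) xy(1)] mv[OF w(1) dv(2) xy(2)] by blast
      with fin show ?thesis by (meson card_mono finite_subset max.coboundedI2 order_trans)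
    qed
    then show "\<exists>N R. N > 0 \<and> R > 0 \<and> (\<forall>x\<in>M. \<forall>y\<in>M. R \<le> d x y \<longrightarrow>
        finite {g \<in> carrier G. d x (\<alpha> g x) \<le> \<epsilon> \<and> d y (\<alpha> g y) \<le> \<epsilon>} \<and>
        card {g \<in> carrier G. d x (\<alpha> g x) \<le> \<epsilon> \<and> d y (\<alpha> g y) \<le> \<epsilon>} \<le> N)"
      by (intro exI[of _ "max 1 N"] exI[of _ "max 1 (R + 2 * C)"]) auto
  qed
  moreover
  define x0 where "x0 = \<iota> (embed v0)"
  have x0: "x0 \<in> M" using v0 embed_hull by (simp add: x0_def)
  have act_x0: "\<alpha> g x0 = \<iota> (embed (\<beta> g v0))" if "g \<in> carrier G" for g
    using that v0 by (simp add: \<alpha>_def x0_def b_def embed_hull a_embed)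
  have d_x0: "d (\<alpha> g x0) (\<alpha> h x0) = D (\<beta> g v0) (\<beta> h v0)" if "g \<in> carrier G" "h \<in> carrier G" for g h
    using that v0 by (simp add: act_x0 d_def embed_hull closed hull_dist_embed_embed)
  have loxo: "loxodromic G M d \<alpha> k" if "k \<in> {g, h}" for k
  proof -
    have "k \<in> carrier G" using that gh by auto
    then show ?thesis unfolding loxodromic_def using x0 lox[OF that] by (intro conjI bexI[of _ x0]) (simp_all add: d_x0)
  qed
  have "independent_loxodromics G M d \<alpha> g h"
  proof (rule act.independent_loxodromicsI[OF four loxo loxo x0])
    fix s t :: int assume st: "s \<in> {1, -1}" "t \<in> {1, -1}"
    have "d x0 (\<alpha> g x0) = D v0 (\<beta> g v0)" if "g \<in> carrier G" for g
      using d_x0[OF one_closed that] x0 v0 one by simp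
    then have "gromov_product d x0 (act.orbit_seq g s x0 m) (act.orbit_seq h t x0 n)
      = gromov_product D v0 (\<beta> (g [^] (s * int m)) v0) (\<beta> (h [^] (t * int n)) v0)" for m n
      using gh by (simp add: gromov_product_def act.orbit_seq_def d_x0)
    then show "\<not> diverges_together d x0 (act.orbit_seq g s x0) (act.orbit_seq h t x0)"
      using indep[OF st] by (simp add: diverges_together_def)
  qed auto
  ultimately show ?thesis unfolding acylindrically_hyperbolic_def using hyperbolic by blast
qed

section \<open>Discriminating homomorphisms\<close>

lemma not_successively_split:
  "\<not> successively P w \<Longrightarrow> \<exists>u a b v. w = u @ a # b # v \<and> \<not> P a b"
proof (induction w rule: induct_list012)
  case (3 x y zs)
  show ?case
  proof (cases "P x y")
    case True
    with 3 obtain u a b v where "y # zs = u @ a # b # v" "\<not> P a b" by auto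
    then show ?thesis by (intro exI[of _ "x # u"]) auto
  next
    case False
    then show ?thesis by (intro exI[of _ "[]"]) auto
  qed
qed auto

lemma word_value_cong:
  "(\<And>i. i \<in> fst ` set w \<Longrightarrow> x i = y i) \<Longrightarrow> word_value G x w = word_value G y w"
  by (induction w) auto

section \<open>Words, inverses and free reduction\<close>

definition inv_word :: "word \<Rightarrow> word" where
  "inv_word w = rev (map (\<lambda>(i, b). (i, \<not> b)) w)"

lemma fst_set_inv_word [simp]: "fst ` set (inv_word w) = fst ` set w"
  by (force simp: inv_word_def image_iff)

context group
begin

lemma word_value_closed [simp]:
  "(\<And>i. i \<in> fst ` set w \<Longrightarrow> x i \<in> carrier G) \<Longrightarrow> word_value G x w \<in> carrier G"
  by (induction w) auto

lemma word_value_append: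
  "(\<And>i. i \<in> fst ` set (u @ v) \<Longrightarrow> x i \<in> carrier G) \<Longrightarrow>
    word_value G x (u @ v) = word_value G x u \<otimes> word_value G x v"
  by (induction u) (auto simp: m_assoc image_Un)

lemma word_value_inv_word:
  "(\<And>i. i \<in> fst ` set w \<Longrightarrow> x i \<in> carrier G) \<Longrightarrow> word_value G x (inv_word w) = inv (word_value G x w)"
proof (induction w)
  case (Cons a w)
  obtain i b where a: "a = (i, b)" by fastforce
  have "word_value G x (inv_word w @ [(i, \<not> b)]) = inv (word_value G x w) \<otimes> word_value G x [(i, \<not> b)]"
  proof (subst word_value_append)
    show "x j \<in> carrier G" if "j \<in> fst ` set (inv_word w @ [(i, \<not> b)])" for j
      using that Cons.prems a by (simp add: image_Un)
    show "word_value G x (inv_word w) \<otimes> word_value G x [(i, \<not> b)] = inv (word_value G x w) \<otimes> word_value G x [(i, \<not> b)]"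
      using Cons by simp
  qed
  then show ?case using Cons.prems a by (auto simp: inv_word_def inv_mult_group)
qed (simp add: inv_word_def)

text \<open>The Noetherian property speaks of reduced words only, whereas products of chosen words
  need not be reduced. The reduced word is the same for all assignments, so it can express a
  relation of \<open>G\<close> and then be evaluated in \<open>H\<close>.\<close>

lemma free_reduction:
  "\<exists>w'. fst ` set w' \<subseteq> fst ` set w \<and> successively (\<lambda>a b. \<not> (fst a = fst b \<and> snd a \<noteq> snd b)) w' \<and>
    (\<forall>x. (\<forall>i\<in>fst ` set w. x i \<in> carrier G) \<longrightarrow> word_value G x w' = word_value G x w)"
proof (induction "length w" arbitrary: w rule: less_induct)
  case less
  show ?case
  proof (cases "successively (\<lambda>a b. \<not> (fst a = fst b \<and> snd a \<noteq> snd b)) w")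
    case False
    then obtain u i b v where w: "w = u @ (i, b) # (i, \<not> b) # v"
    proof -
      obtain u a c v where "w = u @ a # c # v" "fst a = fst c" "snd a \<noteq> snd c"
        using not_successively_split[OF False] by blast
      then show thesis using that[of u "fst a" "snd a" v] by (cases a; cases c) auto
    qed
    obtain w' where w': "fst ` set w' \<subseteq> fst ` set (u @ v)"
      "successively (\<lambda>a b. \<not> (fst a = fst b \<and> snd a \<noteq> snd b)) w'"
      "\<And>x. (\<forall>i\<in>fst ` set (u @ v). x i \<in> carrier G) \<Longrightarrow> word_value G x w' = word_value G x (u @ v)"
      using less[of "u @ v"] w by auto
    have "word_value G x w' = word_value G x w" if x: "\<forall>i\<in>fst ` set w. x i \<in> carrier G" for x
    proof -
      have xi: "x i \<in> carrier G" and v: "word_value G x v \<in> carrier G" using x by (auto simp: w intro!: word_value_closed)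
      have "word_value G x w = word_value G x u \<otimes> word_value G x ((i, b) # (i, \<not> b) # v)"
        unfolding w by (rule word_value_append) (use x in \<open>auto simp: w\<close>)
      also have "word_value G x ((i, b) # (i, \<not> b) # v) = word_value G x v"
        using xi v by (cases b) (simp_all flip: m_assoc)
      also have "word_value G x u \<otimes> word_value G x v = word_value G x (u @ v)"
        by (rule word_value_append[symmetric]) (use x in \<open>auto simp: w\<close>)
      finally show ?thesis using w'(3)[of x] x by (simp add: w)
    qed
    with w' show ?thesis by (intro exI[of _ w']) (auto simp: w)
  qed blast
qed

lemma generate_words:
  assumes "g \<in> generate G (s ` {..<k})" and s: "\<And>i. i < k \<Longrightarrow> s i \<in> carrier G"
  shows "\<exists>w. fst ` set w \<subseteq> {..<k} \<and> word_value G s w = g"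
  using assms(1)
proof induction
  case one
  show ?case by (intro exI[of _ "[]"]) simp
next
  case (incl h)
  then obtain i where "i < k" "h = s i" by auto
  then show ?case using s by (intro exI[of _ "[(i, True)]"]) simp
next
  case (inv h)
  then obtain i where "i < k" "h = s i" by auto
  then show ?case using s by (intro exI[of _ "[(i, False)]"]) simp
next
  case (eng h1 h2)
  then obtain u v where "fst ` set u \<subseteq> {..<k}" "word_value G s u = h1" "fst ` set v \<subseteq> {..<k}" "word_value G s v = h2"
    by blast
  moreover from this have "word_value G s (u @ v) = word_value G s u \<otimes> word_value G s v"
    using s by (intro word_value_append) (auto simp: image_Un)
  ultimately show ?case by (intro exI[of _ "u @ v"]) (simp add: image_Un)
qed

lemma word_value_subgroup:
  assumes "subgroup H G" "\<And>i. i \<in> fst ` set w \<Longrightarrow> x i \<in> H"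
  shows "word_value (G\<lparr>carrier := H\<rparr>) x w = word_value G x w"
  using assms(2) by (induction w) (auto simp: m_inv_consistent[OF assms(1)])

end

section \<open>Finite systems as existential formulas\<close>

fun word_term :: "word \<Rightarrow> gterm" where
  "word_term [] = One"
| "word_term ((i, b) # w) = Mult (if b then Var i else Inv (Var i)) (word_term w)"

lemma term_value_word_term: "term_value G h (word_term w) = word_value G h w"
  by (induction w) auto

definition conjunction :: "gformula list \<Rightarrow> gformula" where
  "conjunction \<phi>s = foldr Conj \<phi>s (Eq One One)"

lemma satisfies_conjunction: "satisfies G h (conjunction \<phi>s) \<longleftrightarrow> (\<forall>\<phi>\<in>set \<phi>s. satisfies G h \<phi>)"
  by (induction \<phi>s) (auto simp: conjunction_def)

lemma quantifier_free_conjunction: "quantifier_free (conjunction \<phi>s) \<longleftrightarrow> (\<forall>\<phi>\<in>set \<phi>s. quantifier_free \<phi>)"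
  by (induction \<phi>s) (auto simp: conjunction_def)

primrec exists_below :: "nat \<Rightarrow> gformula \<Rightarrow> gformula" where
  "exists_below 0 \<phi> = \<phi>"
| "exists_below (Suc k) \<phi> = Ex k (exists_below k \<phi>)"

lemma existential_exists_below: "quantifier_free \<phi> \<Longrightarrow> existential (exists_below k \<phi>)"
  by (induction k) (auto intro: existential.intros)

lemma satisfies_exists_below:
  "satisfies G h (exists_below k \<phi>) \<longleftrightarrow>
    (\<exists>y. (\<forall>i<k. y i \<in> carrier G) \<and> (\<forall>i\<ge>k. y i = h i) \<and> satisfies G y \<phi>)"
proof (induction k arbitrary: h)
  case 0
  have "y = h" if "\<forall>i\<ge>0::nat. y i = h i" for y using that by auto
  then show ?case by auto
next
  case (Suc k)
  have eq: "(\<exists>a\<in>carrier G. (\<forall>i<k. y i \<in> carrier G) \<and> (\<forall>i\<ge>k. y i = (h(k := a)) i) \<and> satisfies G y \<phi>) \<longleftrightarrow>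
    (\<forall>i<Suc k. y i \<in> carrier G) \<and> (\<forall>i\<ge>Suc k. y i = h i) \<and> satisfies G y \<phi>" for y
  proof
    assume y: "(\<forall>i<Suc k. y i \<in> carrier G) \<and> (\<forall>i\<ge>Suc k. y i = h i) \<and> satisfies G y \<phi>"
    then have "y i = h i" if "k < i" for i using that by (simp add: Suc_leI)
    with y show "\<exists>a\<in>carrier G. (\<forall>i<k. y i \<in> carrier G) \<and> (\<forall>i\<ge>k. y i = (h(k := a)) i) \<and> satisfies G y \<phi>"
      by (intro bexI[of _ "y k"]) (auto simp: le_less)
  qed (auto simp: less_Suc_eq)
  have "satisfies G h (exists_below (Suc k) \<phi>) \<longleftrightarrow>
    (\<exists>y. \<exists>a\<in>carrier G. (\<forall>i<k. y i \<in> carrier G) \<and> (\<forall>i\<ge>k. y i = (h(k := a)) i) \<and> satisfies G y \<phi>)"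
    by (simp only: exists_below.simps satisfies.simps Suc.IH) blast
  then show ?case by (simp only: eq)
qed

text \<open>The relators of \<open>G\<close> in its generators form a system that over
  \<open>H\<close> is equivalent to a finite part. The generators show that \<open>G\<close>
  satisfies the formula asking for a solution of this part that keeps \<open>E\<close> nontrivial
  and represents \<open>h1\<close> and \<open>h2\<close> by their words. A solution in
  \<open>H\<close> then satisfies all relators and defines a homomorphism.\<close>

lemma (in group) discriminating_hom:
  assumes fg: "finitely_generated_group G" and H: "subgroup H G"
    and noeth: "equationally_noetherian (G\<lparr>carrier := H\<rparr>)"
    and ec: "existentially_closed_in H G"
    and h: "h1 \<in> H" "h2 \<in> H" and E: "finite E" "E \<subseteq> carrier G" "\<one> \<notin> E"
  shows "\<exists>\<phi>. \<phi> \<in> hom G (G\<lparr>carrier := H\<rparr>) \<and> \<phi> h1 = h1 \<and> \<phi> h2 = h2 \<and> (\<forall>g\<in>E. \<phi> g \<noteq> \<one>)"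
proof -
  have HG: "H \<subseteq> carrier G" using H by (simp add: subgroup.subset)
  obtain S where S: "finite S" "S \<subseteq> carrier G" "generate G S = carrier G"
    using fg by (auto simp: finitely_generated_group_def)
  obtain s0 k where s0: "S = s0 ` {..<k::nat}" using finite_imp_nat_seg_image_inj_on[OF S(1)] unfolding lessThan_def by blast
  define s where "s = restrict s0 {..<k}"
  have s: "s i \<in> carrier G" if "i < k" for i using that s0 S by (auto simp: s_def)
  have "s ` {..<k} = S" using s0 by (auto simp: s_def)
  then have "\<forall>g\<in>carrier G. \<exists>w. fst ` set w \<subseteq> {..<k} \<and> word_value G s w = g"
    using generate_words[of _ s k] S s by auto
  then obtain W where W: "\<And>g. g \<in> carrier G \<Longrightarrow> fst ` set (W g) \<subseteq> {..<k} \<and> word_value G s (W g) = g" by metis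
  define \<Sigma> where "\<Sigma> = {w \<in> free_group_words k. word_value G s w = \<one>}"
  have "\<exists>\<Sigma>\<^sub>0. \<Sigma>\<^sub>0 \<subseteq> \<Sigma> \<and> finite \<Sigma>\<^sub>0 \<and>
    solutions (G\<lparr>carrier := H\<rparr>) k \<Sigma> = solutions (G\<lparr>carrier := H\<rparr>) k \<Sigma>\<^sub>0"
  \<comment> \<open>The Noetherian property is stated for infinite systems; a finite one is its own
    finite part.\<close>
  proof (cases "finite \<Sigma>")
    case False
    then have "\<Sigma> \<subseteq> free_group_words k \<and> infinite \<Sigma>" by (auto simp: \<Sigma>_def)
    then show ?thesis by (rule noeth[unfolded equationally_noetherian_def, rule_format])
  qed auto
  then obtain \<Sigma>\<^sub>0 where \<Sigma>\<^sub>0: "\<Sigma>\<^sub>0 \<subseteq> \<Sigma>" "finite \<Sigma>\<^sub>0"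
    "solutions (G\<lparr>carrier := H\<rparr>) k \<Sigma> = solutions (G\<lparr>carrier := H\<rparr>) k \<Sigma>\<^sub>0" by blast
  obtain ws where ws: "set ws = \<Sigma>\<^sub>0" using \<Sigma>\<^sub>0(2) finite_list by blast
  obtain es where es: "set es = E" using E(1) finite_list by blast
  \<comment> \<open>Variables below \<open>k\<close> will be quantified; \<open>k\<close> and
    \<open>Suc k\<close> remain free and carry the parameters \<open>h1\<close> and
    \<open>h2\<close>.\<close>
  define \<phi> where "\<phi> = conjunction (map (\<lambda>w. Eq (word_term w) One) ws @ map (\<lambda>g. Neg (Eq (word_term (W g)) One)) es
    @ [Eq (word_term (W h1)) (Var k), Eq (word_term (W h2)) (Var (Suc k))])"
  have \<phi>: "satisfies G' y \<phi> \<longleftrightarrow> (\<forall>w\<in>\<Sigma>\<^sub>0. word_value G' y w = \<one>\<^bsub>G'\<^esub>) \<and> (\<forall>g\<in>E. word_value G' y (W g) \<noteq> \<one>\<^bsub>G'\<^esub>) \<and>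
    word_value G' y (W h1) = y k \<and> word_value G' y (W h2) = y (Suc k)" for G' :: "('a, 'b) monoid_scheme" and y
    by (simp add: \<phi>_def satisfies_conjunction term_value_word_term ws es ball_Un) blast
  have "existential (exists_below k \<phi>)"
    by (intro existential_exists_below) (auto simp: \<phi>_def quantifier_free_conjunction)
  moreover define a where "a i = (if i = k then h1 else if i = Suc k then h2 else \<one>)" for i
  moreover have "range a \<subseteq> H" using h H by (auto simp: a_def subgroup.one_closed)
  ultimately have iff: "satisfies (G\<lparr>carrier := H\<rparr>) a (exists_below k \<phi>) \<longleftrightarrow> satisfies G a (exists_below k \<phi>)"
    using ec unfolding existentially_closed_in_def by blast
  have "satisfies G a (exists_below k \<phi>)"
    unfolding satisfies_exists_below
  proof (intro exI[of _ "\<lambda>i. if i < k then s i else a i"] conjI)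
    have eq: "word_value G (\<lambda>i. if i < k then s i else a i) w = word_value G s w" if "fst ` set w \<subseteq> {..<k}" for w
      by (rule word_value_cong) (use that in auto)
    show "satisfies G (\<lambda>i. if i < k then s i else a i) \<phi>"
      unfolding \<phi>
    proof (intro conjI ballI)
      fix w assume "w \<in> \<Sigma>\<^sub>0"
      then have "w \<in> \<Sigma>" using \<Sigma>\<^sub>0(1) by blast
      then show "word_value G (\<lambda>i. if i < k then s i else a i) w = \<one>" by (auto simp: \<Sigma>_def eq free_group_words_def)
    next
      fix g assume "g \<in> E"
      then show "word_value G (\<lambda>i. if i < k then s i else a i) (W g) \<noteq> \<one>" using W[of g] E by (auto simp: eq)
    qed (use W h HG in \<open>auto simp: eq a_def\<close>)
  qed (use s in auto)
  with iff obtain y where y: "\<And>i. i < k \<Longrightarrow> y i \<in> H" "\<And>i. i \<ge> k \<Longrightarrow> y i = a i" "satisfies (G\<lparr>carrier := H\<rparr>) y \<phi>"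
    unfolding satisfies_exists_below by auto
  have yG: "y i \<in> carrier G" if "i < k" for i using y(1) HG that by blast
  have val: "word_value (G\<lparr>carrier := H\<rparr>) y w = word_value G y w" if "fst ` set w \<subseteq> {..<k}" for w
    by (rule word_value_subgroup[OF H]) (use that y in auto)
  have valH: "word_value G y w \<in> H" if "fst ` set w \<subseteq> {..<k}" for w
  proof -
    interpret HH: group "G\<lparr>carrier := H\<rparr>" using H subgroup_imp_group by blast
    show ?thesis using HH.word_value_closed[of w y] that y val[OF that] by auto
  qed
  have relator: "word_value G y w = \<one>" if "w \<in> \<Sigma>" for w
  proof -
    \<comment> \<open>\<open>solutions\<close> consists of extensional functions, so the parameters
      stored in \<open>y\<close> from \<open>k\<close> on are cut off.\<close>
    have "restrict y {..<k} \<in> solutions (G\<lparr>carrier := H\<rparr>) k \<Sigma>\<^sub>0"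
    proof -
      have "word_value (G\<lparr>carrier := H\<rparr>) (restrict y {..<k}) w = \<one>" if "w \<in> \<Sigma>\<^sub>0" for w
      proof -
        have "fst ` set w \<subseteq> {..<k}" using that \<Sigma>\<^sub>0 by (auto simp: \<Sigma>_def free_group_words_def)
        then have "word_value (G\<lparr>carrier := H\<rparr>) (restrict y {..<k}) w = word_value (G\<lparr>carrier := H\<rparr>) y w"
          by (intro word_value_cong) auto
        then show ?thesis using y(3) that by (simp add: \<phi>)
      qed
      then show ?thesis using y(1) by (auto simp: solutions_def)
    qed
    then have "restrict y {..<k} \<in> solutions (G\<lparr>carrier := H\<rparr>) k \<Sigma>" by (simp only: \<Sigma>\<^sub>0(3))
    then have "word_value (G\<lparr>carrier := H\<rparr>) (restrict y {..<k}) w = \<one>"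
      using that by (simp add: solutions_def)
    moreover have w: "fst ` set w \<subseteq> {..<k}" using that by (auto simp: \<Sigma>_def free_group_words_def)
    moreover have "word_value (G\<lparr>carrier := H\<rparr>) (restrict y {..<k}) w = word_value (G\<lparr>carrier := H\<rparr>) y w"
      using w by (intro word_value_cong) auto
    ultimately show ?thesis by (simp add: val)
  qed
  \<comment> \<open>Relations between generators hold between the \<open>y i\<close>: the reduced
    form of \<open>u\<close> times the inverse of \<open>v\<close> is a relator. This makes the map
    below multiplicative although \<open>W\<close> chooses words arbitrarily.\<close>
  have transfer: "word_value G y u = word_value G y v"
    if uv: "fst ` set u \<subseteq> {..<k}" "fst ` set v \<subseteq> {..<k}" "word_value G s u = word_value G s v" for u v
  proof -
    let ?w = "u @ inv_word v"
    have vc: "word_value G x u \<in> carrier G" "word_value G x v \<in> carrier G"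
      "word_value G x ?w = word_value G x u \<otimes> inv (word_value G x v)"
      if "\<And>i. i < k \<Longrightarrow> x i \<in> carrier G" for x
    proof -
      show "word_value G x u \<in> carrier G" "word_value G x v \<in> carrier G" using uv that by (auto intro!: word_value_closed)
      have "word_value G x ?w = word_value G x u \<otimes> word_value G x (inv_word v)"
        by (rule word_value_append) (use uv that in \<open>auto simp: image_Un\<close>)
      also have "word_value G x (inv_word v) = inv (word_value G x v)"
        by (rule word_value_inv_word) (use uv that in auto)
      finally show "word_value G x ?w = word_value G x u \<otimes> inv (word_value G x v)" .
    qed
    obtain w' where w': "fst ` set w' \<subseteq> fst ` set ?w" "successively (\<lambda>a b. \<not> (fst a = fst b \<and> snd a \<noteq> snd b)) w'"
      "\<And>x. (\<forall>i\<in>fst ` set ?w. x i \<in> carrier G) \<Longrightarrow> word_value G x w' = word_value G x ?w"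
      using free_reduction[of ?w] by blast
    have k: "fst ` set ?w \<subseteq> {..<k}" using uv by (simp add: image_Un)
    have "word_value G s w' = \<one>" using w'(3)[of s] k s vc[of s] uv by auto
    then have "w' \<in> \<Sigma>" using w' k by (auto simp: \<Sigma>_def free_group_words_def)
    then have "word_value G y u \<otimes> inv (word_value G y v) = \<one>" using relator w'(3)[of y] k yG vc(3)[of y] by fastforce
    then show ?thesis using vc[of y] yG by (metis inv_equality inv_inv inv_closed)
  qed
  define f where "f g = word_value G y (W g)" for g
  have "f \<in> hom G (G\<lparr>carrier := H\<rparr>)"
  proof (rule homI)
    fix g g' assume g: "g \<in> carrier G" "g' \<in> carrier G"
    show "f g \<in> carrier (G\<lparr>carrier := H\<rparr>)" using W[OF g(1)] valH by (simp add: f_def)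
    have "f (g \<otimes> g') = word_value G y (W g @ W g')"
      unfolding f_def
    proof (rule transfer)
      show "word_value G s (W (g \<otimes> g')) = word_value G s (W g @ W g')"
        using W[of "g \<otimes> g'"] W[OF g(1)] W[OF g(2)] g s by (subst word_value_append) auto
    qed (use W g in \<open>auto simp: image_Un\<close>)
    also have "\<dots> = f g \<otimes> f g'"
      unfolding f_def by (rule word_value_append) (use W g yG in \<open>auto simp: image_Un\<close>)
    finally show "f (g \<otimes> g') = f g \<otimes>\<^bsub>G\<lparr>carrier := H\<rparr>\<^esub> f g'" by simp
  qed
  moreover have f: "f g = word_value (G\<lparr>carrier := H\<rparr>) y (W g)" if "g \<in> carrier G" for g
    using W[OF that] by (simp add: f_def val)
  have "f h1 = h1" "f h2 = h2" "\<forall>g\<in>E. f g \<noteq> \<one>"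
    using y(2,3) h HG E by (auto simp: \<phi> f a_def subset_iff)
  ultimately show ?thesis by blast
qed

lemma (in group) countable_carrier:
  assumes fg: "finitely_generated_group G"
  shows "countable (carrier G)"
proof -
  obtain S where S: "finite S" "S \<subseteq> carrier G" "generate G S = carrier G"
    using fg by (auto simp: finitely_generated_group_def)
  obtain s k where s: "S = s ` {..<k::nat}" using finite_imp_nat_seg_image_inj_on[OF S(1)] unfolding lessThan_def by blast
  have "carrier G \<subseteq> range (word_value G s)"
    using generate_words[of _ s k] S s by fastforce
  then show ?thesis by (meson countableI_type countable_image countable_subset)
qed

lemma (in group) discriminating_sequence:
  assumes fg: "finitely_generated_group G" and H: "subgroup H G"
    and noeth: "equationally_noetherian (G\<lparr>carrier := H\<rparr>)"
    and ec: "existentially_closed_in H G" and h: "h1 \<in> H" "h2 \<in> H"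
  obtains \<phi> :: "nat \<Rightarrow> 'a \<Rightarrow> 'a" where "\<And>n. \<phi> n \<in> hom G (G\<lparr>carrier := H\<rparr>)"
    "\<And>n. \<phi> n h1 = h1" "\<And>n. \<phi> n h2 = h2"
    "\<And>g. g \<in> carrier G \<Longrightarrow> g \<noteq> \<one> \<Longrightarrow> eventually (\<lambda>n. \<phi> n g \<noteq> \<one>) sequentially"
proof -
  define E where "E n = from_nat_into (carrier G) ` {..n} - {\<one>}" for n
  have ne: "carrier G \<noteq> {}" by blast
  have "\<exists>\<phi>. \<phi> \<in> hom G (G\<lparr>carrier := H\<rparr>) \<and> \<phi> h1 = h1 \<and> \<phi> h2 = h2 \<and> (\<forall>g\<in>E n. \<phi> g \<noteq> \<one>)" for n
    by (rule discriminating_hom[OF fg H noeth ec h]) (use from_nat_into[OF ne] in \<open>auto simp: E_def\<close>)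
  then obtain \<phi> where \<phi>: "\<And>n. \<phi> n \<in> hom G (G\<lparr>carrier := H\<rparr>) \<and> \<phi> n h1 = h1 \<and> \<phi> n h2 = h2 \<and> (\<forall>g\<in>E n. \<phi> n g \<noteq> \<one>)"
    by metis
  show thesis
  proof (rule that[of \<phi>])
    fix g assume g: "g \<in> carrier G" "g \<noteq> \<one>"
    obtain m where m: "from_nat_into (carrier G) m = g" using from_nat_into_surj[OF countable_carrier[OF fg] g(1)] by blast
    have "g \<in> E n" if "n \<ge> m" for n using that m g by (auto simp: E_def)
    then show "eventually (\<lambda>n. \<phi> n g \<noteq> \<one>) sequentially"
      using \<phi> unfolding eventually_sequentially by blast
  qed (use \<phi> in auto)
qed

section \<open>Limits of sequences of actions\<close>

text \<open>Only upward jumps need a bound. It will show that the translation amounts of consecutive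
  powers leave no large gaps.\<close>

lemma discrete_ivt:
  fixes f :: "nat \<Rightarrow> real"
  assumes "f 0 \<le> v" "v \<le> f m" "\<And>i. f (Suc i) - f i \<le> \<beta>" "0 \<le> \<beta>"
  shows "\<exists>i\<le>m. \<bar>f i - v\<bar> \<le> \<beta>"
  using assms(2)
proof (induction m)
  case (Suc m)
  show ?case
  proof (cases "v \<le> f m")
    case False
    then show ?thesis using Suc.prems assms(3)[of m] by (intro exI[of _ "Suc m"]) auto
  qed (use Suc le_SucI in blast)
qed (use assms in auto)

text \<open>All operations are taken as ternary so that one closure argument serves the action,
  points on geodesics and medians; arguments may be ignored.\<close>

lemma countable_closure:
  fixes Fs :: "('a \<Rightarrow> 'a \<Rightarrow> 'a \<Rightarrow> 'a) set"
  assumes "countable Fs" and "P x0"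
    and pres: "\<And>f p q r. f \<in> Fs \<Longrightarrow> P p \<Longrightarrow> P q \<Longrightarrow> P r \<Longrightarrow> P (f p q r)"
  obtains V where "countable V" "x0 \<in> V" "\<And>p. p \<in> V \<Longrightarrow> P p"
    "\<And>f p q r. f \<in> Fs \<Longrightarrow> p \<in> V \<Longrightarrow> q \<in> V \<Longrightarrow> r \<in> V \<Longrightarrow> f p q r \<in> V"
proof -
  define S where "S = rec_nat {x0} (\<lambda>_ A. A \<union> (\<lambda>(f, p, q, r). f p q r) ` (Fs \<times> A \<times> A \<times> A))"
  have S0: "S 0 = {x0}" and SS: "S (Suc k) = S k \<union> (\<lambda>(f, p, q, r). f p q r) ` (Fs \<times> S k \<times> S k \<times> S k)" for k
    by (simp_all add: S_def)
  have mono: "mono S" by (rule mono_iff_le_Suc[THEN iffD2]) (simp add: SS)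
  have "countable (S k)" for k
    by (induction k) (simp_all add: S0 SS assms(1))
  then have "countable (\<Union>k. S k)" by simp
  moreover have "x0 \<in> (\<Union>k. S k)" using S0 by blast
  moreover have "\<forall>p\<in>S k. P p" for k
  proof (induction k)
    case (Suc k)
    have "P (case z of (f, p, q, r) \<Rightarrow> f p q r)" if "z \<in> Fs \<times> S k \<times> S k \<times> S k" for z
      using that Suc pres by (cases z) auto
    with Suc show ?case by (simp only: SS) blast
  qed (simp add: S0 assms(2))
  then have "P p" if "p \<in> (\<Union>k. S k)" for p using that by blast
  moreover have "f p q r \<in> (\<Union>k. S k)" if m: "f \<in> Fs" "p \<in> (\<Union>k. S k)" "q \<in> (\<Union>k. S k)" "r \<in> (\<Union>k. S k)" for f p q r
  proof -
    obtain i j k where "p \<in> S i" "q \<in> S j" "r \<in> S k" using m by blast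
    moreover define l where "l = max i (max j k)"
    moreover have "S i \<subseteq> S l" "S j \<subseteq> S l" "S k \<subseteq> S l" using mono by (auto simp: l_def mono_def)
    ultimately have "(f, p, q, r) \<in> Fs \<times> S l \<times> S l \<times> S l" using m(1) by auto
    then have "f p q r \<in> S (Suc l)" unfolding SS by (intro UnI2 image_eqI[of _ _ "(f, p, q, r)"]) auto
    then show ?thesis by blast
  qed
  ultimately show thesis by (rule that)
qed

text \<open>All actions live on the same space \<open>M\<close>; points of the limit will be
  sequences in \<open>M\<close>, moved termwise by \<open>act\<close> below.\<close>

locale action_sequence = group G + Metric_space M d
  for G :: "('g, 'm) monoid_scheme" (structure) and M :: "'x set" and d +
  fixes T :: "nat \<Rightarrow> 'g \<Rightarrow> 'x \<Rightarrow> 'x" and \<delta> :: real and x0 :: 'x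
  assumes action: "isometric_group_action G M d (T n)"
    and geodesic: "geodesic_space M d" and \<delta>_nonneg: "\<delta> \<ge> 0" and hyp: "four_point M d \<delta>"
    and x0 [simp]: "x0 \<in> M"
begin

lemma T_closed [simp]: "g \<in> carrier G \<Longrightarrow> x \<in> M \<Longrightarrow> T n g x \<in> M"
  and T_one [simp]: "x \<in> M \<Longrightarrow> T n \<one> x = x"
  and T_mult: "g \<in> carrier G \<Longrightarrow> h \<in> carrier G \<Longrightarrow> x \<in> M \<Longrightarrow> T n (g \<otimes> h) x = T n g (T n h x)"
  and T_dist [simp]: "g \<in> carrier G \<Longrightarrow> x \<in> M \<Longrightarrow> y \<in> M \<Longrightarrow> d (T n g x) (T n g y) = d x y"
proof -
  interpret isometric_group_action G M d "T n" by (rule action)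
  show "g \<in> carrier G \<Longrightarrow> x \<in> M \<Longrightarrow> T n g x \<in> M" "x \<in> M \<Longrightarrow> T n \<one> x = x"
   "g \<in> carrier G \<Longrightarrow> h \<in> carrier G \<Longrightarrow> x \<in> M \<Longrightarrow> T n (g \<otimes> h) x = T n g (T n h x)"
   "g \<in> carrier G \<Longrightarrow> x \<in> M \<Longrightarrow> y \<in> M \<Longrightarrow> d (T n g x) (T n g y) = d x y"
    by (simp_all add: act_mult)
qed

definition act :: "'g \<Rightarrow> (nat \<Rightarrow> 'x) \<Rightarrow> nat \<Rightarrow> 'x" where
  "act g p n = T n g (p n)"

definition geo :: "'x \<Rightarrow> 'x \<Rightarrow> real \<Rightarrow> 'x" where
  "geo x y t = (SOME z. z \<in> M \<and> d x z = t \<and> d z y = d x y - t)"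

lemma geo:
  assumes "x \<in> M" "y \<in> M" "0 \<le> t" "t \<le> d x y"
  shows "geo x y t \<in> M" "d x (geo x y t) = t" "d (geo x y t) y = d x y - t"
proof -
  obtain \<gamma> where \<gamma>: "\<gamma> \<in> {0..d x y} \<rightarrow> M" "\<gamma> 0 = x" "\<gamma> (d x y) = y"
    "\<And>s t. s \<in> {0..d x y} \<Longrightarrow> t \<in> {0..d x y} \<Longrightarrow> d (\<gamma> s) (\<gamma> t) = \<bar>s - t\<bar>"
    using geodesic[unfolded geodesic_space_def, THEN conjunct2, rule_format, OF assms(1,2)] by blast
  have "\<gamma> t \<in> M \<and> d x (\<gamma> t) = t \<and> d (\<gamma> t) y = d x y - t"
    using \<gamma>(1) \<gamma>(4)[of 0 t] \<gamma>(4)[of t "d x y"] assms \<gamma>(2,3) by auto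
  then have "geo x y t \<in> M \<and> d x (geo x y t) = t \<and> d (geo x y t) y = d x y - t"
    unfolding geo_def by (rule someI)
  then show "geo x y t \<in> M" "d x (geo x y t) = t" "d (geo x y t) y = d x y - t" by auto
qed

lemma gromov_product_bounds:
  assumes "p \<in> M" "q \<in> M" "r \<in> M"
  shows "0 \<le> gromov_product d p q r" "gromov_product d p q r \<le> d p q"
  using triangle[of q p r] triangle[of p q r] assms commute[of p q] by (auto simp: gromov_product_def)

text \<open>Countability lets a single subsequence make all rescaled distances converge. The family
  is closed under the action, under points at integer distance along a geodesic, which give coarse
  geodesicity without rescaling, and under points placed by Gromov products, which become medians in
  the limit tree.\<close>

lemma limit_exists:
  assumes cG: "countable (carrier G)" and \<mu>: "\<And>n. \<mu> n > 0"
    and bdd: "\<And>g. g \<in> carrier G \<Longrightarrow> \<exists>C. \<forall>n. d x0 (T n g x0) \<le> C * \<mu> n"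
  obtains r V D where "strict_mono (r :: nat \<Rightarrow> nat)" "countable V" "(\<lambda>_. x0) \<in> V" "\<And>p n. p \<in> V \<Longrightarrow> p n \<in> M"
    "\<And>g p. g \<in> carrier G \<Longrightarrow> p \<in> V \<Longrightarrow> act g p \<in> V"
    "\<And>p q k. p \<in> V \<Longrightarrow> q \<in> V \<Longrightarrow> \<exists>z\<in>V. \<forall>n. d (p n) (z n) = min (real k) (d (p n) (q n)) \<and>
        d (z n) (q n) = d (p n) (q n) - min (real k) (d (p n) (q n))"
    "\<And>p q r. p \<in> V \<Longrightarrow> q \<in> V \<Longrightarrow> r \<in> V \<Longrightarrow> \<exists>z\<in>V. \<forall>n. d (p n) (z n) = gromov_product d (p n) (q n) (r n) \<and>
        d (z n) (q n) = d (p n) (q n) - gromov_product d (p n) (q n) (r n)"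
    "\<And>p q. p \<in> V \<Longrightarrow> q \<in> V \<Longrightarrow> ((\<lambda>n. d (p n) (q n) / \<mu> n) \<longlongrightarrow> D p q) (filtermap r sequentially)"
proof -
  define f1 where "f1 g p (q :: nat \<Rightarrow> 'x) (r :: nat \<Rightarrow> 'x) = act g p" for g p q r
  define f2 where "f2 k (p :: nat \<Rightarrow> 'x) (q :: nat \<Rightarrow> 'x) (r :: nat \<Rightarrow> 'x) = (\<lambda>n. geo (p n) (q n) (min (real k) (d (p n) (q n))))" for k p q r
  define f3 where "f3 (p :: nat \<Rightarrow> 'x) (q :: nat \<Rightarrow> 'x) (r :: nat \<Rightarrow> 'x) = (\<lambda>n. geo (p n) (q n) (gromov_product d (p n) (q n) (r n)))" for p q r
  define Fs where "Fs = f1 ` carrier G \<union> range f2 \<union> {f3}"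
  define P where "P p \<longleftrightarrow> (\<forall>n. p n \<in> M) \<and> (\<exists>C. \<forall>n. d x0 (p n) \<le> C * \<mu> n)" for p
  have Fs: "countable Fs" using cG by (simp add: Fs_def)
  have P0: "P (\<lambda>_. x0)" by (auto simp: P_def intro!: exI[of _ 0])
  have PFs: "P (f p q r)" if "f \<in> Fs" and pqr: "P p" "P q" "P r" for f p q r
  proof -
    obtain Cp Cq where C: "\<And>n. d x0 (p n) \<le> Cp * \<mu> n" "\<And>n. d x0 (q n) \<le> Cq * \<mu> n" using pqr by (auto simp: P_def)
    have m: "p n \<in> M" "q n \<in> M" "r n \<in> M" for n using pqr by (auto simp: P_def)
    have geo_P: "P (\<lambda>n. geo (p n) (q n) (t n))" if "\<And>n. 0 \<le> t n" "\<And>n. t n \<le> d (p n) (q n)" for t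
    proof -
      have "d x0 (geo (p n) (q n) (t n)) \<le> (2 * Cp + Cq) * \<mu> n" for n
        using triangle[of x0 "p n" "geo (p n) (q n) (t n)"] triangle[of "p n" x0 "q n"] m geo[OF m(1,2) that(1,2), of n]
          C[of n] that(2)[of n] commute[of x0 "p n"]
        by (simp add: algebra_simps)
      then show ?thesis using geo[OF m(1,2) that(1,2)] by (auto simp: P_def)
    qed
    from \<open>f \<in> Fs\<close> consider g where "g \<in> carrier G" "f = f1 g" | k where "f = f2 k" | "f = f3"
      by (auto simp: Fs_def)
    then show ?thesis
    proof cases
      case 1
      obtain C' where C': "\<And>n. d x0 (T n g x0) \<le> C' * \<mu> n" using bdd[OF 1(1)] by blast
      have "d x0 (T n g (p n)) \<le> (C' + Cp) * \<mu> n" for n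
        using triangle[of x0 "T n g x0" "T n g (p n)"] 1(1) m[of n] C'[of n] C(1)[of n] by (simp add: algebra_simps)
      then show ?thesis using 1 m by (auto simp: f1_def P_def act_def)
    next
      case 2
      show ?thesis unfolding 2 f2_def by (rule geo_P) auto
    next
      case 3
      show ?thesis unfolding 3 f3_def by (rule geo_P) (use gromov_product_bounds m in auto)
    qed
  qed
  obtain V where V: "countable V" "(\<lambda>_. x0) \<in> V" "\<And>p. p \<in> V \<Longrightarrow> P p"
    "\<And>f p q r. f \<in> Fs \<Longrightarrow> p \<in> V \<Longrightarrow> q \<in> V \<Longrightarrow> r \<in> V \<Longrightarrow> f p q r \<in> V"
  proof (rule countable_closure[of Fs P "\<lambda>_. x0"])
    show "countable Fs" "P (\<lambda>_. x0)" by fact+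
    show "P (f p q r)" if "f \<in> Fs" "P p" "P q" "P r" for f p q r by (rule PFs) (fact that)+
  qed (rule that)
  have m: "p n \<in> M" if "p \<in> V" for p n using V(3)[OF that] by (simp add: P_def)
  have "\<exists>B>0. \<forall>n. d (p n) (q n) \<le> B * \<mu> n" if pq: "p \<in> V" "q \<in> V" for p q
  proof -
    obtain Cp Cq where C: "\<And>n. d x0 (p n) \<le> Cp * \<mu> n" "\<And>n. d x0 (q n) \<le> Cq * \<mu> n"
      using V(3)[OF pq(1)] V(3)[OF pq(2)] by (auto simp: P_def)
    have "d (p n) (q n) \<le> (\<bar>Cp\<bar> + \<bar>Cq\<bar> + 1) * \<mu> n" for n
    proof -
      have "d (p n) (q n) \<le> (Cp + Cq) * \<mu> n"
        using triangle[of "p n" x0 "q n"] m pq C[of n] commute[of x0 "p n"] by (simp add: algebra_simps)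
      also have "\<dots> \<le> (\<bar>Cp\<bar> + \<bar>Cq\<bar> + 1) * \<mu> n" using \<mu>[of n] by (intro mult_right_mono) auto
      finally show ?thesis .
    qed
    moreover have "\<bar>Cp\<bar> + \<bar>Cq\<bar> + 1 > 0" by linarith
    ultimately show ?thesis by blast
  qed
  then obtain B where B: "\<And>p q. p \<in> V \<Longrightarrow> q \<in> V \<Longrightarrow> B p q > (0::real) \<and> (\<forall>n. d (p n) (q n) \<le> B p q * \<mu> n)" by metis
  \<comment> \<open>The diagonal argument asks for one bound on all pairs, hence the division by the
    bound \<open>B p q\<close> of each pair.\<close>
  define f where "f n = (\<lambda>(p, q). d (p n) (q n) / (B p q * \<mu> n))" for n
  have f_le: "norm (f n x) \<le> 1" if x_in: "x \<in> V \<times> V" for n x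
  proof -
    obtain p q where x: "x = (p, q)" "p \<in> V" "q \<in> V" using x_in by auto
    then have "0 < B p q * \<mu> n" "d (p n) (q n) \<le> B p q * \<mu> n" using B[of p q] \<mu>[of n] by auto
    then show ?thesis by (simp add: f_def x)
  qed
  obtain r :: "nat \<Rightarrow> nat" where r: "strict_mono r" "\<And>x. x \<in> V \<times> V \<Longrightarrow> \<exists>l. (\<lambda>n. f (r n) x) \<longlonglongrightarrow> l"
  proof (rule function_convergent_subsequence[of "V \<times> V" f 1])
    show "countable (V \<times> V)" using V(1) by simp
    show "norm (f n x) \<le> 1" if "x \<in> V \<times> V" for n x by (rule f_le) fact
  qed (rule that)
  have "\<exists>l. ((\<lambda>n. d (p n) (q n) / \<mu> n) \<longlongrightarrow> l) (filtermap r sequentially)" if pq: "p \<in> V" "q \<in> V" for p q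
  proof -
    obtain l where "(\<lambda>n. f (r n) (p, q)) \<longlonglongrightarrow> l" using r(2)[of "(p, q)"] \<open>p \<in> V\<close> \<open>q \<in> V\<close> by auto
    then have "(\<lambda>n. B p q * f (r n) (p, q)) \<longlonglongrightarrow> B p q * l" by (intro tendsto_intros)
    moreover have "B p q * f n (p, q) = d (p n) (q n) / \<mu> n" for n
      using B[OF pq] by (simp add: f_def)
    ultimately show ?thesis by (auto simp: filterlim_filtermap)
  qed
  then obtain D where D: "\<And>p q. p \<in> V \<Longrightarrow> q \<in> V \<Longrightarrow> ((\<lambda>n. d (p n) (q n) / \<mu> n) \<longlongrightarrow> D p q) (filtermap r sequentially)"
    by metis
  show thesis
  proof (rule that[of r V D])
    show "strict_mono r" "countable V" "(\<lambda>_. x0) \<in> V" by fact+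
    show "p n \<in> M" if "p \<in> V" for p n using m that .
    show "((\<lambda>n. d (p n) (q n) / \<mu> n) \<longlongrightarrow> D p q) (filtermap r sequentially)" if "p \<in> V" "q \<in> V" for p q
      using D that .
    show "act g p \<in> V" if "g \<in> carrier G" "p \<in> V" for g p
      using V(4)[of "f1 g" p p p] that by (simp add: Fs_def f1_def)
    show "\<exists>z\<in>V. \<forall>n. d (p n) (z n) = min (real k) (d (p n) (q n)) \<and>
        d (z n) (q n) = d (p n) (q n) - min (real k) (d (p n) (q n))" if "p \<in> V" "q \<in> V" for p q k
      using V(4)[of "f2 k" p q p] that m geo
      by (intro bexI[of _ "f2 k p q p"]) (simp_all add: Fs_def f2_def)
    show "\<exists>z\<in>V. \<forall>n. d (p n) (z n) = gromov_product d (p n) (q n) (r n) \<and>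
        d (z n) (q n) = d (p n) (q n) - gromov_product d (p n) (q n) (r n)" if "p \<in> V" "q \<in> V" "r \<in> V" for p q r
      using V(4)[of "f3" p q r] that m geo gromov_product_bounds
      by (intro bexI[of _ "f3 p q r"]) (simp_all add: Fs_def f3_def)
  qed
qed

end

text \<open>\<F> is the image of \<open>sequentially\<close> under a subsequence, so sequences keep
  their original indices. A single \<open>T n\<close> may have an infinite kernel and need not be
  acylindrical; acylindricity is therefore asked of finite sets \<open>A\<close> and eventually in
  \<open>n\<close>, with \<open>N\<close> and \<open>R\<close> independent of
  \<open>A\<close>.\<close>

locale limit_action = action_sequence G M d T \<delta> x0
  for G :: "('g, 'm) monoid_scheme" (structure) and M :: "'x set" and d T \<delta> x0 +
  fixes \<F> :: "nat filter" and \<mu> :: "nat \<Rightarrow> real" and V :: "(nat \<Rightarrow> 'x) set" and D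
  assumes \<F>_nontrivial: "\<F> \<noteq> bot" and \<mu>_pos: "\<mu> n > 0"
    and x0_V: "(\<lambda>_. x0) \<in> V" and V_M [simp]: "p \<in> V \<Longrightarrow> p n \<in> M"
    and act_V [simp]: "g \<in> carrier G \<Longrightarrow> p \<in> V \<Longrightarrow> act g p \<in> V"
    and limit: "p \<in> V \<Longrightarrow> q \<in> V \<Longrightarrow> ((\<lambda>n. d (p n) (q n) / \<mu> n) \<longlongrightarrow> D p q) \<F>"
    and asymptotically_acylindrical: "\<epsilon> \<ge> 0 \<Longrightarrow> \<exists>N::nat. \<exists>R. \<forall>A. finite A \<longrightarrow> A \<subseteq> carrier G \<longrightarrow> card A > N \<longrightarrow>
      eventually (\<lambda>n. \<forall>x\<in>M. \<forall>y\<in>M. d x y \<ge> R \<longrightarrow>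
        (\<exists>g\<in>A. d x (T n g x) > \<epsilon> \<or> d y (T n g y) > \<epsilon>)) \<F>"
begin

lemma act_one [simp]: "p \<in> V \<Longrightarrow> act \<one> p = p"
  by (auto simp: act_def)

lemma act_mult: "g \<in> carrier G \<Longrightarrow> h \<in> carrier G \<Longrightarrow> p \<in> V \<Longrightarrow> act (g \<otimes> h) p = act g (act h p)"
  by (auto simp: act_def T_mult)

lemma limit_unique: "p \<in> V \<Longrightarrow> q \<in> V \<Longrightarrow> ((\<lambda>n. d (p n) (q n) / \<mu> n) \<longlongrightarrow> l) \<F> \<Longrightarrow> D p q = l"
  using tendsto_unique[OF \<F>_nontrivial limit] by blast

lemma D_act [simp]: "g \<in> carrier G \<Longrightarrow> p \<in> V \<Longrightarrow> q \<in> V \<Longrightarrow> D (act g p) (act g q) = D p q"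
  by (rule limit_unique) (auto simp: act_def limit)

sublocale pseudo_metric_space V D
proof
  show "D p p = 0" if "p \<in> V" for p by (rule limit_unique) (use that in auto)
  show "D p q = D q p" if "p \<in> V" "q \<in> V" for p q
  proof (rule limit_unique[OF that])
    have "(\<lambda>n. d (p n) (q n) / \<mu> n) = (\<lambda>n. d (q n) (p n) / \<mu> n)" by (simp add: commute)
    then show "((\<lambda>n. d (p n) (q n) / \<mu> n) \<longlongrightarrow> D q p) \<F>" using limit[OF that(2,1)] by simp
  qed
  show "D p r \<le> D p q + D q r" if "p \<in> V" "q \<in> V" "r \<in> V" for p q r
  proof (rule tendsto_le[OF \<F>_nontrivial tendsto_add[OF limit limit] limit])
    show "\<forall>\<^sub>F n in \<F>. d (p n) (r n) / \<mu> n \<le> d (p n) (q n) / \<mu> n + d (q n) (r n) / \<mu> n"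
      using that \<mu>_pos triangle by (intro always_eventually allI) (simp add: divide_right_mono less_imp_le flip: add_divide_distrib)
  qed (use that in auto)
qed

text \<open>Covers both regimes: \<delta>' is \<delta> when \<mu> is 1, and 0 when \<mu> tends to
  infinity.\<close>

lemma four_point_limit:
  assumes "((\<lambda>n. \<delta> / \<mu> n) \<longlongrightarrow> \<delta>') \<F>"
  shows "four_point V D \<delta>'"
  unfolding four_point_def
proof (intro ballI)
  fix x y z w assume m: "x \<in> V" "y \<in> V" "z \<in> V" "w \<in> V"
  show "D x y + D z w \<le> max (D x z + D y w) (D x w + D y z) + 2 * \<delta>'"
  proof (rule tendsto_le[OF \<F>_nontrivial])
    show "((\<lambda>n. max (d (x n) (z n) / \<mu> n + d (y n) (w n) / \<mu> n) (d (x n) (w n) / \<mu> n + d (y n) (z n) / \<mu> n) + 2 * (\<delta> / \<mu> n))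
      \<longlongrightarrow> max (D x z + D y w) (D x w + D y z) + 2 * \<delta>') \<F>"
      using m assms by (intro tendsto_intros tendsto_max limit) auto
    show "((\<lambda>n. d (x n) (y n) / \<mu> n + d (z n) (w n) / \<mu> n) \<longlongrightarrow> D x y + D z w) \<F>"
      using m by (intro tendsto_intros limit) auto
    show "\<forall>\<^sub>F n in \<F>. d (x n) (y n) / \<mu> n + d (z n) (w n) / \<mu> n
      \<le> max (d (x n) (z n) / \<mu> n + d (y n) (w n) / \<mu> n) (d (x n) (w n) / \<mu> n + d (y n) (z n) / \<mu> n) + 2 * (\<delta> / \<mu> n)"
    proof (intro always_eventually allI)
      fix n
      have "d (x n) (y n) + d (z n) (w n) \<le> max (d (x n) (z n) + d (y n) (w n)) (d (x n) (w n) + d (y n) (z n)) + 2 * \<delta>"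
        by (rule four_pointD[OF hyp]) (use m in auto)
      then show "d (x n) (y n) / \<mu> n + d (z n) (w n) / \<mu> n
      \<le> max (d (x n) (z n) / \<mu> n + d (y n) (w n) / \<mu> n) (d (x n) (w n) / \<mu> n + d (y n) (z n) / \<mu> n) + 2 * (\<delta> / \<mu> n)"
        using \<mu>_pos[of n] divide_right_mono[of _ _ "\<mu> n"]
        by (fastforce simp: add_divide_distrib max_divide_distrib_right)
    qed
  qed
qed

lemma limit_less: "p \<in> V \<Longrightarrow> q \<in> V \<Longrightarrow> D p q < c \<Longrightarrow> eventually (\<lambda>n. d (p n) (q n) < c * \<mu> n) \<F>"
  using order_tendstoD(2)[OF limit, of p q c] \<mu>_pos by (simp add: pos_divide_less_eq)

lemma limit_greater: "p \<in> V \<Longrightarrow> q \<in> V \<Longrightarrow> D p q > c \<Longrightarrow> eventually (\<lambda>n. d (p n) (q n) > c * \<mu> n) \<F>"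
  using order_tendstoD(1)[OF limit, of p q c] \<mu>_pos by (simp add: pos_less_divide_eq)

text \<open>The homomorphisms fix the two loxodromics, so the orbit of \<open>x0\<close> under their
  powers is constant in \<open>n\<close>; \<open>y\<close> names it. Hence quasi-isometry and
  independence carry over literally, and only acylindricity needs a limit argument.\<close>

lemma bounded_scale_acylindrically_hyperbolic:
  assumes cV: "countable V" and \<mu>1: "\<And>n. \<mu> n = 1"
    and points: "\<And>p q k. p \<in> V \<Longrightarrow> q \<in> V \<Longrightarrow> \<exists>z\<in>V. \<forall>n. d (p n) (z n) = min (real k) (d (p n) (q n)) \<and>
        d (z n) (q n) = d (p n) (q n) - min (real k) (d (p n) (q n))"
    and gh: "g \<in> carrier G" "h \<in> carrier G"
    and const: "\<And>k n m. k \<in> {g, h} \<Longrightarrow> T n (k [^] (m::int)) x0 = y k m"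
    and lox: "\<And>k. k \<in> {g, h} \<Longrightarrow> \<exists>K\<ge>1. \<exists>C\<ge>0. \<forall>m n :: int.
        \<bar>real_of_int m - real_of_int n\<bar> / K - C \<le> d (y k m) (y k n) \<and>
        d (y k m) (y k n) \<le> K * \<bar>real_of_int m - real_of_int n\<bar> + C"
    and indep: "\<And>s t. s \<in> {1, -1} \<Longrightarrow> t \<in> {1, -1} \<Longrightarrow>
      \<not> diverges_together d x0 (\<lambda>n. y g (s * int n)) (\<lambda>n. y h (t * int n))"
  shows "acylindrically_hyperbolic TYPE('g \<times> real) G"
proof -
  define v0 where "v0 = (\<lambda>_::nat. x0)"
  have v0: "v0 \<in> V" using x0_V by (simp add: v0_def)
  have lim: "((\<lambda>n. d (p n) (q n)) \<longlongrightarrow> D p q) \<F>" if "p \<in> V" "q \<in> V" for p q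
    using limit[OF that] \<mu>1 by simp
  have uniq: "D p q = l" if "p \<in> V" "q \<in> V" "((\<lambda>n. d (p n) (q n)) \<longlongrightarrow> l) \<F>" for p q l
    using limit_unique[OF that(1,2)] that(3) \<mu>1 by simp
  have "((\<lambda>n. \<delta> / \<mu> n) \<longlongrightarrow> \<delta>) \<F>" using \<mu>1 by simp
  then have four: "four_point V D \<delta>" by (rule four_point_limit)
  have orb: "D (act (k [^] (m::int)) v0) (act (l [^] (n::int)) v0) = d (y k m) (y l n)"
    if "k \<in> {g, h}" "l \<in> {g, h}" for k l m n
    by (rule uniq) (use that gh v0 const in \<open>auto simp: act_def v0_def\<close>)
  have D_v0: "D v0 (act (k [^] (m::int)) v0) = d x0 (y k m)" if "k \<in> {g, h}" for k m
    by (rule uniq) (use that gh v0 const in \<open>auto simp: act_def v0_def\<close>)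
  show ?thesis
  proof (rule acylindrically_hyperbolicI[OF group_axioms cV pseudo_metric_space_axioms v0 four \<delta>_nonneg, of 1 act g h])
    fix p q t assume pq: "p \<in> V" "q \<in> V" and t: "0 \<le> t" "t \<le> D p q"
    \<comment> \<open>Only integer distances are available in \<open>V\<close>; rounding causes the
      constant 1.\<close>
    define k where "k = nat \<lfloor>t\<rfloor>"
    have k: "real k \<le> t" "t \<le> real k + 1" using t by (auto simp: k_def)
    obtain z where z: "z \<in> V" "\<And>n. d (p n) (z n) = min (real k) (d (p n) (q n))"
      "\<And>n. d (z n) (q n) = d (p n) (q n) - min (real k) (d (p n) (q n))" using points[OF pq, of k] by blast
    have "D p z = min (real k) (D p q)" "D z q = D p q - min (real k) (D p q)"
      by (rule uniq; use z pq in \<open>simp; intro tendsto_intros tendsto_min lim; simp\<close>)+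
    then show "\<exists>z\<in>V. D p z \<le> t + 1 \<and> D z q \<le> D p q - t + 1" using z(1) k t by (intro bexI[of _ z]) auto
  next
    fix \<epsilon> :: real assume "\<epsilon> \<ge> 0"
    \<comment> \<open>The margin 1, here and in \<open>R + 1\<close>, turns bounds on limits into
      strict bounds that hold eventually.\<close>
    then obtain N R where NR: "\<And>A. finite A \<Longrightarrow> A \<subseteq> carrier G \<Longrightarrow> card A > N \<Longrightarrow>
      eventually (\<lambda>n. \<forall>x\<in>M. \<forall>y\<in>M. d x y \<ge> R \<longrightarrow>
        (\<exists>g\<in>A. d x (T n g x) > \<epsilon> + 1 \<or> d y (T n g y) > \<epsilon> + 1)) \<F>"
      using asymptotically_acylindrical[of "\<epsilon> + 1"] by auto
    have "finite {g \<in> carrier G. D x (act g x) \<le> \<epsilon> \<and> D y (act g y) \<le> \<epsilon>} \<and>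
      card {g \<in> carrier G. D x (act g x) \<le> \<epsilon> \<and> D y (act g y) \<le> \<epsilon>} \<le> N"
      if xy: "x \<in> V" "y \<in> V" "R + 1 \<le> D x y" for x y
    proof (rule finite_if_finite_subsets_card_bdd, rule ccontr)
      fix A assume A: "A \<subseteq> {g \<in> carrier G. D x (act g x) \<le> \<epsilon> \<and> D y (act g y) \<le> \<epsilon>}" "finite A" "\<not> card A \<le> N"
      have ev: "eventually (\<lambda>n. \<forall>g\<in>A. d (z n) (act g z n) < \<epsilon> + 1) \<F>" if "z \<in> V" "\<And>g. g \<in> A \<Longrightarrow> D z (act g z) \<le> \<epsilon>" for z
      proof (intro eventually_ball_finite A(2) ballI)
        fix g assume g: "g \<in> A"
        have "D z (act g z) < \<epsilon> + 1" using that(2)[OF g] by simp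
        then show "eventually (\<lambda>n. d (z n) (act g z n) < \<epsilon> + 1) \<F>"
          using limit_less[of z "act g z" "\<epsilon> + 1"] that(1) g A(1) \<mu>1 by auto
      qed
      have "eventually (\<lambda>n. \<forall>g\<in>A. d (x n) (act g x n) < \<epsilon> + 1) \<F>" "eventually (\<lambda>n. \<forall>g\<in>A. d (y n) (act g y n) < \<epsilon> + 1) \<F>"
        using ev[of x] ev[of y] xy A(1) by auto
      moreover have "eventually (\<lambda>n. d (x n) (y n) > R) \<F>" using limit_greater[OF xy(1,2), of R] xy \<mu>1 by simp
      moreover have "eventually (\<lambda>n. \<forall>x\<in>M. \<forall>y\<in>M. d x y \<ge> R \<longrightarrow>
        (\<exists>g\<in>A. d x (T n g x) > \<epsilon> + 1 \<or> d y (T n g y) > \<epsilon> + 1)) \<F>"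
        using NR[of A] A by auto
      ultimately have "eventually (\<lambda>n. False) \<F>"
      proof eventually_elim
        case (elim n)
        then obtain g where "g \<in> A" "d (x n) (T n g (x n)) > \<epsilon> + 1 \<or> d (y n) (T n g (y n)) > \<epsilon> + 1"
          using xy V_M by (meson less_imp_le)
        with elim show False by (force simp: act_def)
      qed
      then show False using \<F>_nontrivial by simp
    qed
    then show "\<exists>N::nat. \<exists>R. \<forall>x\<in>V. \<forall>y\<in>V. R \<le> D x y \<longrightarrow>
      finite {g \<in> carrier G. D x (act g x) \<le> \<epsilon> \<and> D y (act g y) \<le> \<epsilon>} \<and>
      card {g \<in> carrier G. D x (act g x) \<le> \<epsilon> \<and> D y (act g y) \<le> \<epsilon>} \<le> N" by blast
  next
    fix k assume k: "k \<in> {g, h}"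
    show "\<exists>K\<ge>1. \<exists>C\<ge>0. \<forall>m n :: int.
        \<bar>real_of_int m - real_of_int n\<bar> / K - C \<le> D (act (k [^] m) v0) (act (k [^] n) v0) \<and>
        D (act (k [^] m) v0) (act (k [^] n) v0) \<le> K * \<bar>real_of_int m - real_of_int n\<bar> + C"
      using lox[OF k] orb[OF k k] by simp
  next
    fix s t :: int assume st: "s \<in> {1, -1}" "t \<in> {1, -1}"
    have "gromov_product D v0 (act (g [^] (s * int m)) v0) (act (h [^] (t * int n)) v0) =
      gromov_product d x0 (y g (s * int m)) (y h (t * int n))" for m n
      by (simp add: gromov_product_def D_v0 orb)
    then show "\<not> diverges_together D v0 (\<lambda>n. act (g [^] (s * int n)) v0) (\<lambda>n. act (h [^] (t * int n)) v0)"
      using indep[OF st] by (simp add: diverges_together_def)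
  qed (auto simp: act_mult gh)
qed

end

section \<open>Counting translates of a segment in a tree\<close>

text \<open>A positive \<eta> is essential: translates of the segment will be compared by the
  pigeonhole principle, which only makes their endpoints agree up to \<eta>.\<close>

locale segment_action = group G + pseudo_metric_space V D
  for G :: "('g, 'm) monoid_scheme" (structure) and V :: "'v set" and D +
  fixes act :: "'g \<Rightarrow> 'v \<Rightarrow> 'v" and a b :: 'v and \<eta> :: real
  assumes tree: "four_point V D 0"
    and median: "p \<in> V \<Longrightarrow> q \<in> V \<Longrightarrow> r \<in> V \<Longrightarrow>
      \<exists>c\<in>V. D p c = gromov_product D p q r \<and> D c q = D p q - gromov_product D p q r"
    and act_V [simp]: "g \<in> carrier G \<Longrightarrow> p \<in> V \<Longrightarrow> act g p \<in> V"
    and act_one [simp]: "p \<in> V \<Longrightarrow> act \<one> p = p"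
    and act_mult: "g \<in> carrier G \<Longrightarrow> h \<in> carrier G \<Longrightarrow> p \<in> V \<Longrightarrow> act (g \<otimes> h) p = act g (act h p)"
    and D_act [simp]: "g \<in> carrier G \<Longrightarrow> p \<in> V \<Longrightarrow> q \<in> V \<Longrightarrow> D (act g p) (act g q) = D p q"
    and ab [simp]: "a \<in> V" "b \<in> V" and ab_pos: "D a b > 0" and \<eta>_pos: "\<eta> > 0"
    and finite_W: "finite {g \<in> carrier G. D a (act g a) \<le> \<eta> \<and> D b (act g b) \<le> \<eta>}"
begin

abbreviation L :: real where "L \<equiv> D a b"

definition betw :: "'v \<Rightarrow> 'v \<Rightarrow> 'v \<Rightarrow> bool" where
  "betw p r q \<longleftrightarrow> D p r + D r q = D p q"

definition seg :: "'v \<Rightarrow> 'v \<Rightarrow> bool" where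
  "seg w z \<longleftrightarrow> (\<exists>u\<in>carrier G. w = act u a \<and> z = act u b \<or> w = act u b \<and> z = act u a)"

text \<open>Translates \<open>[w, z]\<close> have length \<open>L\<close>, so the equation puts
  \<open>p\<close>, \<open>w\<close>, \<open>z\<close>, \<open>q\<close> in this order on a
  geodesic. A chain is a row of nonoverlapping translates, in either orientation, peeled off from
  the left.\<close>

primrec chain :: "nat \<Rightarrow> 'v \<Rightarrow> 'v \<Rightarrow> bool" where
  "chain 0 p q \<longleftrightarrow> True"
| "chain (Suc k) p q \<longleftrightarrow> (\<exists>w z. seg w z \<and> D p w + L + D z q = D p q \<and> chain k z q)"

lemma chain_SucI: "seg w z \<Longrightarrow> D p w + L + D z q = D p q \<Longrightarrow> chain k z q \<Longrightarrow> chain (Suc k) p q"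
  by auto

lemma seg_V: "seg w z \<Longrightarrow> w \<in> V \<and> z \<in> V"
  by (auto simp: seg_def)

lemma seg_D: "seg w z \<Longrightarrow> D w z = L"
  using D_sym[of a b] by (auto simp: seg_def)

lemma seg_sym: "seg w z \<Longrightarrow> seg z w"
  by (auto simp: seg_def)

lemma seg_act: "g \<in> carrier G \<Longrightarrow> seg w z \<Longrightarrow> seg (act g w) (act g z)"
  unfolding seg_def by (metis ab act_mult m_closed)

lemma betw_sym: "p \<in> V \<Longrightarrow> r \<in> V \<Longrightarrow> q \<in> V \<Longrightarrow> betw p r q \<Longrightarrow> betw q r p"
  using D_sym[of p r] D_sym[of r q] D_sym[of p q] by (simp add: betw_def)

text \<open>In a tree the points between \<open>p\<close> and \<open>q\<close> are linearly ordered
  by their distance from \<open>p\<close>.\<close>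

lemma betw_order:
  assumes "p \<in> V" "q \<in> V" "c \<in> V" "z \<in> V" "betw p c q" "betw p z q" "D p z \<le> D p c"
  shows "betw p z c" "betw z c q"
proof -
  have "D z c + D p q \<le> max (D z p + D c q) (D z q + D c p)"
    using four_pointD[OF tree, of z c p q] assms by simp
  then have "D z c \<le> D p c - D p z"
    using assms D_sym[of z p] D_sym[of c p] by (auto simp: betw_def max_def split: if_splits)
  moreover have "D p c \<le> D p z + D z c" "D z q \<le> D z c + D c q" using assms D_triangle by auto
  ultimately show "betw p z c" "betw z c q" using assms by (auto simp: betw_def)
qed

lemma betw_trans:
  assumes "p \<in> V" "q \<in> V" "c \<in> V" "z \<in> V" "betw p c q" "betw p z c"
  shows "betw p z q" "betw z c q"
  using assms D_triangle[of p z q] D_triangle[of z c q] by (auto simp: betw_def)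

text \<open>The locale places \<open>c\<close> on one side of the triangle; the four-point
  inequality with constant 0 puts it on the other two.\<close>

lemma medianE:
  assumes "p \<in> V" "q \<in> V" "r \<in> V"
  obtains c where "c \<in> V" "betw p c q" "betw p c r" "betw q c r" "D p c = gromov_product D p q r"
proof -
  obtain c where c: "c \<in> V" "D p c = gromov_product D p q r" "D c q = D p q - gromov_product D p q r"
    using median[OF assms] by blast
  have "D c r + D p q \<le> max (D c p + D r q) (D c q + D r p)"
    using four_pointD[OF tree, of c r p q] assms c by simp
  then have "D c r \<le> D p r - gromov_product D p q r"
    using c assms D_sym[of c p] D_sym[of r q] D_sym[of r p]
    by (auto simp: gromov_product_def max_def field_simps split: if_splits)
  moreover have "D p r \<le> D p c + D c r" by (rule D_triangle) (use assms c in auto)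
  ultimately have "D c r = D p r - gromov_product D p q r" using c by simp
  with c assms D_sym[of c q] have "betw p c q" "betw p c r" "betw q c r"
    by (auto simp: betw_def gromov_product_def field_simps)
  with c that show thesis by blast
qed

lemma chain_length: "p \<in> V \<Longrightarrow> q \<in> V \<Longrightarrow> chain k p q \<Longrightarrow> real k * L \<le> D p q"
proof (induction k arbitrary: p)
  case 0
  then show ?case by (simp add: D_nonneg)
next
  case (Suc k)
  then obtain w z where wz: "seg w z" "D p w + L + D z q = D p q" "chain k z q" by auto
  then have "real k * L \<le> D z q" using Suc seg_V by blast
  moreover have "0 \<le> D p w" using seg_V[OF wz(1)] Suc D_nonneg by blast
  ultimately show ?case using wz by (simp add: algebra_simps)
qed

lemma chain_left:
  assumes "p \<in> V" "q \<in> V" "r \<in> V" "betw p r q" "chain k r q"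
  shows "chain k p q"
proof (cases k)
  case (Suc l)
  then obtain w z where wz: "seg w z" "D r w + L + D z q = D r q" "chain l z q" using assms by auto
  have "D p w \<le> D p r + D r w" "D p q \<le> D p w + D w q" "D w q \<le> D w z + D z q"
    using assms seg_V[OF wz(1)] D_triangle by auto
  then have "D p w + L + D z q = D p q" using assms wz seg_D[OF wz(1)] by (auto simp: betw_def)
  with Suc wz show ?thesis by auto
qed simp

lemma chain_append:
  assumes "p \<in> V" "q \<in> V" "r \<in> V" "betw p r q" "chain i p r" "chain j r q"
  shows "chain (i + j) p q"
  using assms
proof (induction i arbitrary: p)
  case 0
  then show ?case using chain_left by simp
next
  case (Suc i)
  then obtain w z where wz: "seg w z" "D p w + L + D z r = D p r" "chain i z r" by auto
  note m = seg_V[OF wz(1)]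
  have "D z q \<le> D z r + D r q" "D p q \<le> D p w + D w q" "D w q \<le> D w z + D z q"
    using Suc m D_triangle by auto
  then have "D z r + D r q = D z q" "D p w + L + D z q = D p q"
    using Suc wz seg_D[OF wz(1)] by (auto simp: betw_def)
  moreover from this have "chain (i + j) z q" using Suc m wz by (auto simp: betw_def)
  ultimately show ?case using wz by auto
qed

lemma chain_right:
  assumes "p \<in> V" "q \<in> V" "r \<in> V" "betw p r q" "chain k p r"
  shows "chain k p q"
  using chain_append[of p q r k 0] assms by simp

lemma chain_sym: "p \<in> V \<Longrightarrow> q \<in> V \<Longrightarrow> chain k p q \<Longrightarrow> chain k q p"
proof (induction k arbitrary: p)
  case (Suc k)
  then obtain w z where wz: "seg w z" "D p w + L + D z q = D p q" "chain k z q" by auto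
  note m = seg_V[OF wz(1)]
  have "D p q \<le> D p z + D z q" "D p z \<le> D p w + D w z" using Suc m D_triangle by auto
  then have e: "betw p z q" "D p w + L = D p z" using wz seg_D[OF wz(1)] by (auto simp: betw_def)
  then have "chain 1 z p"
    using wz m Suc D_sym[of p w] D_sym[of p z] seg_sym[OF wz(1)]
    unfolding One_nat_def by (intro chain_SucI[of z w]) auto
  moreover have "betw q z p" using e Suc m betw_sym by blast
  ultimately have "chain (k + 1) q p" using Suc m wz by (intro chain_append[of q p z]) auto
  then show ?case by simp
qed simp

lemma chain_Suc: "p \<in> V \<Longrightarrow> q \<in> V \<Longrightarrow> chain (Suc k) p q \<Longrightarrow> chain k p q"
proof -
  assume pq: "p \<in> V" "q \<in> V" and "chain (Suc k) p q"
  then obtain w z where wz: "seg w z" "D p w + L + D z q = D p q" "chain k z q" by auto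
  note m = seg_V[OF wz(1)]
  have "D p q \<le> D p z + D z q" "D p z \<le> D p w + D w z" using pq m D_triangle by auto
  then have "betw p z q" using wz seg_D[OF wz(1)] by (auto simp: betw_def)
  then show ?thesis using chain_left pq m wz by blast
qed

lemma chain_mono: "p \<in> V \<Longrightarrow> q \<in> V \<Longrightarrow> chain k p q \<Longrightarrow> j \<le> k \<Longrightarrow> chain j p q"
proof (induction k)
  case (Suc k)
  then show ?case using chain_Suc[of p q k] by (cases "j = Suc k") (auto simp del: chain.simps)
qed simp

text \<open>Cutting at an arbitrary point destroys at most one translate, the one that contains the
  point in its interior.\<close>

lemma chain_split:
  assumes "p \<in> V" "q \<in> V" "c \<in> V" "betw p c q" "chain k p q"
  shows "\<exists>i j. k \<le> i + j + 1 \<and> chain i p c \<and> chain j c q"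
  using assms
proof (induction k arbitrary: p)
  case (Suc k)
  then obtain w z where wz: "seg w z" "D p w + L + D z q = D p q" "chain k z q" by auto
  note m = seg_V[OF wz(1)]
  have "D p q \<le> D p z + D z q" "D p z \<le> D p w + D w z" using Suc m D_triangle by auto
  then have z: "betw p z q" "D p w + L = D p z" using wz seg_D[OF wz(1)] by (auto simp: betw_def)
  show ?case
  proof (cases "D p z \<le> D p c")
    case True
    then have zc: "betw p z c" "betw z c q" using betw_order[of p q c z] Suc m z by auto
    then obtain i j where ij: "k \<le> i + j + 1" "chain i z c" "chain j c q"
      using Suc.IH[of z] Suc.prems m wz by auto
    then have "chain (Suc i) p c" using wz z zc by (intro chain_SucI[of w z]) (auto simp: betw_def)
    then show ?thesis using ij by (intro exI[of _ "Suc i"] exI[of _ j]) auto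
  next
    case False
    then have "betw c z q" using betw_order[of p q z c] Suc m z by auto
    then have "chain k c q" using chain_left[of c q z] Suc.prems m wz by auto
    then show ?thesis by (intro exI[of _ 0] exI[of _ k]) auto
  qed
qed (use chain.simps(1) in blast)

text \<open>Cutting at the end of the \<open>i\<close>-th translate destroys none.\<close>

lemma chain_decompose:
  assumes "p \<in> V" "q \<in> V" "chain (i + j) p q"
  shows "\<exists>z\<in>V. betw p z q \<and> chain i p z \<and> chain j z q"
  using assms
proof (induction i arbitrary: p)
  case 0
  then show ?case by (intro bexI[of _ p]) (auto simp: betw_def)
next
  case (Suc i)
  then obtain w z where wz: "seg w z" "D p w + L + D z q = D p q" "chain (i + j) z q" by auto
  note m = seg_V[OF wz(1)]
  obtain y where y: "y \<in> V" "betw z y q" "chain i z y" "chain j y q" using Suc m wz by blast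
  have "D p q \<le> D p y + D y q" "D p y \<le> D p w + D w y" "D w y \<le> D w z + D z y" using Suc m y D_triangle by auto
  then have "betw p y q" "D p w + L + D z y = D p y"
    using wz y seg_D[OF wz(1)] by (auto simp: betw_def)
  then show ?case using wz y by (intro bexI[of _ y]) auto
qed

lemma chain_act: "g \<in> carrier G \<Longrightarrow> p \<in> V \<Longrightarrow> q \<in> V \<Longrightarrow> chain k p q \<Longrightarrow> chain k (act g p) (act g q)"
proof (induction k arbitrary: p)
  case (Suc k)
  then obtain w z where wz: "seg w z" "D p w + L + D z q = D p q" "chain k z q" by auto
  note m = seg_V[OF wz(1)]
  have "D (act g p) (act g w) + L + D (act g z) (act g q) = D (act g p) (act g q)"
    using wz m Suc.prems by simp
  moreover have "chain k (act g z) (act g q)" using Suc m wz by blast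
  ultimately show ?case using Suc.prems wz seg_act by (intro chain_SucI) auto
qed simp

section \<open>The counting metric and its hyperbolicity\<close>

definition cnt :: "'v \<Rightarrow> 'v \<Rightarrow> nat" where
  "cnt p q = Max {k. chain k p q}"

lemma chain_iff: "p \<in> V \<Longrightarrow> q \<in> V \<Longrightarrow> chain k p q \<longleftrightarrow> k \<le> cnt p q"
proof -
  assume pq: "p \<in> V" "q \<in> V"
  have "{k. chain k p q} \<subseteq> {..nat \<lfloor>D p q / L\<rfloor>}"
  proof
    fix k assume "k \<in> {k. chain k p q}"
    then have "real k \<le> D p q / L" using chain_length[OF pq, of k] ab_pos by (simp add: pos_le_divide_eq)
    then show "k \<in> {..nat \<lfloor>D p q / L\<rfloor>}" by (simp add: le_nat_floor)
  qed
  then have fin: "finite {k. chain k p q}" by (rule finite_subset) simp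
  moreover have "{k. chain k p q} \<noteq> {}" using chain.simps(1) by blast
  ultimately have "cnt p q \<in> {k. chain k p q}" unfolding cnt_def by (rule Max_in)
  then have "chain (cnt p q) p q" by (rule CollectD)
  moreover have "k \<le> cnt p q" if "chain k p q" unfolding cnt_def by (rule Max_ge[OF fin CollectI]) (rule that)
  ultimately show ?thesis using chain_mono[OF pq] by blast
qed

lemma cnt_length: "p \<in> V \<Longrightarrow> q \<in> V \<Longrightarrow> real (cnt p q) * L \<le> D p q"
  using chain_length chain_iff by blast

lemma cnt_sym: "p \<in> V \<Longrightarrow> q \<in> V \<Longrightarrow> cnt p q = cnt q p"
  by (meson antisym chain_iff chain_sym order_refl)

lemma cnt_act: assumes "g \<in> carrier G" "p \<in> V" "q \<in> V" shows "cnt (act g p) (act g q) = cnt p q"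
proof (rule antisym)
  have 1: "cnt p q \<le> cnt (act g p) (act g q)" if "g \<in> carrier G" "p \<in> V" "q \<in> V" for g p q
    using chain_act[OF that] chain_iff that by (meson act_V order_refl)
  show "cnt p q \<le> cnt (act g p) (act g q)" by (rule 1[OF assms])
  have "act (inv g) (act g r) = r" if "r \<in> V" for r
    using act_mult[of "inv g" g r] assms that by simp
  then show "cnt (act g p) (act g q) \<le> cnt p q" using 1[of "inv g" "act g p" "act g q"] assms by simp
qed

lemma cnt_add_le: "p \<in> V \<Longrightarrow> q \<in> V \<Longrightarrow> c \<in> V \<Longrightarrow> betw p c q \<Longrightarrow> cnt p c + cnt c q \<le> cnt p q"
  using chain_append[of p q c "cnt p c" "cnt c q"] chain_iff by simp

lemma cnt_add_ge: "p \<in> V \<Longrightarrow> q \<in> V \<Longrightarrow> c \<in> V \<Longrightarrow> betw p c q \<Longrightarrow> cnt p q \<le> cnt p c + cnt c q + 1"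
  using chain_split[of p q c "cnt p q"] chain_iff by fastforce

lemma cnt_triangle: "p \<in> V \<Longrightarrow> q \<in> V \<Longrightarrow> r \<in> V \<Longrightarrow> cnt p r \<le> cnt p q + cnt q r + 1"
proof -
  assume m: "p \<in> V" "q \<in> V" "r \<in> V"
  obtain c where c: "c \<in> V" "betw p c r" "betw p c q" "betw r c q" using medianE[of p r q] m by metis
  have "betw q c r" using c m betw_sym by blast
  then show ?thesis
    using cnt_add_ge[of p r c] cnt_add_le[of p q c] cnt_add_le[of q r c] m c by linarith
qed

text \<open>The added 1 absorbs the translate lost at a cut, so the coarse triangle inequality of
  \<open>cnt\<close> becomes a true one.\<close>

definition N :: "'v \<Rightarrow> 'v \<Rightarrow> real" where
  "N p q = (if p = q then 0 else real (cnt p q) + 1)"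

lemma cnt_refl: "p \<in> V \<Longrightarrow> cnt p p = 0"
  using cnt_length[of p p] ab_pos by (simp add: mult_le_0_iff)

lemma N_bounds: "p \<in> V \<Longrightarrow> real (cnt p q) \<le> N p q" "N p q \<le> real (cnt p q) + 1"
  using cnt_refl by (auto simp: N_def)

lemma pseudo_metric_N: "pseudo_metric_space V N"
proof
  show "N p r \<le> N p q + N q r" if "p \<in> V" "q \<in> V" "r \<in> V" for p q r
    using cnt_triangle[OF that] by (auto simp: N_def)
qed (auto simp: N_def cnt_sym)

lemma N_act: "g \<in> carrier G \<Longrightarrow> p \<in> V \<Longrightarrow> q \<in> V \<Longrightarrow> N (act g p) (act g q) = N p q"
proof -
  assume m: "g \<in> carrier G" "p \<in> V" "q \<in> V"
  have "act (inv g) (act g r) = r" if "r \<in> V" for r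
    using act_mult[of "inv g" g r] m that by simp
  then have "act g p = act g q \<longleftrightarrow> p = q" using m by metis
  then show ?thesis using m by (simp add: N_def cnt_act)
qed

text \<open>Up to an additive error, twice the count from \<open>w\<close> to a median is the
  doubled Gromov product for \<open>cnt\<close>, and medians on a common segment are ordered as in
  the tree. The errors are 1 from \<open>up\<close>, 2 from \<open>lo\<close> and 2 from replacing
  \<open>cnt\<close> by \<open>N\<close>, in all twice 5/2.\<close>

lemma four_point_N: "four_point V N (5/2)"
  unfolding four_point_def
proof (intro ballI)
  fix x y z w assume m: "x \<in> V" "y \<in> V" "z \<in> V" "w \<in> V"
  obtain cxy where cxy: "cxy \<in> V" "betw w cxy x" "betw w cxy y" "betw x cxy y" "D w cxy = gromov_product D w x y"
    using medianE[of w x y] m by metis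
  obtain cxz where cxz: "cxz \<in> V" "betw w cxz x" "betw w cxz z" "betw x cxz z" "D w cxz = gromov_product D w x z"
    using medianE[of w x z] m by metis
  obtain czy where czy: "czy \<in> V" "betw w czy z" "betw w czy y" "betw z czy y" "D w czy = gromov_product D w z y"
    using medianE[of w z y] m by metis
  have up: "cnt p q + 2 * cnt w c \<le> cnt w p + cnt w q + 1" and lo: "cnt w p + cnt w q \<le> cnt p q + 2 * cnt w c + 2"
    if "p \<in> V" "q \<in> V" "c \<in> V" "betw w c p" "betw w c q" "betw p c q" for p q c
    using that m cnt_add_ge[of p q c] cnt_add_le[of p q c] cnt_add_ge[of w p c] cnt_add_le[of w p c]
      cnt_add_ge[of w q c] cnt_add_le[of w q c] cnt_sym[of p c]
    by linarith+
  have "D x y + D z w \<le> max (D x z + D y w) (D x w + D y z)"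
    using four_pointD[OF tree, of x y z w] m by simp
  then have "gromov_product D w x z \<le> gromov_product D w x y \<or> gromov_product D w z y \<le> gromov_product D w x y"
    using D_sym[of w x] D_sym[of w y] D_sym[of w z] D_sym[of z y] m
    by (auto simp: gromov_product_def max_def field_simps split: if_splits)
  then have "cnt w cxz \<le> cnt w cxy \<or> cnt w czy \<le> cnt w cxy"
  proof
    assume "gromov_product D w x z \<le> gromov_product D w x y"
    then have "betw w cxz cxy" using betw_order[of w x cxy cxz] m cxy cxz by simp
    then show ?thesis using cnt_add_le[of w cxy cxz] m cxy cxz by simp
  next
    assume "gromov_product D w z y \<le> gromov_product D w x y"
    then have "betw w czy cxy" using betw_order[of w y cxy czy] m cxy czy by simp
    then show ?thesis using cnt_add_le[of w cxy czy] m cxy czy by simp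
  qed
  then have "cnt x y + cnt z w \<le> cnt x z + cnt y w + 3 \<or> cnt x y + cnt z w \<le> cnt x w + cnt y z + 3"
    using up[of x y cxy] lo[of x z cxz] lo[of z y czy] m cxy cxz czy cnt_sym[of w x] cnt_sym[of w y] cnt_sym[of w z] cnt_sym[of z y]
    by auto
  then show "N x y + N z w \<le> max (N x z + N y w) (N x w + N y z) + 2 * (5 / 2)"
    using N_bounds(2)[of x y] N_bounds(2)[of z w] N_bounds(1)[OF m(1), of z] N_bounds(1)[OF m(2), of w]
      N_bounds(1)[OF m(1), of w] N_bounds(1)[OF m(2), of z]
    by (auto simp: max_def)
qed

lemma coarse_N:
  assumes pq: "p \<in> V" "q \<in> V" and t: "0 \<le> t" "t \<le> N p q"
  shows "\<exists>z\<in>V. N p z \<le> t + 2 \<and> N z q \<le> N p q - t + 2"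
proof (cases "p = q")
  case True
  then show ?thesis using pq t by (intro bexI[of _ p]) (auto simp: N_def)
next
  case False
  \<comment> \<open>\<open>t\<close> may exceed \<open>cnt p q\<close>, since \<open>N\<close> is
    larger by 1.\<close>
  define i where "i = min (nat \<lfloor>t\<rfloor>) (cnt p q)"
  have Npq: "N p q = real (cnt p q) + 1" using False by (simp add: N_def)
  have i: "real i \<le> t" "t \<le> real i + 1" using t Npq by (auto simp: i_def min_def) linarith+
  have "chain (i + (cnt p q - i)) p q" using chain_iff[OF pq] by (simp add: i_def)
  then obtain z where z: "z \<in> V" "betw p z q" "chain i p z" "chain (cnt p q - i) z q"
    using chain_decompose[OF pq] by blast
  then have "i \<le> cnt p z" "cnt p q - i \<le> cnt z q" "cnt p z + cnt z q \<le> cnt p q"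
    using chain_iff cnt_add_le pq by auto
  then have "cnt p z \<le> i" "cnt z q \<le> cnt p q - i" by linarith+
  moreover have "i \<le> cnt p q" by (simp add: i_def)
  ultimately show ?thesis using z(1) N_bounds(2)[of p z] N_bounds(2)[of z q] i Npq
    by (intro bexI[of _ z]) (auto simp: of_nat_diff)
qed

section \<open>Acylindricity for the counting metric\<close>

definition W :: "'g set" where
  "W = {g \<in> carrier G. D a (act g a) \<le> \<eta> \<and> D b (act g b) \<le> \<eta>}"

text \<open>If all elements of \<open>A\<close> carry a translate of the segment to nearly the same
  place as \<open>g0\<close>, their differences from \<open>g0\<close>, conjugated back to the
  original segment, lie in \<open>W\<close>.\<close>

lemma coarse_stabilizer_seg:
  assumes "seg w z" "g0 \<in> carrier G" "A \<subseteq> carrier G"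
    and "\<And>g. g \<in> A \<Longrightarrow> D (act g0 w) (act g w) \<le> \<eta> \<and> D (act g0 z) (act g z) \<le> \<eta>"
  shows "card A \<le> card W"
proof -
  obtain v where v: "v \<in> carrier G" "w = act v a \<and> z = act v b \<or> w = act v b \<and> z = act v a"
    using assms(1) by (auto simp: seg_def)
  let ?f = "\<lambda>g. inv (g0 \<otimes> v) \<otimes> (g \<otimes> v)"
  have inj: "inj_on ?f A" using assms v by (intro inj_onI) (simp add: subset_iff)
  have fin: "finite W" using finite_W by (simp add: W_def)
  have D: "D p (act (?f g) p) = D (act g0 (act v p)) (act g (act v p))" if "p \<in> V" "g \<in> A" for p g
  proof -
    have g: "g \<in> carrier G" using that assms by auto
    have "D p (act (?f g) p) = D (act (g0 \<otimes> v) p) (act (g0 \<otimes> v) (act (?f g) p))"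
      using that v assms g by (subst D_act) auto
    also have "act (g0 \<otimes> v) (act (?f g) p) = act (g \<otimes> v) p"
      using that v assms g by (simp flip: act_mult add: m_assoc[symmetric] r_inv)
    finally show ?thesis using that v assms g by (simp add: act_mult)
  qed
  have "?f ` A \<subseteq> W"
  proof
    fix x assume "x \<in> ?f ` A"
    then obtain g where g: "g \<in> A" "x = ?f g" by blast
    then show "x \<in> W" using D[OF ab(1) g(1)] D[OF ab(2) g(1)] assms(2,3) assms(4)[OF g(1)] v by (auto simp: W_def)
  qed
  then show ?thesis using inj fin by (intro card_inj_on_le)
qed

text \<open>The number of intervals of length \<eta> needed to cover the half-open interval from 0
  to \<open>L\<close>.\<close>

definition K1 :: nat where "K1 = nat \<lceil>L / \<eta>\<rceil>"

text \<open>Translates that start less than \<open>L\<close> behind the first one are sorted into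
  \<open>K1\<close> intervals of starting positions; within an interval both endpoints agree up to
  \<eta>, which leaves at most \<open>card W\<close> elements. All others lie beyond the end of the
  first translate, where the count has dropped by at least 1.\<close>

lemma count_translates:
  assumes wz: "seg w z" and y: "y \<in> V" "y' \<in> V" and U: "finite U" "U \<subseteq> carrier G"
    and between: "\<And>u. u \<in> U \<Longrightarrow> D y (act u w) + L + D (act u z) y' = D y y'"
    and k: "cnt y y' \<le> k"
  shows "card U \<le> k * (K1 * card W)"
  using y(1) U between k
proof (induction k arbitrary: y U)
  case 0
  have "U = {}"
  proof (rule ccontr)
    assume "U \<noteq> {}"
    then obtain u where "u \<in> U" by blast
    then have "chain 1 y y'" using 0 seg_act[OF _ wz, of u] by auto
    then show False using chain_iff[of y y' 1] 0 y by simp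
  qed
  then show ?case by simp
next
  case (Suc k)
  note m = seg_V[OF wz]
  define pos where "pos u = D y (act u w)" for u
  show ?case
  proof (cases "U = {}")
    case False
    then obtain u0 where u0: "u0 \<in> U" "\<And>u. u \<in> U \<Longrightarrow> pos u0 \<le> pos u"
      using ex_min_if_finite[of "pos ` U"] Suc.prems(2) by (metis (no_types, lifting) finite_imageI image_iff image_is_empty linorder_not_le)
    have c: "u \<in> carrier G" if "u \<in> U" for u using that Suc.prems by auto
    have on: "betw y (act u w) y'" "betw y (act u z) y'" "D y (act u z) = pos u + L" if "u \<in> U" for u
    proof -
      have mu: "act u w \<in> V" "act u z \<in> V" using m c[OF that] by auto
      have "D (act u w) y' \<le> D (act u w) (act u z) + D (act u z) y'" "D y (act u z) \<le> D y (act u w) + D (act u w) (act u z)"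
        "D y y' \<le> D y (act u z) + D (act u z) y'" "D y y' \<le> D y (act u w) + D (act u w) y'"
        using D_triangle[OF mu y(2)] D_triangle[OF Suc.prems(1) mu] D_triangle[OF Suc.prems(1) mu(2) y(2)]
          D_triangle[OF Suc.prems(1) mu(1) y(2)] by blast+
      moreover have "D (act u w) (act u z) = L" using m c[OF that] seg_D[OF wz] by simp
      ultimately show "betw y (act u w) y'" "betw y (act u z) y'" "D y (act u z) = pos u + L"
        using Suc.prems(4)[OF that] by (auto simp: betw_def pos_def)
    qed
    define U1 where "U1 = {u \<in> U. pos u < pos u0 + L}"
    define U2 where "U2 = {u \<in> U. pos u0 + L \<le> pos u}"
    have "card U2 \<le> k * (K1 * card W)"
    proof (rule Suc.IH)
      let ?y = "act u0 z"
      show "?y \<in> V" using m c u0 by auto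
      show "finite U2" "U2 \<subseteq> carrier G" using Suc.prems by (auto simp: U2_def)
      show "D ?y (act u w) + L + D (act u z) y' = D ?y y'" if "u \<in> U2" for u
      proof -
        have u: "u \<in> U" using that by (simp add: U2_def)
        have "betw ?y (act u w) y'"
          using betw_order(2)[of y y' "act u w" ?y] on[OF u] on[OF u0(1)] that m c[OF u] c[OF u0(1)] Suc.prems y
          by (auto simp: U2_def pos_def)
        moreover have "D (act u w) y' = L + D (act u z) y'"
          using on[OF u] Suc.prems(4)[OF u] by (auto simp: betw_def)
        ultimately show ?thesis by (simp add: betw_def)
      qed
      have "chain (Suc (cnt ?y y')) y y'"
        using Suc.prems(4)[OF u0(1)] seg_act[OF c[OF u0(1)] wz] chain_iff[of ?y y' "cnt ?y y'"] m c[OF u0(1)] y by auto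
      then have "Suc (cnt ?y y') \<le> cnt y y'" using chain_iff Suc.prems y by blast
      then show "cnt ?y y' \<le> k" using Suc.prems by simp
    qed
    moreover have "card U1 \<le> K1 * card W"
    proof -
      define fl where "fl u = nat \<lfloor>(pos u - pos u0) / \<eta>\<rfloor>" for u
      have fl: "fl u < K1" if "u \<in> U1" for u
      proof -
        have "(pos u - pos u0) / \<eta> < L / \<eta>" "0 \<le> (pos u - pos u0) / \<eta>"
          using that u0 \<eta>_pos by (auto simp: U1_def divide_strict_right_mono)
        then have "\<lfloor>(pos u - pos u0) / \<eta>\<rfloor> < \<lceil>L / \<eta>\<rceil>" "0 \<le> \<lfloor>(pos u - pos u0) / \<eta>\<rfloor>"
          by (auto simp: floor_less_iff) (meson ceiling_correct le_of_int_ceiling less_le_trans)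
        then show ?thesis unfolding fl_def K1_def by linarith
      qed
      have U1: "(\<Union>i<K1. {u \<in> U1. fl u = i}) = U1" using fl by auto
      have "card (\<Union>i<K1. {u \<in> U1. fl u = i}) \<le> (\<Sum>i<K1. card {u \<in> U1. fl u = i})"
        by (rule card_UN_le) simp
      then have "card U1 \<le> (\<Sum>i<K1. card {u \<in> U1. fl u = i})" by (simp only: U1)
      also have "\<dots> \<le> (\<Sum>i<K1. card W)"
      proof (rule sum_mono)
        fix i
        show "card {u \<in> U1. fl u = i} \<le> card W"
        proof (cases "{u \<in> U1. fl u = i} = {}")
          case False
          then obtain g0 where g0: "g0 \<in> U1" "fl g0 = i" by blast
          then have g0U: "g0 \<in> U" by (simp add: U1_def)
          show ?thesis
          proof (rule coarse_stabilizer_seg[OF wz c[OF g0U]])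
            show "{u \<in> U1. fl u = i} \<subseteq> carrier G" using c by (auto simp: U1_def)
            fix g assume "g \<in> {u \<in> U1. fl u = i}"
            then have g: "g \<in> U" "fl g = i" by (auto simp: U1_def)
            have "\<lfloor>(pos g - pos u0) / \<eta>\<rfloor> = \<lfloor>(pos g0 - pos u0) / \<eta>\<rfloor>"
            proof -
              have "0 \<le> (pos g - pos u0) / \<eta>" "0 \<le> (pos g0 - pos u0) / \<eta>"
                using u0(2)[OF g(1)] u0(2)[OF g0U] \<eta>_pos by simp_all
              moreover have "nat \<lfloor>(pos g - pos u0) / \<eta>\<rfloor> = nat \<lfloor>(pos g0 - pos u0) / \<eta>\<rfloor>"
                using g g0 by (simp add: fl_def)
              ultimately show ?thesis by (simp add: eq_nat_nat_iff)
            qed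
            then have "\<bar>(pos g - pos u0) / \<eta> - (pos g0 - pos u0) / \<eta>\<bar> < 1" by linarith
            moreover have "(pos g - pos u0) / \<eta> - (pos g0 - pos u0) / \<eta> = (pos g - pos g0) / \<eta>"
              by (simp add: diff_divide_distrib)
            ultimately have "\<bar>pos g - pos g0\<bar> < \<eta>" using \<eta>_pos by (simp add: abs_divide)
            moreover have "D p q \<le> \<bar>D y p - D y q\<bar>" if "p \<in> V" "q \<in> V" "betw y p y'" "betw y q y'" for p q
              using betw_order[of y y' p q] betw_order[of y y' q p] that Suc.prems y D_sym[of p q]
              by (cases "D y p \<le> D y q") (auto simp: betw_def)
            ultimately show "D (act g0 w) (act g w) \<le> \<eta> \<and> D (act g0 z) (act g z) \<le> \<eta>"
              using on[OF g(1)] on[OF g0U] c[OF g(1)] c[OF g0U] m unfolding pos_def by (smt (verit) act_V)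
          qed
        qed (simp only: card.empty le0)
      qed
      finally show ?thesis by simp
    qed
    moreover have "U = U1 \<union> U2" by (auto simp: U1_def U2_def)
    ultimately show ?thesis using card_Un_le[of U1 U2] by simp
  qed simp
qed

text \<open>Replacing \<open>p\<close> by \<open>p'\<close> changes the geodesic to \<open>q\<close>
  only up to the branch point \<open>c\<close>. Since more translates fit before \<open>w\<close>
  than between \<open>p\<close> and \<open>p'\<close>, the point \<open>c\<close> comes before
  \<open>w\<close>, and the translate \<open>[w, z]\<close> survives.\<close>

lemma slide_endpoint:
  assumes m: "p \<in> V" "p' \<in> V" "q \<in> V" and wz: "seg w z"
    and on: "D p w + L + D z q = D p q" and gt: "cnt p p' < cnt p w"
  shows "D p' w + L + D z q = D p' q"
proof -
  have wzV: "w \<in> V" "z \<in> V" using seg_V[OF wz] by auto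
  obtain c where c: "c \<in> V" "betw p c p'" "betw p c q" "betw p' c q"
    using medianE[OF m] by metis
  have tri: "D p q \<le> D p w + D w q" "D w q \<le> L + D z q"
    using D_triangle[OF m(1) wzV(1) m(3)] D_triangle[OF wzV m(3)] seg_D[OF wz] by simp_all
  then have w: "betw p w q" "D w q = L + D z q" using on by (auto simp: betw_def)
  have "\<not> D p w \<le> D p c"
  proof
    assume "D p w \<le> D p c"
    then have "betw p w c" using betw_order[of p q c w] m c w wzV by auto
    then show False using cnt_add_le[of p c w] cnt_add_le[of p p' c] m c wzV gt by auto
  qed
  then have "betw p c w" "betw c w q" using betw_order[of p q w c] m c w wzV by auto
  then have "betw p' w q" using betw_trans[of q p' c w] betw_sym m c wzV by blast
  then show ?thesis using w by (simp add: betw_def)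
qed

lemma cnt_le_of_N: "p \<in> V \<Longrightarrow> q \<in> V \<Longrightarrow> N p q \<le> real k \<Longrightarrow> cnt p q \<le> k"
  using N_bounds(1)[of p q] by linarith

text \<open>Choose a translate \<open>[w, z]\<close> in the middle of the segment from
  \<open>x\<close> to \<open>y\<close>. An element moving both ends by little in \<open>N\<close>
  keeps its image on that segment, by two slides, and within a part of bounded count;
  \<open>count_translates\<close> then bounds the number of elements.\<close>

lemma acylindrical_N:
  assumes x: "x \<in> V" "y \<in> V" and far: "N x y \<ge> 2 * real E + 6"
  shows "finite {u \<in> carrier G. N x (act u x) \<le> real E \<and> N y (act u y) \<le> real E} \<and>
    card {u \<in> carrier G. N x (act u x) \<le> real E \<and> N y (act u y) \<le> real E} \<le> (2 * E + 5) * (K1 * card W)"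
proof (rule finite_if_finite_subsets_card_bdd)
  fix A assume A: "A \<subseteq> {u \<in> carrier G. N x (act u x) \<le> real E \<and> N y (act u y) \<le> real E}" "finite A"
  have c: "u \<in> carrier G" if "u \<in> A" for u using A that by auto
  have near: "cnt x (act u x) \<le> E" "cnt y (act u y) \<le> E" if "u \<in> A" for u
    using A(1) that x c[OF that] by (auto intro!: cnt_le_of_N)
  \<comment> \<open>One translate in the middle and \<open>E + 1\<close> on either side, more than
    the ends can be moved.\<close>
  have "(E + 1) + (1 + (E + 1)) \<le> cnt x y" using far N_bounds(2)[of x y] by linarith
  then have "chain ((E + 1) + (1 + (E + 1))) x y" using chain_iff x by blast
  then obtain v where v: "v \<in> V" "betw x v y" "chain (E + 1) x v" "chain (1 + (E + 1)) v y"
    using chain_decompose[OF x] by blast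
  then obtain w z where wz: "seg w z" "D v w + L + D z y = D v y" "chain (E + 1) z y"
    unfolding plus_1_eq_Suc chain.simps(2) by blast
  note m = seg_V[OF wz(1)]
  have "D x y \<le> D x w + D w y" "D w y \<le> L + D z y" "D x w \<le> D x v + D v w" "D v y \<le> D v w + D w y"
    using D_triangle[of x w y] D_triangle[of w z y] D_triangle[of x v w] D_triangle[of v w y] x v m seg_D[OF wz(1)] by auto
  then have on: "D x w + L + D z y = D x y" "betw x v w" "betw x w y" "D w y = L + D z y"
    using v wz by (auto simp: betw_def)
  have cw: "E < cnt x w" using chain_right[of x w v "E + 1"] chain_iff[of x w "E + 1"] v on x m by auto
  have cz: "E < cnt y z" using chain_iff[of z y "E + 1"] wz(3) cnt_sym[of y z] x m by auto
  have slid: "D x (act u w) + L + D (act u z) y = D x y" if u: "u \<in> A" for u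
  proof -
    note cu = c[OF u]
    have 1: "D x (act u w) + L + D (act u z) (act u y) = D x (act u y)"
    proof (rule slide_endpoint[OF _ x(1) _ seg_act[OF cu wz(1)]])
      show "D (act u x) (act u w) + L + D (act u z) (act u y) = D (act u x) (act u y)" using on(1) x m cu by simp
      show "cnt (act u x) x < cnt (act u x) (act u w)"
        using near(1)[OF u] cw cnt_act[OF cu x(1)] cnt_sym[of "act u x" x] x m cu by simp
    qed (use cu x in auto)
    have "D y (act u z) + L + D (act u w) x = D y x"
    proof (rule slide_endpoint[OF _ x(2) x(1) seg_sym[OF seg_act[OF cu wz(1)]]])
      show "D (act u y) (act u z) + L + D (act u w) x = D (act u y) x"
        using 1 x m cu D_sym[of "act u w" x] D_sym[of "act u y" x] D_sym[of y z] by simp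
      show "cnt (act u y) y < cnt (act u y) (act u z)"
        using near(2)[OF u] cz cnt_act[OF cu x(2)] cnt_sym[of "act u y" y] x m cu by simp
    qed (use cu x in auto)
    then show ?thesis
      using x m cu D_sym[of y "act u z"] D_sym[of "act u w" x] D_sym[of y x] by simp
  qed
  show "card A \<le> (2 * E + 5) * (K1 * card W)"
  proof (cases "A = {}")
    case False
    have fin: "finite ((\<lambda>u. D x (act u w)) ` A)" "(\<lambda>u. D x (act u w)) ` A \<noteq> {}" using A False by auto
    obtain u1 where u1: "u1 \<in> A" "\<And>u. u \<in> A \<Longrightarrow> D x (act u1 w) \<le> D x (act u w)"
      using Min_in[OF fin] Min_le[OF fin(1)] by auto
    obtain u2 where u2: "u2 \<in> A" "\<And>u. u \<in> A \<Longrightarrow> D x (act u w) \<le> D x (act u2 w)"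
      using Max_in[OF fin] Max_ge[OF fin(1)] by auto
    have V: "act u w \<in> V" "act u z \<in> V" if "u \<in> A" for u using m c[OF that] by auto
    have b: "betw x (act u w) y" "betw x (act u z) y" "D x (act u z) = D x (act u w) + L" if u: "u \<in> A" for u
    proof -
      have "D (act u w) (act u z) = L" using m c[OF u] seg_D[OF wz(1)] by simp
      then show "betw x (act u w) y" "betw x (act u z) y" "D x (act u z) = D x (act u w) + L"
        using slid[OF u] D_triangle[OF V[OF u] x(2)] D_triangle[OF x(1) V[OF u]]
          D_triangle[OF x(1) V(2)[OF u] x(2)] D_triangle[OF x(1) V(1)[OF u] x(2)]
        by (auto simp: betw_def)
    qed
    let ?p = "act u1 w" and ?q = "act u2 z"
    have pq: "betw x ?p ?q" "betw ?p ?q y"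
      using betw_order[of x y ?q ?p] b[OF u1(1)] b[OF u2(1)] V[OF u1(1)] V[OF u2(1)] x u2(2)[OF u1(1)] ab_pos by auto
    have dpq: "D ?p ?q = D x ?q - D x ?p" using pq by (simp add: betw_def)
    have D_pos: "D ?p (act u w) = D x (act u w) - D x ?p" "D (act u z) ?q = D x ?q - D x (act u z)" if u: "u \<in> A" for u
    proof -
      have "betw x ?p (act u w)" using betw_order[of x y "act u w" ?p] b[OF u1(1)] b[OF u] V[OF u1(1)] V[OF u] x u1(2)[OF u] by auto
      moreover have "betw x (act u z) ?q" using betw_order[of x y ?q "act u z"] b[OF u2(1)] b[OF u] V[OF u2(1)] V[OF u] x u2(2)[OF u] by auto
      ultimately show "D ?p (act u w) = D x (act u w) - D x ?p" "D (act u z) ?q = D x ?q - D x (act u z)"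
        by (simp_all add: betw_def)
    qed
    \<comment> \<open>Going from the middle translate to either extreme image costs
      \<open>E + 1\<close>; the translate itself contributes 1 and the two subdivisions of the
      segment 2.\<close>
    have cnt: "cnt ?p ?q \<le> 2 * E + 5"
    proof -
      have "cnt x y \<ge> cnt x ?p + (cnt ?p ?q + cnt ?q y)"
        using cnt_add_le[of x y ?p] cnt_add_le[of ?p y ?q] pq b[OF u1(1)] V[OF u1(1)] V[OF u2(1)] x by fastforce
      moreover have "cnt x w \<le> E + cnt x ?p + 1"
        using cnt_act[OF c[OF u1(1)] x(1), of w] cnt_triangle[of "act u1 x" x ?p] near(1)[OF u1(1)] x V[OF u1(1)] c[OF u1(1)] m
          cnt_sym[of "act u1 x" x] by simp
      moreover have "cnt z y \<le> cnt ?q y + E + 1"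
        using cnt_act[OF c[OF u2(1)] _ x(2), of z] cnt_triangle[of ?q y "act u2 y"] near(2)[OF u2(1)] x V[OF u2(1)] c[OF u2(1)] m by simp
      moreover have "cnt x y \<le> cnt x w + (cnt w z + cnt z y + 1) + 1"
        using cnt_triangle[of x w y] cnt_triangle[of w z y] x m by auto
      moreover have "cnt w z \<le> 1"
        using cnt_length[of w z] m seg_D[OF wz(1)] ab_pos by simp
      ultimately show ?thesis by linarith
    qed
    show ?thesis
    proof (rule count_translates[OF wz(1) _ _ A(2) _ _ cnt])
      show "D ?p (act u w) + L + D (act u z) ?q = D ?p ?q" if "u \<in> A" for u
        using D_pos[OF that] b(3)[OF that] dpq by simp
    qed (use V u1 u2 c in auto)
  qed simp
qed

text \<open>If \<open>v0\<close> lies between the two orbits in the tree, counts on both sides add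
  up, so all their Gromov products for \<open>N\<close> at \<open>v0\<close> are at most 1 and the
  orbits do not diverge together.\<close>

theorem acylindrically_hyperbolic_of_segment:
  assumes cV: "countable V" and gh: "g \<in> carrier G" "h \<in> carrier G" and v0: "v0 \<in> V"
    and lox: "\<And>k. k \<in> {g, h} \<Longrightarrow> \<exists>K\<ge>1. \<exists>C\<ge>0. \<forall>m n :: int.
        \<bar>real_of_int m - real_of_int n\<bar> / K - C \<le> N (act (k [^] m) v0) (act (k [^] n) v0) \<and>
        N (act (k [^] m) v0) (act (k [^] n) v0) \<le> K * \<bar>real_of_int m - real_of_int n\<bar> + C"
    and indep: "\<And>s t m n. s \<in> {1, -1} \<Longrightarrow> t \<in> {1, -1} \<Longrightarrow>
      betw (act (g [^] (s * int m)) v0) v0 (act (h [^] (t * int n)) v0)"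
  shows "acylindrically_hyperbolic TYPE('g \<times> real) G"
proof (rule acylindrically_hyperbolicI[OF group_axioms cV pseudo_metric_N v0 four_point_N, of 2 act g h])
  fix \<epsilon> :: real assume "0 \<le> \<epsilon>"
  define E where "E = nat \<lceil>\<epsilon>\<rceil>"
  have E: "\<epsilon> \<le> real E" unfolding E_def by (rule real_nat_ceiling_ge)
  have "finite {u \<in> carrier G. N x (act u x) \<le> \<epsilon> \<and> N y (act u y) \<le> \<epsilon>} \<and>
    card {u \<in> carrier G. N x (act u x) \<le> \<epsilon> \<and> N y (act u y) \<le> \<epsilon>} \<le> (2 * E + 5) * (K1 * card W)"
    if "x \<in> V" "y \<in> V" "2 * real E + 6 \<le> N x y" for x y
  proof -
    have "{u \<in> carrier G. N x (act u x) \<le> \<epsilon> \<and> N y (act u y) \<le> \<epsilon>} \<subseteq>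
      {u \<in> carrier G. N x (act u x) \<le> real E \<and> N y (act u y) \<le> real E}" using E by auto
    then show ?thesis using acylindrical_N[OF that] by (meson card_mono finite_subset order_trans)
  qed
  then show "\<exists>K::nat. \<exists>R. \<forall>x\<in>V. \<forall>y\<in>V. R \<le> N x y \<longrightarrow>
      finite {u \<in> carrier G. N x (act u x) \<le> \<epsilon> \<and> N y (act u y) \<le> \<epsilon>} \<and>
      card {u \<in> carrier G. N x (act u x) \<le> \<epsilon> \<and> N y (act u y) \<le> \<epsilon>} \<le> K" by blast
next
  fix s t :: int assume st: "s \<in> {1, -1}" "t \<in> {1, -1}"
  have "gromov_product N v0 (act (g [^] (s * int m)) v0) (act (h [^] (t * int n)) v0) \<le> 1" for m n
  proof -
    let ?p = "act (g [^] (s * int m)) v0" and ?q = "act (h [^] (t * int n)) v0"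
    have V: "?p \<in> V" "?q \<in> V" using gh v0 by auto
    have "cnt ?p v0 + cnt v0 ?q \<le> cnt ?p ?q" by (rule cnt_add_le) (use V v0 indep[OF st] in auto)
    then show ?thesis
      using N_bounds(1)[OF V(1), of ?q] N_bounds(2)[of v0 ?p] N_bounds(2)[of v0 ?q] cnt_sym[OF V(1) v0]
      unfolding gromov_product_def by auto
  qed
  then have "\<not> (\<exists>k. \<forall>m\<ge>k. \<forall>n\<ge>k. 2 \<le> gromov_product N v0 (act (g [^] (s * int m)) v0) (act (h [^] (t * int n)) v0))"
    by (metis numeral_le_one_iff order_refl order_trans semiring_norm(69))
  then show "\<not> diverges_together N v0 (\<lambda>n. act (g [^] (s * int n)) v0) (\<lambda>n. act (h [^] (t * int n)) v0)"
    unfolding diverges_together_def by blast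
qed (auto simp: act_mult gh N_act coarse_N intro: lox)

end

section \<open>Rescaled limits\<close>

context action_sequence
begin

text \<open>A coarse coordinate: \<open>y\<close> lies near the point at distance \<open>t\<close>
  from \<open>P\<close> on a geodesic from \<open>P\<close> to \<open>Q\<close>.\<close>

definition near :: "'x \<Rightarrow> 'x \<Rightarrow> real \<Rightarrow> real \<Rightarrow> 'x \<Rightarrow> bool" where
  "near P Q c t y \<longleftrightarrow> \<bar>d P y - t\<bar> \<le> c \<and> \<bar>d Q y - (d P Q - t)\<bar> \<le> c"

lemma near_mono: "near P Q c t y \<Longrightarrow> c \<le> c' \<Longrightarrow> near P Q c' t y"
  by (auto simp: near_def)

lemma near_geo: "P \<in> M \<Longrightarrow> Q \<in> M \<Longrightarrow> 0 \<le> t \<Longrightarrow> t \<le> d P Q \<Longrightarrow> near P Q 0 t (geo P Q t)"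
  using geo[of P Q t] commute[of Q "geo P Q t"] by (simp add: near_def)

text \<open>The four-point inequality for \<open>y\<close>, \<open>y'\<close>, \<open>P\<close>,
  \<open>Q\<close>: a coarse coordinate determines a point up to a bounded error.\<close>

lemma near_close:
  assumes "P \<in> M" "Q \<in> M" "y \<in> M" "y' \<in> M" "near P Q c t y" "near P Q c t' y'"
  shows "d y y' \<le> \<bar>t - t'\<bar> + 2 * c + 2 * \<delta>"
proof -
  have "d y y' + d P Q \<le> max (d y P + d y' Q) (d y Q + d y' P) + 2 * \<delta>"
    by (rule four_pointD[OF hyp]) (use assms in auto)
  then show ?thesis
    using assms commute[of y P] commute[of y Q] commute[of y' P] commute[of y' Q]
    by (auto simp: near_def max_def abs_if split: if_splits)
qed

text \<open>Knowing which sum is the smallest makes the other two agree up to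
  \<open>2 * \<delta>\<close>. This bound ignores the scale, which is why tree data can yield
  bounded errors in \<open>M\<close>.\<close>

lemma four_point_two_largest:
  assumes "x \<in> M" "y \<in> M" "z \<in> M" "w \<in> M" "d x w + d y z + 2 * \<delta> < d x z + d y w"
  shows "\<bar>d x y + d z w - (d x z + d y w)\<bar> \<le> 2 * \<delta>"
proof -
  have "d x y + d z w \<le> max (d x z + d y w) (d x w + d y z) + 2 * \<delta>"
    "d x z + d y w \<le> max (d x y + d z w) (d x w + d z y) + 2 * \<delta>"
    using four_pointD[OF hyp, of x y z w] four_pointD[OF hyp, of x z y w] assms by auto
  then show ?thesis using assms commute[of z y] \<delta>_nonneg by (auto simp: max_def split: if_splits)
qed

text \<open>
  On the middle part of a long segment whose ends it does not move too far, an isometry is a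
  coarse translation; here \<open>P'\<close>, \<open>Q'\<close>, \<open>y'\<close> are the images of \<open>P\<close>, \<open>Q\<close>, \<open>y\<close>.
\<close>

lemma near_shift:
  assumes m: "P \<in> M" "Q \<in> M" "P' \<in> M" "Q' \<in> M" "y \<in> M" "y' \<in> M"
    and iso: "d P' Q' = d P Q" "d P' y' = d P y" "d Q' y' = d Q y"
    and y: "near P Q c t y"
    and 1: "d P P' + d P Q - t + 2 * \<delta> + 2 * c < d P Q' + t"
    and 2: "d Q Q' + t + 2 * \<delta> + 2 * c < d Q P' + d P Q - t"
    and 3: "d P P' + d Q Q' + 2 * \<delta> < 2 * d P Q"
  shows "near P Q (c + 4 * \<delta>) (t + (d P Q' - d P Q)) y'"
proof -
  have a: "\<bar>d P y' + d Q' P' - (d P Q' + d y' P')\<bar> \<le> 2 * \<delta>"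
    by (rule four_point_two_largest)
      (use m 1 y iso commute[of y' P'] commute[of y' Q'] commute[of Q' P'] in \<open>auto simp: near_def\<close>)
  have b: "\<bar>d Q y' + d P' Q' - (d Q P' + d y' Q')\<bar> \<le> 2 * \<delta>"
    by (rule four_point_two_largest)
      (use m 2 y iso commute[of y' P'] commute[of y' Q'] commute[of Q' P'] in \<open>auto simp: near_def\<close>)
  have c: "\<bar>d P Q' + d Q P' - (d P Q + d Q' P')\<bar> \<le> 2 * \<delta>"
    by (rule four_point_two_largest)
      (use m 3 iso commute[of Q' P'] commute[of Q' Q] in auto)
  from y have n: "\<bar>d P y - t\<bar> \<le> c" "\<bar>d Q y - (d P Q - t)\<bar> \<le> c" by (auto simp: near_def)
  show ?thesis
    using a b c n iso commute[of y' P'] commute[of y' Q'] commute[of Q' P'] \<delta>_nonneg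
    unfolding near_def by linarith
qed

end

locale tree_limit = limit_action G M d T \<delta> x0 \<F> \<mu> V D
  for G :: "('g, 'm) monoid_scheme" (structure) and M :: "'x set" and d T \<delta> x0 \<F> \<mu> V D +
  assumes scale: "filterlim \<mu> at_top \<F>"
begin

lemma const_over_scale: "((\<lambda>n. C / \<mu> n) \<longlongrightarrow> 0) \<F>"
  by (rule tendsto_divide_0[OF tendsto_const]) (use scale filterlim_at_top_imp_at_infinity in blast)

lemma tree: "four_point V D 0"
  by (rule four_point_limit) (rule const_over_scale)

text \<open>Translates a strict inequality in the tree into an inequality in \<open>M\<close> with
  any prescribed slack.\<close>

lemma eventually_greater:
  assumes "((\<lambda>n. f n / \<mu> n) \<longlongrightarrow> l) \<F>" "0 < l"
  shows "eventually (\<lambda>n. f n > C) \<F>"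
proof -
  have "eventually (\<lambda>n. l / 2 < f n / \<mu> n) \<F>" using assms by (intro order_tendstoD) auto
  moreover have "eventually (\<lambda>n. 2 * \<bar>C\<bar> / l + 1 \<le> \<mu> n) \<F>" using scale by (simp add: filterlim_at_top)
  ultimately show ?thesis
  proof eventually_elim
    case (elim n)
    have "l / 2 * (2 * \<bar>C\<bar> / l + 1) = \<bar>C\<bar> + l / 2" using assms(2) by (simp add: field_simps)
    then have "C < l / 2 * (2 * \<bar>C\<bar> / l + 1)" using assms(2) by linarith
    also have "\<dots> \<le> l / 2 * \<mu> n" using elim assms(2) by (intro mult_left_mono) auto
    also have "\<dots> < f n" using elim \<mu>_pos[of n] by (simp add: field_simps)
    finally show ?case .
  qed
qed

text \<open>The source of all finiteness in the tree case. The displacement must be bounded before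
  rescaling, and the test points \<open>p\<close>, \<open>q\<close> may be chosen outside
  \<open>V\<close>.\<close>

lemma finite_of_bounded_displacement:
  assumes Z: "Z \<subseteq> carrier G" and \<epsilon>: "\<epsilon> \<ge> 0"
    and pq: "eventually (\<lambda>n. p n \<in> M \<and> q n \<in> M) \<F>" and far: "\<And>C. eventually (\<lambda>n. d (p n) (q n) > C) \<F>"
    and bdd: "\<And>z. z \<in> Z \<Longrightarrow> eventually (\<lambda>n. d (p n) (T n z (p n)) \<le> \<epsilon> \<and> d (q n) (T n z (q n)) \<le> \<epsilon>) \<F>"
  shows "finite Z"
proof -
  obtain N R where NR: "\<And>A. finite A \<Longrightarrow> A \<subseteq> carrier G \<Longrightarrow> card A > N \<Longrightarrow>
      eventually (\<lambda>n. \<forall>x\<in>M. \<forall>y\<in>M. d x y \<ge> R \<longrightarrow> (\<exists>g\<in>A. d x (T n g x) > \<epsilon> \<or> d y (T n g y) > \<epsilon>)) \<F>"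
    using asymptotically_acylindrical[OF \<epsilon>] by blast
  have "finite Z \<and> card Z \<le> N"
  proof (rule finite_if_finite_subsets_card_bdd, rule ccontr)
    fix A assume A: "A \<subseteq> Z" "finite A" "\<not> card A \<le> N"
    have "eventually (\<lambda>n. \<forall>z\<in>A. d (p n) (T n z (p n)) \<le> \<epsilon> \<and> d (q n) (T n z (q n)) \<le> \<epsilon>) \<F>"
      using A bdd by (intro eventually_ball_finite) auto
    moreover have "eventually (\<lambda>n. \<forall>x\<in>M. \<forall>y\<in>M. d x y \<ge> R \<longrightarrow> (\<exists>g\<in>A. d x (T n g x) > \<epsilon> \<or> d y (T n g y) > \<epsilon>)) \<F>"
      using NR A Z by auto
    ultimately have "eventually (\<lambda>n. False) \<F>" using pq far[of R]
    proof eventually_elim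
      case (elim n)
      then obtain g where "g \<in> A" "d (p n) (T n g (p n)) > \<epsilon> \<or> d (q n) (T n g (q n)) > \<epsilon>"
        by (meson less_imp_le)
      with elim(1) show False by force
    qed
    then show False using \<F>_nontrivial by simp
  qed
  then show ?thesis by blast
qed

section \<open>Coarse translations along long segments\<close>

definition shift :: "(nat \<Rightarrow> 'x) \<Rightarrow> (nat \<Rightarrow> 'x) \<Rightarrow> 'g \<Rightarrow> nat \<Rightarrow> real" where
  "shift P Q g n = d (P n) (act g Q n) - d (P n) (Q n)"

lemma shift_tendsto:
  "g \<in> carrier G \<Longrightarrow> P \<in> V \<Longrightarrow> Q \<in> V \<Longrightarrow> ((\<lambda>n. shift P Q g n / \<mu> n) \<longlongrightarrow> D P (act g Q) - D P Q) \<F>"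
  unfolding shift_def diff_divide_distrib by (intro tendsto_intros limit) auto

text \<open>The hypotheses are the limits of those of \<open>near_shift\<close>; the first is most
  demanding at \<open>t1\<close>, the second at \<open>t2\<close>. One eventual set of indices
  serves all \<open>y\<close> and all coordinates, so the result can be applied again to an image
  point.\<close>

lemma eventually_near_shift:
  assumes g: "g \<in> carrier G" and PQ: "P \<in> V" "Q \<in> V"
    and 1: "D P (act g P) + D P Q < D P (act g Q) + 2 * t1"
    and 2: "D Q (act g Q) + 2 * t2 < D Q (act g P) + D P Q"
    and 3: "D P (act g P) + D Q (act g Q) < 2 * D P Q"
  shows "eventually (\<lambda>n. \<forall>y\<in>M. \<forall>\<tau>. t1 * \<mu> n \<le> \<tau> \<longrightarrow> \<tau> \<le> t2 * \<mu> n \<longrightarrow> near (P n) (Q n) c \<tau> y \<longrightarrow>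
    near (P n) (Q n) (c + 4 * \<delta>) (\<tau> + shift P Q g n) (T n g y)) \<F>"
proof -
  have V: "act g P \<in> V" "act g Q \<in> V" using g PQ by auto
  have "eventually (\<lambda>n. d (P n) (act g Q n) + 2 * (t1 * \<mu> n) - d (P n) (act g P n) - d (P n) (Q n) > 2 * \<delta> + 2 * c) \<F>"
  proof (rule eventually_greater)
    have "((\<lambda>n. d (P n) (act g Q n) / \<mu> n + 2 * t1 - d (P n) (act g P n) / \<mu> n - d (P n) (Q n) / \<mu> n) \<longlongrightarrow>
      D P (act g Q) + 2 * t1 - D P (act g P) - D P Q) \<F>"
      using V PQ by (intro tendsto_intros limit) auto
    then show "((\<lambda>n. (d (P n) (act g Q n) + 2 * (t1 * \<mu> n) - d (P n) (act g P n) - d (P n) (Q n)) / \<mu> n) \<longlongrightarrow>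
      D P (act g Q) + 2 * t1 - D P (act g P) - D P Q) \<F>"
      using \<mu>_pos by (simp add: add_divide_distrib diff_divide_distrib less_imp_neq[symmetric])
  qed (use 1 in auto)
  moreover have "eventually (\<lambda>n. d (Q n) (act g P n) + d (P n) (Q n) - d (Q n) (act g Q n) - 2 * (t2 * \<mu> n) > 2 * \<delta> + 2 * c) \<F>"
  proof (rule eventually_greater)
    have "((\<lambda>n. d (Q n) (act g P n) / \<mu> n + d (P n) (Q n) / \<mu> n - d (Q n) (act g Q n) / \<mu> n - 2 * t2) \<longlongrightarrow>
      D Q (act g P) + D P Q - D Q (act g Q) - 2 * t2) \<F>"
      using V PQ by (intro tendsto_intros limit) auto
    then show "((\<lambda>n. (d (Q n) (act g P n) + d (P n) (Q n) - d (Q n) (act g Q n) - 2 * (t2 * \<mu> n)) / \<mu> n) \<longlongrightarrow>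
      D Q (act g P) + D P Q - D Q (act g Q) - 2 * t2) \<F>"
      using \<mu>_pos by (simp add: add_divide_distrib diff_divide_distrib less_imp_neq[symmetric])
  qed (use 2 in auto)
  moreover have "eventually (\<lambda>n. 2 * d (P n) (Q n) - d (P n) (act g P n) - d (Q n) (act g Q n) > 2 * \<delta>) \<F>"
  proof (rule eventually_greater)
    have "((\<lambda>n. 2 * (d (P n) (Q n) / \<mu> n) - d (P n) (act g P n) / \<mu> n - d (Q n) (act g Q n) / \<mu> n) \<longlongrightarrow>
      2 * D P Q - D P (act g P) - D Q (act g Q)) \<F>"
      using V PQ by (intro tendsto_intros limit) auto
    then show "((\<lambda>n. (2 * d (P n) (Q n) - d (P n) (act g P n) - d (Q n) (act g Q n)) / \<mu> n) \<longlongrightarrow>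
      2 * D P Q - D P (act g P) - D Q (act g Q)) \<F>"
      by (simp add: diff_divide_distrib)
  qed (use 3 in auto)
  ultimately show ?thesis
  proof eventually_elim
    case (elim n)
    show ?case
    proof (intro ballI allI impI)
      fix y \<tau> assume y: "y \<in> M" "t1 * \<mu> n \<le> \<tau>" "\<tau> \<le> t2 * \<mu> n" "near (P n) (Q n) c \<tau> y"
      show "near (P n) (Q n) (c + 4 * \<delta>) (\<tau> + shift P Q g n) (T n g y)"
        unfolding shift_def
        by (rule near_shift[where P' = "act g P n" and y = y])
          (use elim y g PQ V in \<open>auto simp: act_def\<close>)
    qed
  qed
qed

lemma eventually_two_largest:
  assumes "x \<in> V" "y \<in> V" "z \<in> V" "w \<in> V" "D x w + D y z < D x z + D y w"
  shows "eventually (\<lambda>n. \<bar>d (x n) (y n) + d (z n) (w n) - (d (x n) (z n) + d (y n) (w n))\<bar> \<le> 2 * \<delta>) \<F>"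
proof -
  have "eventually (\<lambda>n. d (x n) (z n) + d (y n) (w n) - d (x n) (w n) - d (y n) (z n) > 2 * \<delta>) \<F>"
  proof (rule eventually_greater)
    have "((\<lambda>n. d (x n) (z n) / \<mu> n + d (y n) (w n) / \<mu> n - d (x n) (w n) / \<mu> n - d (y n) (z n) / \<mu> n) \<longlongrightarrow>
      D x z + D y w - D x w - D y z) \<F>"
      using assms by (intro tendsto_intros limit) auto
    then show "((\<lambda>n. (d (x n) (z n) + d (y n) (w n) - d (x n) (w n) - d (y n) (z n)) / \<mu> n) \<longlongrightarrow>
      D x z + D y w - D x w - D y z) \<F>"
      by (simp add: add_divide_distrib diff_divide_distrib)
  qed (use assms in auto)
  then show ?thesis
  proof eventually_elim
    case (elim n)
    show ?case by (rule four_point_two_largest) (use assms elim in auto)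
  qed
qed

text \<open>A test point at an arbitrary limit coordinate. It need not belong to \<open>V\<close>,
  and it is under control only for almost all \<open>n\<close>.\<close>

definition mark :: "(nat \<Rightarrow> 'x) \<Rightarrow> (nat \<Rightarrow> 'x) \<Rightarrow> real \<Rightarrow> nat \<Rightarrow> 'x" where
  "mark P Q t n = geo (P n) (Q n) (t * \<mu> n)"

lemma eventually_mark:
  assumes "P \<in> V" "Q \<in> V" "0 \<le> t" "t < D P Q"
  shows "eventually (\<lambda>n. mark P Q t n \<in> M \<and> near (P n) (Q n) 0 (t * \<mu> n) (mark P Q t n)) \<F>"
  using limit_greater[OF assms(1,2,4)]
proof eventually_elim
  case (elim n)
  then show ?case
    using geo[of "P n" "Q n" "t * \<mu> n"] near_geo[of "P n" "Q n" "t * \<mu> n"] assms \<mu>_pos[of n] by (simp add: mark_def)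
qed

lemma eventually_mark_far:
  assumes "P \<in> V" "Q \<in> V" "0 \<le> s" "s < t" "t < D P Q"
  shows "eventually (\<lambda>n. d (mark P Q s n) (mark P Q t n) > C) \<F>"
proof -
  have "((\<lambda>n. ((t - s) * \<mu> n) / \<mu> n) \<longlongrightarrow> t - s) \<F>" using \<mu>_pos by (simp add: less_imp_neq[symmetric])
  then have "eventually (\<lambda>n. (t - s) * \<mu> n > C) \<F>" by (rule eventually_greater) (use assms in auto)
  moreover have "eventually (\<lambda>n. mark P Q s n \<in> M \<and> near (P n) (Q n) 0 (s * \<mu> n) (mark P Q s n)) \<F>"
    "eventually (\<lambda>n. mark P Q t n \<in> M \<and> near (P n) (Q n) 0 (t * \<mu> n) (mark P Q t n)) \<F>"
    using assms by (intro eventually_mark; simp)+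
  ultimately show ?thesis
  proof eventually_elim
    case (elim n)
    then have "d (P n) (mark P Q t n) \<le> d (P n) (mark P Q s n) + d (mark P Q s n) (mark P Q t n)"
      using triangle assms by simp
    then show ?case using elim by (simp add: near_def algebra_simps)
  qed
qed

text \<open>Along the axis of \<open>g\<close> both \<open>g\<close> and \<open>w\<close> are coarse
  translations, by about \<open>L\<close> and about 0. Translations commute, so the commutator moves
  the test points by a bounded amount before rescaling, whatever small fraction of the scale
  \<open>w\<close> translates by.\<close>

lemma finite_commutators:
  assumes y: "y \<in> V" and g: "g \<in> carrier G" and L: "L > 0" "D y (act g y) = L"
    "D y (act (g \<otimes> g) y) = 2 * L" "D y (act (g \<otimes> g \<otimes> g) y) = 3 * L" and \<eta>: "0 \<le> \<eta>" "\<eta> \<le> L / 100"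
  shows "finite ((\<lambda>w. inv g \<otimes> (inv w \<otimes> (g \<otimes> w))) `
    {w \<in> carrier G. D y (act w y) \<le> \<eta> \<and> D (act (g \<otimes> g) y) (act w (act (g \<otimes> g) y)) \<le> \<eta>})"
proof -
  define Q where "Q = act (g \<otimes> g) y"
  have Q: "Q \<in> V" using y g by (simp add: Q_def)
  have DQ: "D y Q = 2 * L" using L by (simp add: Q_def)
  have gQ: "D y (act g Q) = 3 * L" using L y g by (simp add: Q_def m_assoc flip: act_mult)
  have Qg: "D Q (act g y) = L" using L y g D_sym[of "act g y" y] D_sym[of Q "act g y"]
    by (simp add: Q_def act_mult)
  have QgQ: "D Q (act g Q) = L"
    using D_act[of "g \<otimes> g" y "act g y"] L y g by (simp add: Q_def m_assoc flip: act_mult)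
  \<comment> \<open>The segment has length \<open>2 * L\<close>. Starting between
    \<open>0.4 * L\<close> and \<open>0.6 * L\<close>, the images under \<open>g\<close> (about
    \<open>1.4 * L\<close> to \<open>1.6 * L\<close>) and under \<open>w\<close> stay in the ranges
    where the next translation is controlled.\<close>
  define p q where "p = mark y Q (4/10 * L)" and "q = mark y Q (6/10 * L)"
  note tri = D_triangle D_sym
  show ?thesis
  \<comment> \<open>Each translation costs \<open>4 * \<delta>\<close>; two points of error
    \<open>8 * \<delta>\<close> with equal coordinates are \<open>18 * \<delta>\<close>
    close.\<close>
  proof (rule finite_of_bounded_displacement[where p = p and q = q and \<epsilon> = "18 * \<delta>"])
    show "0 \<le> 18 * \<delta>" using \<delta>_nonneg by simp
    have ep: "eventually (\<lambda>n. p n \<in> M \<and> near (y n) (Q n) 0 (4/10 * L * \<mu> n) (p n)) \<F>"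
      unfolding p_def using y Q L DQ by (intro eventually_mark) auto
    have eq: "eventually (\<lambda>n. q n \<in> M \<and> near (y n) (Q n) 0 (6/10 * L * \<mu> n) (q n)) \<F>"
      unfolding q_def using y Q L DQ by (intro eventually_mark) auto
    from ep eq show "eventually (\<lambda>n. p n \<in> M \<and> q n \<in> M) \<F>" by eventually_elim auto
    show "eventually (\<lambda>n. C < d (p n) (q n)) \<F>" for C
      unfolding p_def q_def by (rule eventually_mark_far) (use y Q L DQ in auto)
    fix z assume "z \<in> (\<lambda>w. inv g \<otimes> (inv w \<otimes> (g \<otimes> w))) `
      {w \<in> carrier G. D y (act w y) \<le> \<eta> \<and> D (act (g \<otimes> g) y) (act w (act (g \<otimes> g) y)) \<le> \<eta>}"
    then obtain w where w: "w \<in> carrier G" "D y (act w y) \<le> \<eta>" "D Q (act w Q) \<le> \<eta>"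
      and z: "z = inv g \<otimes> (inv w \<otimes> (g \<otimes> w))" by (auto simp: Q_def)
    have wV: "act w y \<in> V" "act w Q \<in> V" using w y Q by auto
    have "D y Q \<le> D y (act w Q) + D (act w Q) Q" "D Q y \<le> D Q (act w y) + D (act w y) y"
      "D y (act w Q) \<le> D y Q + D Q (act w Q)"
      using wV y Q by (auto intro!: D_triangle)
    then have wQ: "2 * L - \<eta> \<le> D y (act w Q)" "2 * L - \<eta> \<le> D Q (act w y)" "D y (act w Q) \<le> 2 * L + \<eta>"
      using w DQ D_sym[of "act w Q" Q] D_sym[of Q y] D_sym[of "act w y" y] wV y Q by auto
    have S: "eventually (\<lambda>n. \<forall>x\<in>M. \<forall>\<tau>. 1/10 * L * \<mu> n \<le> \<tau> \<longrightarrow> \<tau> \<le> 9/10 * L * \<mu> n \<longrightarrow> near (y n) (Q n) c \<tau> x \<longrightarrow>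
      near (y n) (Q n) (c + 4 * \<delta>) (\<tau> + shift y Q g n) (T n g x)) \<F>" for c
      by (rule eventually_near_shift[OF g y Q]) (use L DQ gQ Qg QgQ in auto)
    have S': "eventually (\<lambda>n. \<forall>x\<in>M. \<forall>\<tau>. 1/10 * L * \<mu> n \<le> \<tau> \<longrightarrow> \<tau> \<le> 18/10 * L * \<mu> n \<longrightarrow> near (y n) (Q n) c \<tau> x \<longrightarrow>
      near (y n) (Q n) (c + 4 * \<delta>) (\<tau> + shift y Q w n) (T n w x)) \<F>" for c
      by (rule eventually_near_shift[OF w(1) y Q]) (use L DQ w wQ \<eta> in auto)
    have kg0: "((\<lambda>n. shift y Q g n / \<mu> n) \<longlongrightarrow> L) \<F>" using shift_tendsto[OF g y Q] gQ DQ by simp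
    have kg: "eventually (\<lambda>n. 9/10 * L < shift y Q g n / \<mu> n) \<F>" "eventually (\<lambda>n. shift y Q g n / \<mu> n < 11/10 * L) \<F>"
      by (rule order_tendstoD[OF kg0]; use L(1) in simp)+
    have kw: "eventually (\<lambda>n. - (2/100) * L < shift y Q w n / \<mu> n) \<F>" "eventually (\<lambda>n. shift y Q w n / \<mu> n < 2/100 * L) \<F>"
      by (rule order_tendstoD[OF shift_tendsto[OF w(1) y Q]]; use wQ DQ \<eta> L(1) in simp)+
    have main: "eventually (\<lambda>n. d (x n) (T n z (x n)) \<le> 18 * \<delta>) \<F>"
      if x: "eventually (\<lambda>n. x n \<in> M \<and> near (y n) (Q n) 0 (r * L * \<mu> n) (x n)) \<F>" and r: "4/10 \<le> r" "r \<le> 6/10" for x r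
      using x S[of 0] S'[of 0] S[of "4 * \<delta>"] S'[of "4 * \<delta>"] kg kw
    proof eventually_elim
      case (elim n)
      let ?x = "x n" and ?kg = "shift y Q g n" and ?kw = "shift y Q w n"
      have \<mu>: "\<mu> n > 0" by (rule \<mu>_pos)
      have xM: "?x \<in> M" using elim by simp
      have k: "9/10 * L * \<mu> n < ?kg" "?kg < 11/10 * L * \<mu> n" "- (2/100) * L * \<mu> n < ?kw" "?kw < 2/100 * L * \<mu> n"
        using elim \<mu> by (simp_all add: pos_less_divide_eq pos_divide_less_eq)
      have r': "4/10 * (L * \<mu> n) \<le> r * (L * \<mu> n)" "r * (L * \<mu> n) \<le> 6/10 * (L * \<mu> n)" "0 < L * \<mu> n"
        using r L \<mu> by (auto intro!: mult_right_mono)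
      have 1: "near (y n) (Q n) (4 * \<delta>) (r * L * \<mu> n + ?kg) (T n g ?x)"
        using elim(2)[rule_format, OF xM, of "r * L * \<mu> n"] elim(1) r' by (simp add: mult.assoc)
      have 2: "near (y n) (Q n) (4 * \<delta>) (r * L * \<mu> n + ?kw) (T n w ?x)"
        using elim(3)[rule_format, OF xM, of "r * L * \<mu> n"] elim(1) r' by (simp add: mult.assoc)
      have 3: "near (y n) (Q n) (8 * \<delta>) (r * L * \<mu> n + ?kg + ?kw) (T n w (T n g ?x))"
        using elim(5)[rule_format, of "T n g ?x" "r * L * \<mu> n + ?kg"] 1 g xM r' k by (simp add: mult.assoc)
      have 4: "near (y n) (Q n) (8 * \<delta>) (r * L * \<mu> n + ?kw + ?kg) (T n g (T n w ?x))"
        using elim(4)[rule_format, of "T n w ?x" "r * L * \<mu> n + ?kw"] 2 w xM r' k by (simp add: mult.assoc)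
      have "d (T n w (T n g ?x)) (T n g (T n w ?x)) \<le> 18 * \<delta>"
        using near_close[OF _ _ _ _ 3 4] y Q g w xM by simp
      moreover have "d ?x (T n z ?x) = d (T n (w \<otimes> g) ?x) (T n (w \<otimes> g) (T n z ?x))"
        using g w xM z by simp
      moreover have "T n (w \<otimes> g) (T n z ?x) = T n (g \<otimes> w) ?x"
      proof -
        have cancel: "a \<otimes> (inv a \<otimes> b) = b" if "a \<in> carrier G" "b \<in> carrier G" for a b
          using that by (simp flip: m_assoc)
        have "w \<otimes> g \<otimes> z = g \<otimes> w" using g w cancel by (simp add: z m_assoc)
        then show ?thesis using T_mult[of "w \<otimes> g" z ?x n] g w xM z by simp
      qed
      ultimately show ?case using g w xM by (simp add: T_mult)
    qed
    from main[of p "4/10"] main[of q "6/10"] ep eq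
    show "eventually (\<lambda>n. d (p n) (T n z (p n)) \<le> 18 * \<delta> \<and> d (q n) (T n z (q n)) \<le> 18 * \<delta>) \<F>"
      by (simp add: eventually_conj_iff)
  qed (use g in auto)
qed

text \<open>An element that almost fixes the three ends translates by the same amount along the two
  sides leaving an end, and by opposite amounts when a side is reversed. Going once around the
  tripod forces every amount to be its own negative up to a bounded error.\<close>

lemma finite_tripod_stabilizer:
  assumes y: "y0 \<in> V" "y1 \<in> V" "y2 \<in> V" and \<eta>: "0 \<le> \<eta>"
    and gp: "\<eta> < gromov_product D y0 y1 y2" "\<eta> < gromov_product D y1 y0 y2" "\<eta> < gromov_product D y2 y0 y1"
  shows "finite {v \<in> carrier G. D y0 (act v y0) \<le> \<eta> \<and> D y1 (act v y1) \<le> \<eta> \<and> D y2 (act v y2) \<le> \<eta>}"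
proof -
  define l where "l = D y0 y1"
  have l: "2 * \<eta> < l" using gp D_sym y by (simp add: gromov_product_def l_def field_simps)
  define t1 t2 where "t1 = \<eta> + (l - 2 * \<eta>) / 3" and "t2 = \<eta> + 2 * (l - 2 * \<eta>) / 3"
  have t: "\<eta> < t1" "t1 < t2" "t2 < l - \<eta>" using l by (auto simp: t1_def t2_def field_simps)
  define p q where "p = mark y0 y1 t1" and "q = mark y0 y1 t2"
  show ?thesis
  proof (rule finite_of_bounded_displacement[where p = p and q = q and \<epsilon> = "16 * \<delta>"])
    show "0 \<le> 16 * \<delta>" using \<delta>_nonneg by simp
    have ep: "eventually (\<lambda>n. p n \<in> M \<and> near (y0 n) (y1 n) 0 (t1 * \<mu> n) (p n)) \<F>"
      unfolding p_def using y t \<eta> by (intro eventually_mark) (auto simp: l_def)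
    have eq: "eventually (\<lambda>n. q n \<in> M \<and> near (y0 n) (y1 n) 0 (t2 * \<mu> n) (q n)) \<F>"
      unfolding q_def using y t \<eta> by (intro eventually_mark) (auto simp: l_def)
    from ep eq show "eventually (\<lambda>n. p n \<in> M \<and> q n \<in> M) \<F>" by eventually_elim auto
    show "eventually (\<lambda>n. C < d (p n) (q n)) \<F>" for C
      unfolding p_def q_def by (rule eventually_mark_far) (use y t \<eta> in \<open>auto simp: l_def\<close>)
    fix v assume "v \<in> {v \<in> carrier G. D y0 (act v y0) \<le> \<eta> \<and> D y1 (act v y1) \<le> \<eta> \<and> D y2 (act v y2) \<le> \<eta>}"
    then have v: "v \<in> carrier G" and small: "D y0 (act v y0) \<le> \<eta>" "D y1 (act v y1) \<le> \<eta>" "D y2 (act v y2) \<le> \<eta>" by auto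
    have moved: "D a b - \<eta> \<le> D a (act v b)" if "a \<in> V" "b \<in> V" "D b (act v b) \<le> \<eta>" for a b
      using D_triangle[of a "act v b" b] D_sym[of "act v b" b] that v by auto
    have share: "eventually (\<lambda>n. \<bar>shift a b v n - shift a c v n\<bar> \<le> 2 * \<delta>) \<F>"
      if m: "a \<in> V" "b \<in> V" "c \<in> V" and s: "D a (act v a) \<le> \<eta>" "D b (act v b) \<le> \<eta>" "D c (act v c) \<le> \<eta>"
        and gp: "\<eta> < gromov_product D a b c" for a b c
    proof -
      have "eventually (\<lambda>n. \<bar>d (a n) (act v b n) + d (act v a n) (act v c n) - (d (a n) (act v c n) + d (act v b n) (act v a n))\<bar> \<le> 2 * \<delta>) \<F>"
      proof -
        have "D a (act v a) + D (act v b) (act v c) < D a (act v c) + D (act v b) (act v a)"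
          using moved[OF m(1,3) s(3)] s gp v m D_sym[of b a] by (simp add: gromov_product_def)
        then show ?thesis using eventually_two_largest[of a "act v b" "act v c" "act v a"] m v
          by (simp add: act_def commute)
      qed
      then show ?thesis
      proof eventually_elim
        case (elim n)
        then show ?case using v m commute[of "b n" "a n"] by (simp add: shift_def act_def)
      qed
    qed
    have flip: "eventually (\<lambda>n. \<bar>shift a b v n + shift b a v n\<bar> \<le> 2 * \<delta>) \<F>"
      if m: "a \<in> V" "b \<in> V" and s: "D a (act v a) \<le> \<eta>" "D b (act v b) \<le> \<eta>" and ab: "\<eta> < D a b" for a b
    proof -
      have "eventually (\<lambda>n. \<bar>d (a n) (act v b n) + d (b n) (act v a n) - (d (a n) (b n) + d (act v b n) (act v a n))\<bar> \<le> 2 * \<delta>) \<F>"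
      proof (rule eventually_two_largest)
        show "D a (act v a) + D (act v b) b < D a b + D (act v b) (act v a)"
          using s ab v m D_sym[of b a] D_sym[of "act v b" b] by simp
      qed (use v m in auto)
      then show ?thesis
      proof eventually_elim
        case (elim n)
        then show ?case using v m commute[of "b n" "a n"] by (simp add: shift_def act_def)
      qed
    qed
    have gps: "\<eta> < gromov_product D y0 y2 y1" "\<eta> < gromov_product D y1 y2 y0" "\<eta> < gromov_product D y2 y1 y0"
      using gp y D_sym by (simp_all add: gromov_product_def add.commute)
    have Ds: "\<eta> < D y0 y2" "\<eta> < D y2 y1" "\<eta> < D y1 y0"
      using gp y \<eta> D_sym[of y0 y1] D_sym[of y0 y2] D_sym[of y1 y2]
      by (auto simp: gromov_product_def field_simps)
    \<comment> \<open>Three shared legs and three reversals, each with error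
      \<open>2 * \<delta>\<close>, bound twice the shift by \<open>12 * \<delta>\<close>. The
      constant \<open>16 * \<delta>\<close> is this \<open>6 * \<delta>\<close> plus the
      \<open>10 * \<delta>\<close> of \<open>near_close\<close>.\<close>
    have zero: "eventually (\<lambda>n. \<bar>shift y0 y1 v n\<bar> \<le> 6 * \<delta>) \<F>"
      using share[OF y(1,2,3) small gp(1)] flip[OF y(1,3) small(1,3) Ds(1)] share[OF y(3,1,2) small(3,1,2) gp(3)]
        flip[OF y(3,2) small(3,2) Ds(2)] share[OF y(2,3,1) small(2,3,1) gps(2)] flip[OF y(2,1) small(2,1) Ds(3)]
      by eventually_elim linarith
    have S: "eventually (\<lambda>n. \<forall>x\<in>M. \<forall>\<tau>. t1 * \<mu> n \<le> \<tau> \<longrightarrow> \<tau> \<le> t2 * \<mu> n \<longrightarrow> near (y0 n) (y1 n) 0 \<tau> x \<longrightarrow>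
      near (y0 n) (y1 n) (0 + 4 * \<delta>) (\<tau> + shift y0 y1 v n) (T n v x)) \<F>"
      by (rule eventually_near_shift[OF v y(1,2)])
        (use t small l \<eta> moved[OF y(1,2) small(2)] moved[OF y(2,1) small(1)] D_sym[OF y(1,2)] in \<open>auto simp: l_def\<close>)
    have main: "eventually (\<lambda>n. d (x n) (T n v (x n)) \<le> 16 * \<delta>) \<F>"
      if x: "eventually (\<lambda>n. x n \<in> M \<and> near (y0 n) (y1 n) 0 (r * \<mu> n) (x n)) \<F>" and r: "t1 \<le> r" "r \<le> t2" for x r
      using x S zero
    proof eventually_elim
      case (elim n)
      have \<mu>: "0 \<le> \<mu> n" using \<mu>_pos[of n] by simp
      have 1: "near (y0 n) (y1 n) (4 * \<delta>) (r * \<mu> n + shift y0 y1 v n) (T n v (x n))"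
        using elim(2)[rule_format, of "x n" "r * \<mu> n"] elim(1) r \<mu> by (auto intro: mult_right_mono)
      have 2: "near (y0 n) (y1 n) (4 * \<delta>) (r * \<mu> n) (x n)" using elim(1) \<delta>_nonneg near_mono by fastforce
      have "d (x n) (T n v (x n)) \<le> \<bar>r * \<mu> n - (r * \<mu> n + shift y0 y1 v n)\<bar> + 2 * (4 * \<delta>) + 2 * \<delta>"
        by (rule near_close[OF _ _ _ _ 2 1]) (use y v elim in auto)
      then show ?case using elim(3) by simp
    qed
    from main[OF ep] main[OF eq] t
    show "eventually (\<lambda>n. d (p n) (T n v (p n)) \<le> 16 * \<delta> \<and> d (q n) (T n v (q n)) \<le> 16 * \<delta>) \<F>"
      by (simp add: eventually_conj_iff)
  qed auto
qed

section \<open>Powers of elements that fix the base point\<close>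

abbreviation base :: "nat \<Rightarrow> 'x" where "base \<equiv> \<lambda>_. x0"

lemma int_pow_displacement:
  assumes A: "A \<in> carrier G" and \<beta>: "d x0 (T n A x0) \<le> \<beta>"
  shows "d x0 (T n (A [^] (k::int)) x0) \<le> real_of_int \<bar>k\<bar> * \<beta>"
proof -
  have nat: "d x0 (T n (A [^] (m::nat)) x0) \<le> real m * \<beta>" for m
  proof (induction m)
    case (Suc m)
    have "d x0 (T n (A [^] Suc m) x0) \<le> d x0 (T n (A [^] m) x0) + d (T n (A [^] m) x0) (T n (A [^] m) (T n A x0))"
      using A triangle[of x0 "T n (A [^] m) x0" "T n (A [^] m) (T n A x0)"] by (simp add: T_mult)
    then show ?case using Suc \<beta> A by (simp add: algebra_simps)
  qed simp
  show ?thesis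
  proof (cases "k \<ge> 0")
    case True
    then obtain m where "k = int m" by (rule nonneg_int_cases)
    then show ?thesis using nat[of m] by (simp add: int_pow_int)
  next
    case False
    then have "0 \<le> - k" by simp
    then obtain m where "- k = int m" by (rule nonneg_int_cases)
    then have m: "k = - int m" by simp
    have k: "A [^] k = inv (A [^] m)" "real_of_int \<bar>k\<bar> = real m"
      using A by (simp_all add: m int_pow_neg int_pow_int)
    have "d x0 (T n (inv (A [^] m)) x0) = d (T n (A [^] m) x0) (T n (A [^] m) (T n (inv (A [^] m)) x0))"
      using A by simp
    also have "T n (A [^] m) (T n (inv (A [^] m)) x0) = x0"
      using A T_mult[of "A [^] m" "inv (A [^] m)" x0 n] by simp
    finally show ?thesis using nat[of m] k commute[of x0] by simp
  qed
qed

lemma D_base_bounded: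
  assumes g: "g \<in> carrier G" and \<beta>: "\<And>n. d x0 (T n g x0) \<le> \<beta>"
  shows "D base (act g base) = 0"
proof (rule limit_unique)
  show "((\<lambda>n. d x0 (act g base n) / \<mu> n) \<longlongrightarrow> 0) \<F>"
  proof (rule tendsto_sandwich[OF _ _ tendsto_const const_over_scale])
    show "\<forall>\<^sub>F n in \<F>. 0 \<le> d x0 (act g base n) / \<mu> n" using \<mu>_pos by (simp add: less_imp_le)
    show "\<forall>\<^sub>F n in \<F>. d x0 (act g base n) / \<mu> n \<le> \<beta> / \<mu> n"
      using \<beta> \<mu>_pos by (intro always_eventually allI divide_right_mono) (auto simp: act_def less_imp_le)
  qed
qed (use g x0_V in auto)

text \<open>Powers of \<open>A\<close> and \<open>B\<close> act as coarse translations on a common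
  initial piece of the segment from \<open>base\<close> to \<open>Q\<close>. The amounts of the
  powers of \<open>A\<close> sweep a long interval in bounded steps, so each of \<open>N + 1\<close>
  powers of \<open>B\<close> is matched by one of \<open>A\<close>. The quotients move two distant
  points by a bounded amount, so acylindricity makes two quotients coincide.\<close>

lemma common_germ_powers:
  assumes A: "A \<in> carrier G" and B: "B \<in> carrier G" and Q: "Q \<in> V"
    and inj: "\<And>(i::int) (j::int). A [^] i = A [^] j \<Longrightarrow> i = j"
    and \<beta>A: "\<And>n. d x0 (T n A x0) \<le> \<beta>A" and \<beta>B: "\<And>n. d x0 (T n B x0) \<le> \<beta>B"
    and gpA: "0 < gromov_product D base Q (act A Q)" and gpB: "0 < gromov_product D base Q (act B Q)"
  shows "\<exists>(i::int) (j::int). j \<noteq> 0 \<and> A [^] i = B [^] j"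
proof -
  define \<theta> where "\<theta> = min (gromov_product D base Q (act A Q)) (gromov_product D base Q (act B Q))"
  define l where "l = D base Q"
  \<comment> \<open>The last condition says that the segments from \<open>base\<close> to
    \<open>Q\<close> and to its image share an initial piece of length \<theta>.\<close>
  define fixes_germ where "fixes_germ f \<longleftrightarrow> f \<in> carrier G \<and> D base (act f base) = 0 \<and> D Q (act f Q) \<le> 2 * l - 2 * \<theta>" for f
  note bV = x0_V
  have \<theta>: "0 < \<theta>" using gpA gpB by (simp add: \<theta>_def)
  have base_act: "D base (act f Q) = l" if "f \<in> carrier G" "D base (act f base) = 0" for f
    using D_triangle[of base "act f base" "act f Q"] D_triangle[of "act f base" base "act f Q"] that bV Q
      D_sym[of base "act f base"] by (simp add: l_def)
  have \<beta>0: "0 \<le> \<beta>A" "0 \<le> \<beta>B" using \<beta>A[of 0] \<beta>B[of 0] nonneg[of x0] by (meson order_trans)+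
  have l: "\<theta> \<le> l"
  proof -
    have "D base (act A base) = 0" by (rule D_base_bounded[OF A]) (rule \<beta>A)
    then have "gromov_product D base Q (act A Q) = l - D Q (act A Q) / 2"
      using base_act[OF A] by (simp add: gromov_product_def l_def)
    then show ?thesis using D_nonneg[of Q "act A Q"] Q A by (simp add: \<theta>_def)
  qed
  have pow: "fixes_germ (C [^] (k::int))"
    if C: "C \<in> carrier G" "\<And>n. d x0 (T n C x0) \<le> \<beta>" "\<theta> \<le> gromov_product D base Q (act C Q)" for C \<beta> k
  proof -
    have z: "D base (act (C [^] (k::int)) base) = 0" for k
      by (rule D_base_bounded[where \<beta> = "real_of_int \<bar>k\<bar> * \<beta>"]) (use C int_pow_displacement in auto)
    have zC: "D base (act C base) = 0" by (rule D_base_bounded) (use C in auto)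
    have gC: "D Q (act C Q) \<le> 2 * l - 2 * \<theta>"
      using C(3) base_act[OF C(1) zC] by (simp add: gromov_product_def l_def)
    \<comment> \<open>All these points have distance \<open>l\<close> from \<open>base\<close>,
      where sharing a piece of length \<theta> is a transitive relation by the four-point
      inequality.\<close>
    have nat: "D Q (act (C [^] (m::nat)) Q) \<le> 2 * l - 2 * \<theta>" for m
    proof (induction m)
      case 0
      then show ?case using Q l by simp
    next
      case (Suc m)
      have e: "C [^] Suc m = C \<otimes> C [^] m" using nat_pow_Suc2 C(1) by blast
      have b: "D base (act (C [^] Suc m) Q) = l"
        by (rule base_act) (use z[of "int (Suc m)", unfolded int_pow_int] C(1) in blast)+
      have "D Q (act (C [^] Suc m) Q) + D (act C Q) base \<le>
        max (D Q (act C Q) + D (act (C [^] Suc m) Q) base) (D Q base + D (act (C [^] Suc m) Q) (act C Q)) + 2 * 0"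
        by (rule four_pointD[OF tree]) (use Q C bV in auto)
      moreover have "D (act (C [^] Suc m) Q) (act C Q) = D (act (C [^] m) Q) Q"
        unfolding e using C Q by (simp add: act_mult)
      ultimately show ?case
        using Suc gC b base_act[OF C(1) zC] D_sym[of "act C Q" base] D_sym[of "act (C [^] Suc m) Q" base]
          D_sym[of "act (C [^] m) Q" Q] D_sym[of Q base] Q C bV
        by (auto simp: l_def max_def split: if_splits)
    qed
    have "D Q (act (C [^] k) Q) \<le> 2 * l - 2 * \<theta>"
    proof (cases "k \<ge> 0")
      case True
      then obtain m where "k = int m" by (rule nonneg_int_cases)
      then show ?thesis using nat[of m] by (simp add: int_pow_int)
    next
      case False
      then have "0 \<le> - k" by simp
    then obtain m where "- k = int m" by (rule nonneg_int_cases)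
    then have m: "k = - int m" by simp
      have k: "C [^] k = inv (C [^] m)" using C by (simp add: m int_pow_neg int_pow_int)
      have "D Q (act (inv (C [^] m)) Q) = D (act (C [^] m) Q) (act (C [^] m) (act (inv (C [^] m)) Q))"
        using C Q by simp
      also have "act (C [^] m) (act (inv (C [^] m)) Q) = Q"
        using C Q act_mult[of "C [^] m" "inv (C [^] m)" Q] by simp
      finally show ?thesis using nat[of m] k D_sym[of "act (C [^] m) Q" Q] C Q by simp
    qed
    then show ?thesis using z C(1) by (simp add: fixes_germ_def)
  qed
  have powA: "fixes_germ (A [^] (k::int))" for k by (rule pow[OF A \<beta>A]) (simp add: \<theta>_def)
  have powB: "fixes_germ (B [^] (k::int))" for k by (rule pow[OF B \<beta>B]) (simp add: \<theta>_def)
  define t1 t2 where "t1 = \<theta> / 3" and "t2 = 2 * \<theta> / 3"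
  have t: "0 < t1" "t1 < t2" "t2 < \<theta>" using \<theta> by (auto simp: t1_def t2_def)
  define p where "p r = mark base Q r" for r
  have mark: "eventually (\<lambda>n. p r n \<in> M \<and> near x0 (Q n) 0 (r * \<mu> n) (p r n)) \<F>" if "r \<in> {t1, t2}" for r
    unfolding p_def using bV Q t l that by (intro eventually_mark[of base Q]) (auto simp: l_def)
  have far: "eventually (\<lambda>n. d (p t1 n) (p t2 n) > C) \<F>" for C
    unfolding p_def by (rule eventually_mark_far) (use bV Q t l in \<open>auto simp: l_def\<close>)
  have moves: "eventually (\<lambda>n. near x0 (Q n) (4 * \<delta>) (r * \<mu> n + shift base Q f n) (T n f (p r n))) \<F>"
    if f: "fixes_germ f" and r: "r \<in> {t1, t2}" for f r
  proof -
    have fG: "f \<in> carrier G" "D base (act f base) = 0" "D Q (act f Q) \<le> 2 * l - 2 * \<theta>" using f by (auto simp: fixes_germ_def)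
    have "D Q base \<le> D Q (act f base) + D (act f base) base" using fG Q bV by (intro D_triangle) auto
    then have "l \<le> D Q (act f base)" using fG Q bV D_sym[of Q base] D_sym[of "act f base" base] by (simp add: l_def)
    then have "eventually (\<lambda>n. \<forall>x\<in>M. \<forall>\<tau>. t1 * \<mu> n \<le> \<tau> \<longrightarrow> \<tau> \<le> t2 * \<mu> n \<longrightarrow> near (base n) (Q n) 0 \<tau> x \<longrightarrow>
      near (base n) (Q n) (0 + 4 * \<delta>) (\<tau> + shift base Q f n) (T n f x)) \<F>"
      by (intro eventually_near_shift fG(1) bV Q) (use fG base_act[OF fG(1,2)] t \<theta> l in \<open>auto simp: l_def\<close>)
    then show ?thesis using mark[OF r]
    proof eventually_elim
      case (elim n)
      then show ?case using elim(1)[rule_format, of "p r n" "r * \<mu> n"] r t \<mu>_pos[of n] by (auto intro: mult_right_mono)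
    qed
  qed
  have close: "eventually (\<lambda>n. d (T n f (p r n)) (T n f' (p r n)) \<le> \<bar>shift base Q f n - shift base Q f' n\<bar> + 10 * \<delta>) \<F>"
    if f: "fixes_germ f" "fixes_germ f'" and r: "r \<in> {t1, t2}" for f f' r
    using moves[OF f(1) r] moves[OF f(2) r] mark[OF r]
  proof eventually_elim
    case (elim n)
    then show ?case using near_close[OF _ _ _ _ elim(1,2)] f Q by (auto simp: fixes_germ_def)
  qed
  have one: "fixes_germ \<one>" using powA[of 0] by simp
  have shift_one: "shift base Q \<one> n = 0" for n using Q by (simp add: shift_def)
  \<comment> \<open>Moving \<open>f\<close> to the other argument turns the shift into a distance
    from an inverse image of \<open>x0\<close> to \<open>Q n\<close>, so differences are bounded for
    every \<open>n\<close> and without \<delta>.\<close>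
  have shift_le: "\<bar>shift base Q f n - shift base Q f' n\<bar> \<le> d (T n (inv f) x0) (T n (inv f') x0)"
    if "f \<in> carrier G" "f' \<in> carrier G" for f f' n
  proof -
    have e: "d x0 (T n f (Q n)) = d (T n (inv f) x0) (Q n)" if "f \<in> carrier G" for f
    proof -
      have "d x0 (T n f (Q n)) = d (T n (inv f) x0) (T n (inv f) (T n f (Q n)))" using that Q by simp
      also have "T n (inv f) (T n f (Q n)) = Q n" using that Q T_mult[of "inv f" f "Q n" n] by simp
      finally show ?thesis .
    qed
    show ?thesis
      using e[OF that(1)] e[OF that(2)] mdist_reverse_triangle[of "T n (inv f) x0" "Q n" "T n (inv f') x0"]
        triangle[of "T n (inv f) x0" "T n (inv f') x0" "Q n"] triangle[of "T n (inv f') x0" "T n (inv f) x0" "Q n"]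
        commute[of "T n (inv f) x0" "T n (inv f') x0"] that Q
      by (simp add: shift_def act_def)
  qed
  have step: "\<bar>shift base Q (A [^] (k + 1)) n - shift base Q (A [^] k) n\<bar> \<le> \<beta>A" for k :: int and n
  proof -
    have "\<bar>shift base Q (A [^] (k + 1)) n - shift base Q (A [^] k) n\<bar> \<le> d (T n (inv (A [^] (k + 1))) x0) (T n (inv (A [^] k)) x0)"
      using A by (intro shift_le) auto
    also have "inv (A [^] k) = inv (A [^] (k + 1)) \<otimes> A"
    proof -
      have "inv (A [^] (k + 1)) \<otimes> A = A [^] (- (k + 1)) \<otimes> A [^] (1::int)"
        using int_pow_neg[OF A, of "k + 1"] A by simp
      also have "\<dots> = A [^] (- k)" using A int_pow_mult[of A "- (k + 1)" 1] by simp
      finally show ?thesis using A by (simp add: int_pow_neg)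
    qed
    also have "d (T n (inv (A [^] (k + 1))) x0) (T n (inv (A [^] (k + 1)) \<otimes> A) x0) = d x0 (T n A x0)"
      using A by (simp add: T_mult)
    finally show ?thesis using \<beta>A[of n] by linarith
  qed
  have shiftB: "\<bar>shift base Q (B [^] (j::int)) n\<bar> \<le> real_of_int \<bar>j\<bar> * \<beta>B" for j n
  proof -
    have "\<bar>shift base Q (B [^] j) n - shift base Q \<one> n\<bar> \<le> d (T n (inv (B [^] j)) x0) (T n (inv \<one>) x0)"
      using B by (intro shift_le) auto
    then show ?thesis using int_pow_displacement[OF B \<beta>B[of n], of "- j"] B commute by (simp add: shift_one int_pow_neg)
  qed
  have flip: "eventually (\<lambda>n. \<bar>shift base Q (A [^] (k::int)) n + shift base Q (A [^] (- k)) n\<bar> \<le> 2 * \<delta>) \<F>" for k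
  proof -
    let ?f = "A [^] k"
    have fG: "?f \<in> carrier G" "D base (act ?f base) = 0" "D Q (act ?f Q) \<le> 2 * l - 2 * \<theta>"
      using powA[of k] by (auto simp: fixes_germ_def)
    have "eventually (\<lambda>n. \<bar>d (base n) (act ?f Q n) + d (Q n) (act ?f base n) - (d (base n) (Q n) + d (act ?f Q n) (act ?f base n))\<bar> \<le> 2 * \<delta>) \<F>"
      by (rule eventually_two_largest)
        (use fG Q bV \<theta> D_sym[of "act ?f Q" Q] D_sym[of Q base] in \<open>auto simp: l_def\<close>)
    then show ?thesis
    proof eventually_elim
      case (elim n)
      have "d (Q n) (T n ?f x0) = d (T n (inv ?f) (Q n)) (T n (inv ?f) (T n ?f x0))" using Q fG by simp
      also have "T n (inv ?f) (T n ?f x0) = x0" using T_mult[of "inv ?f" ?f x0 n] fG by simp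
      finally show ?case using elim Q fG commute[of "Q n" x0] commute[of x0 "T n (inv ?f) (Q n)"] A
        by (simp add: shift_def act_def int_pow_neg)
    qed
  qed
  \<comment> \<open>Matched powers differ in shift by at most \<beta>A; \<open>close\<close> adds
    \<open>10 * \<delta>\<close>.\<close>
  define \<epsilon> where "\<epsilon> = \<beta>A + 10 * \<delta>"
  have "0 \<le> \<epsilon>" using \<beta>0 \<delta>_nonneg by (simp add: \<epsilon>_def)
  then obtain N R where NR: "\<And>S. finite S \<Longrightarrow> S \<subseteq> carrier G \<Longrightarrow> card S > N \<Longrightarrow>
      eventually (\<lambda>n. \<forall>x\<in>M. \<forall>y\<in>M. d x y \<ge> R \<longrightarrow> (\<exists>g\<in>S. d x (T n g x) > \<epsilon> \<or> d y (T n g y) > \<epsilon>)) \<F>"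
    using asymptotically_acylindrical by blast
  \<comment> \<open>One exponent more than acylindricity allows; \<Delta> bounds the shifts of the
    corresponding powers of \<open>B\<close>.\<close>
  define J where "J = {1..int N + 1}"
  define \<Delta> where "\<Delta> = (real N + 1) * \<beta>B"
  have "0 \<le> \<Delta> + 12 * \<delta>" using \<beta>0 \<delta>_nonneg by (simp add: \<Delta>_def)
  then obtain N2 R2 where NR2: "\<And>S. finite S \<Longrightarrow> S \<subseteq> carrier G \<Longrightarrow> card S > N2 \<Longrightarrow>
      eventually (\<lambda>n. \<forall>x\<in>M. \<forall>y\<in>M. d x y \<ge> R2 \<longrightarrow> (\<exists>g\<in>S. d x (T n g x) > \<Delta> + 12 * \<delta> \<or> d y (T n g y) > \<Delta> + 12 * \<delta>)) \<F>"
    using asymptotically_acylindrical by blast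
  \<comment> \<open>So many distinct powers of \<open>A\<close> cannot all move the marks by at most
    \<open>\<Delta> + 12 * \<delta>\<close>; one has shift beyond
    \<open>\<Delta> + 2 * \<delta>\<close>, and by \<open>flip\<close> its inverse has shift beyond
    \<Delta> on the other side.\<close>
  define I where "I = int N2 + 1"
  define PA where "PA = (\<lambda>i::int. A [^] i) ` {1..I}"
  have PA: "finite PA" "PA \<subseteq> carrier G" "card PA > N2"
    using A card_image[of "\<lambda>i::int. A [^] i" "{1..I}"] inj by (auto simp: PA_def I_def inj_on_def)
  define F where "F = (\<lambda>(i::int, j::int). inv (A [^] i) \<otimes> B [^] j) ` ({- I..I} \<times> J)"
  have F: "finite F" "F \<subseteq> carrier G" using A B by (auto simp: F_def J_def)
  \<comment> \<open>The matching exponents depend on \<open>n\<close>, so acylindricity is needed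
    for all large subsets of the finite set \<open>F\<close> simultaneously.\<close>
  have "eventually (\<lambda>n. \<forall>S\<in>{S. S \<subseteq> F \<and> card S > N}. \<forall>x\<in>M. \<forall>y\<in>M. d x y \<ge> R \<longrightarrow>
      (\<exists>g\<in>S. d x (T n g x) > \<epsilon> \<or> d y (T n g y) > \<epsilon>)) \<F>"
    using F by (intro eventually_ball_finite ballI NR) (auto intro: finite_subset)
  moreover have "eventually (\<lambda>n. \<forall>x\<in>M. \<forall>y\<in>M. d x y \<ge> R2 \<longrightarrow>
      (\<exists>g\<in>PA. d x (T n g x) > \<Delta> + 12 * \<delta> \<or> d y (T n g y) > \<Delta> + 12 * \<delta>)) \<F>"
    by (rule NR2[OF PA])
  moreover have "eventually (\<lambda>n. \<forall>i\<in>{- I..I}. \<forall>j\<in>J. \<forall>r\<in>{t1, t2}.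
      d (T n (A [^] i) (p r n)) (T n (B [^] j) (p r n)) \<le> \<bar>shift base Q (A [^] i) n - shift base Q (B [^] j) n\<bar> + 10 * \<delta>) \<F>"
    by (intro eventually_ball_finite ballI close powA powB) (auto simp: J_def)
  moreover have "eventually (\<lambda>n. \<forall>i\<in>{1..I}. \<forall>r\<in>{t1, t2}.
      d (T n \<one> (p r n)) (T n (A [^] i) (p r n)) \<le> \<bar>shift base Q \<one> n - shift base Q (A [^] i) n\<bar> + 10 * \<delta>) \<F>"
    by (intro eventually_ball_finite ballI close powA one) auto
  moreover have "eventually (\<lambda>n. \<forall>i\<in>{1..I}. \<bar>shift base Q (A [^] i) n + shift base Q (A [^] (- i)) n\<bar> \<le> 2 * \<delta>) \<F>"
    by (intro eventually_ball_finite ballI flip) auto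
  moreover have "eventually (\<lambda>n. p t1 n \<in> M) \<F>" using mark[of t1] by (simp add: eventually_conj_iff)
  moreover have "eventually (\<lambda>n. p t2 n \<in> M) \<F>" using mark[of t2] by (simp add: eventually_conj_iff)
  moreover have "eventually (\<lambda>n. d (p t1 n) (p t2 n) > max R R2) \<F>" by (rule far)
  ultimately have "eventually (\<lambda>n. \<exists>(i::int) (j::int). j \<noteq> 0 \<and> A [^] i = B [^] j) \<F>"
  proof eventually_elim
    case (elim n)
    define sh where "sh k = shift base Q (A [^] (k::int)) n" for k
    have "d (p t1 n) (p t2 n) \<ge> R2" using elim(8) by simp
    then obtain i0 where i0: "i0 \<in> {1..I}"
      "d (p t1 n) (T n (A [^] i0) (p t1 n)) > \<Delta> + 12 * \<delta> \<or> d (p t2 n) (T n (A [^] i0) (p t2 n)) > \<Delta> + 12 * \<delta>"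
      using elim(2)[rule_format, OF elim(6,7)] unfolding PA_def by blast
    have big: "\<bar>sh i0\<bar> > \<Delta> + 2 * \<delta>"
      using i0(2) elim(4)[rule_format, OF i0(1), of t1] elim(4)[rule_format, OF i0(1), of t2] elim(6,7)
      by (auto simp: shift_one sh_def)
    have opp: "\<bar>sh i0 + sh (- i0)\<bar> \<le> 2 * \<delta>" using elim(5) i0(1) by (simp add: sh_def)
    have sh0: "sh 0 = 0" by (simp add: sh_def shift_one)
    have step': "\<bar>sh (s * int (Suc k)) - sh (s * int k)\<bar> \<le> \<beta>A" if "s \<in> {1, -1}" for s k
    proof (cases "s = 1")
      case True
      then show ?thesis using step[of "int k" n] by (simp add: sh_def add.commute)
    next
      case False
      then have "s = -1" using that by simp
      then have e: "s * int (Suc k) = - int k - 1" "s * int k = - int k - 1 + 1" by auto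
      show ?thesis unfolding sh_def e by (subst abs_minus_commute) (rule step)
    qed
    \<comment> \<open>\<sigma> is the sign of the target and \<open>s\<close> the direction of
      powers whose shifts reach that side; the shifts start at 0 and move by at most \<beta>A per
      step.\<close>
    have hit: "\<exists>i\<in>{- I..I}. \<bar>sh i - v\<bar> \<le> \<beta>A" if v: "\<bar>v\<bar> \<le> \<Delta>" for v
    proof -
      define m where "m = nat i0"
      have m: "int m = i0" "m \<ge> 1" "int m \<le> I" using i0(1) by (auto simp: m_def)
      define \<sigma> :: real where "\<sigma> = (if v \<ge> 0 then 1 else -1)"
      have "\<exists>s\<in>{1, -1::int}. \<sigma> * sh (s * int m) \<ge> \<Delta>"
        using big opp m by (auto simp: \<sigma>_def)
      then obtain s where s: "s \<in> {1, -1::int}" "\<sigma> * sh (s * int m) \<ge> \<Delta>" by blast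
      have "\<exists>k\<le>m. \<bar>\<sigma> * sh (s * int k) - \<sigma> * v\<bar> \<le> \<beta>A"
      proof (rule discrete_ivt)
        show "\<sigma> * sh (s * int 0) \<le> \<sigma> * v" using sh0 by (auto simp: \<sigma>_def)
        show "\<sigma> * v \<le> \<sigma> * sh (s * int m)" using s v by (auto simp: \<sigma>_def split: if_splits)
        show "\<sigma> * sh (s * int (Suc k)) - \<sigma> * sh (s * int k) \<le> \<beta>A" for k
          using step'[OF s(1), of k] by (auto simp: \<sigma>_def)
      qed (use \<beta>0 in auto)
      then obtain k where "k \<le> m" "\<bar>sh (s * int k) - v\<bar> \<le> \<beta>A"
        by (auto simp: \<sigma>_def split: if_splits)
      then show ?thesis using s(1) m by (intro bexI[of _ "s * int k"]) auto
    qed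
    have "\<exists>i\<in>{- I..I}. \<bar>sh i - shift base Q (B [^] j) n\<bar> \<le> \<beta>A" if "j \<in> J" for j :: int
    proof (rule hit)
      have "\<bar>shift base Q (B [^] j) n\<bar> \<le> real_of_int \<bar>j\<bar> * \<beta>B" by (rule shiftB)
      also have "\<dots> \<le> \<Delta>" unfolding \<Delta>_def by (rule mult_right_mono) (use that \<beta>0 in \<open>auto simp: J_def\<close>)
      finally show "\<bar>shift base Q (B [^] j) n\<bar> \<le> \<Delta>" .
    qed
    then obtain ix where ix: "\<And>j. j \<in> J \<Longrightarrow> ix j \<in> {- I..I}" "\<And>j. j \<in> J \<Longrightarrow> \<bar>sh (ix j) - shift base Q (B [^] j) n\<bar> \<le> \<beta>A"
      by metis
    define z where "z j = inv (A [^] ix j) \<otimes> B [^] j" for j :: int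
    have zF: "z ` J \<subseteq> F" using ix(1) by (force simp: z_def F_def)
    have small: "d (p r n) (T n (z j) (p r n)) \<le> \<epsilon>" if j: "j \<in> J" and r: "r \<in> {t1, t2}" for j r
    proof -
      have pM: "p r n \<in> M" using r elim(6,7) by auto
      have "d (p r n) (T n (z j) (p r n)) = d (T n (A [^] ix j) (p r n)) (T n (A [^] ix j) (T n (z j) (p r n)))"
        using pM A B by (simp add: z_def)
      also have "T n (A [^] ix j) (T n (z j) (p r n)) = T n (B [^] j) (p r n)"
        using pM A B T_mult[of "A [^] ix j" "z j" "p r n" n] by (simp add: z_def flip: m_assoc)
      finally show ?thesis using elim(3)[rule_format, OF ix(1)[OF j] j r] ix(2)[OF j] by (simp add: \<epsilon>_def sh_def)
    qed
    have "\<not> inj_on z J"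
    proof
      assume "inj_on z J"
      then have "card (z ` J) > N" by (simp add: card_image J_def)
      moreover have "d (p t1 n) (p t2 n) \<ge> R" using elim(8) by simp
      ultimately obtain g where "g \<in> z ` J" "d (p t1 n) (T n g (p t1 n)) > \<epsilon> \<or> d (p t2 n) (T n g (p t2 n)) > \<epsilon>"
        using elim(1)[rule_format, OF _ elim(6,7), of "z ` J"] zF by blast
      then show False using small by fastforce
    qed
    then obtain j j' where j: "j \<noteq> j'" "z j = z j'" by (auto simp: inj_on_def)
    have "A [^] (ix j - ix j') = B [^] (j - j')"
    proof -
      have "B [^] j = A [^] ix j \<otimes> z j" using A B by (simp add: z_def flip: m_assoc)
      also have "\<dots> = A [^] ix j \<otimes> inv (A [^] ix j') \<otimes> B [^] j'" using A B j by (simp add: z_def m_assoc)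
      finally have "B [^] j \<otimes> inv (B [^] j') = A [^] ix j \<otimes> inv (A [^] ix j')" using A B by (simp add: m_assoc)
      then show ?thesis using A B by (simp add: int_pow_diff)
    qed
    then show ?case using j by (intro exI[of _ "ix j - ix j'"] exI[of _ "j - j'"]) auto
  qed
  then show ?thesis using \<F>_nontrivial by (simp add: eventually_const)
qed

section \<open>Ping-pong in the limit tree\<close>

abbreviation orb :: "'g \<Rightarrow> nat \<Rightarrow> 'x" where "orb u \<equiv> act u base"

definition len :: "'g \<Rightarrow> real" where "len u = D base (orb u)"

text \<open>The length of the common initial piece of the segments from \<open>base\<close> to its
  translates by \<open>u\<close> and \<open>v\<close>. Positive overlap means leaving
  \<open>base\<close> in the same direction, an equivalence relation among elements that move
  \<open>base\<close>.\<close>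

definition overlap :: "'g \<Rightarrow> 'g \<Rightarrow> real" where
  "overlap u v = gromov_product D base (orb u) (orb v)"

definition word_prod :: "'g list \<Rightarrow> 'g" where "word_prod xs = foldr (\<otimes>) xs \<one>"

lemma base_V [simp]: "base \<in> V" by (rule x0_V)

lemma len_one [simp]: "len \<one> = 0" by (simp add: len_def)

lemma D_orb:
  assumes "u \<in> carrier G" "v \<in> carrier G"
  shows "D (orb u) (orb v) = len (inv u \<otimes> v)"
proof -
  have "act u (act (inv u \<otimes> v) base) = orb v"
    using assms by (simp flip: act_mult add: m_assoc[symmetric])
  then show ?thesis using D_act[of u base "act (inv u \<otimes> v) base"] assms by (simp add: len_def)
qed

lemma len_inv: "u \<in> carrier G \<Longrightarrow> len (inv u) = len u"
  using D_orb[of u \<one>] D_sym[of "orb u" base] by (simp add: len_def)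

lemma len_triangle: "u \<in> carrier G \<Longrightarrow> v \<in> carrier G \<Longrightarrow> len (u \<otimes> v) \<le> len u + len v"
  using D_triangle[of base "orb u" "orb (u \<otimes> v)"] D_orb[of u "u \<otimes> v"]
  by (simp add: len_def flip: m_assoc)

lemma len_mult_zero:
  assumes "u \<in> carrier G" "v \<in> carrier G" "len v = 0"
  shows "len (u \<otimes> v) = len u" "len (v \<otimes> u) = len u"
proof -
  have "u = (u \<otimes> v) \<otimes> inv v" "u = inv v \<otimes> (v \<otimes> u)" using assms by (simp_all add: m_assoc flip: m_assoc[of "inv v"])
  then have "len u \<le> len (u \<otimes> v) + len (inv v)" "len u \<le> len (inv v) + len (v \<otimes> u)"
    using len_triangle assms by (metis inv_closed m_closed)+
  then show "len (u \<otimes> v) = len u" "len (v \<otimes> u) = len u"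
    using len_triangle[of u v] len_triangle[of v u] assms len_inv by auto
qed

lemma overlap_len: "u \<in> carrier G \<Longrightarrow> v \<in> carrier G \<Longrightarrow> overlap u v = (len u + len v - len (inv u \<otimes> v)) / 2"
  by (simp add: overlap_def gromov_product_def len_def[of u] len_def[of v] D_orb)

lemma overlap_nonneg: "u \<in> carrier G \<Longrightarrow> v \<in> carrier G \<Longrightarrow> 0 \<le> overlap u v"
  using D_triangle[of "orb u" base "orb v"] D_sym[of "orb u" base] by (simp add: overlap_def gromov_product_def)

lemma overlap_sym: "u \<in> carrier G \<Longrightarrow> v \<in> carrier G \<Longrightarrow> overlap u v = overlap v u"
  using D_sym[of "orb u" "orb v"] by (simp add: overlap_def gromov_product_def)

lemma overlap_trans:
  assumes "u \<in> carrier G" "v \<in> carrier G" "w \<in> carrier G" "0 < overlap u v" "0 < overlap v w"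
  shows "0 < overlap u w"
  using four_pointD[OF tree, of "orb u" "orb w" "orb v" base] assms
    D_sym[of "orb u" base] D_sym[of "orb v" base] D_sym[of "orb w" base] D_sym[of "orb w" "orb v"]
  by (auto simp: overlap_def gromov_product_def max_def split: if_splits)

lemma word_prod_closed: "set xs \<subseteq> carrier G \<Longrightarrow> word_prod xs \<in> carrier G"
  by (induction xs) (auto simp: word_prod_def)

lemma word_prod_append: "set xs \<subseteq> carrier G \<Longrightarrow> set ys \<subseteq> carrier G \<Longrightarrow> word_prod (xs @ ys) = word_prod xs \<otimes> word_prod ys"
  by (induction xs) (use word_prod_closed in \<open>auto simp: word_prod_def m_assoc\<close>)

text \<open>Ping-pong: letters leave the base point in distinct directions, so reduced words give geodesics.\<close>

lemma reduced_word_length: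
  assumes X: "X \<subseteq> carrier G" "\<And>x. x \<in> X \<Longrightarrow> inv x \<in> X"
    and c: "c > 0" "\<And>x. x \<in> X \<Longrightarrow> len x = c"
    and sep: "\<And>x y. x \<in> X \<Longrightarrow> y \<in> X \<Longrightarrow> x \<noteq> y \<Longrightarrow> overlap x y = 0"
    and xs: "xs \<noteq> []" "set xs \<subseteq> X" "successively (\<lambda>x y. y \<noteq> inv x) xs"
  shows "len (word_prod xs) = c * real (length xs) \<and> 0 < overlap (word_prod xs) (hd xs)"
  using xs
proof (induction xs)
  case (Cons x ys)
  have x: "x \<in> X" "x \<in> carrier G" "inv x \<in> X" using Cons X by auto
  show ?case
  proof (cases "ys = []")
    case True
    then show ?thesis using x c by (simp add: word_prod_def overlap_len)
  next
    case False
    define w where "w = word_prod ys"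
    have w: "w \<in> carrier G" unfolding w_def using Cons.prems X by (intro word_prod_closed) auto
    have y: "hd ys \<in> X" "hd ys \<in> carrier G" "hd ys \<noteq> inv x"
    proof -
      show "hd ys \<in> X" using hd_in_set[OF False] Cons.prems by auto
      then show "hd ys \<in> carrier G" using X by auto
      show "hd ys \<noteq> inv x" using False Cons.prems by (simp add: successively_Cons)
    qed
    have IH: "len w = c * real (length ys)" "0 < overlap w (hd ys)"
      using Cons.IH Cons.prems False by (auto simp: successively_Cons w_def)
    have "overlap (inv x) w = 0"
    proof (rule ccontr)
      assume "overlap (inv x) w \<noteq> 0"
      then have "0 < overlap (inv x) w" using overlap_nonneg[of "inv x" w] x w by simp
      then have "0 < overlap (inv x) (hd ys)" using overlap_trans[of "inv x" w "hd ys"] IH x w y by simp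
      then show False using sep[of "inv x" "hd ys"] x y by simp
    qed
    then have "len (x \<otimes> w) = c * real (length (x # ys))"
      using overlap_len[of "inv x" w] x w IH c(2)[OF x(3)] by (simp add: algebra_simps)
    moreover have "0 < overlap (x \<otimes> w) x"
    proof -
      have "inv (x \<otimes> w) \<otimes> x = inv w" using x w by (simp add: inv_mult_group m_assoc)
      then show ?thesis
        using calculation overlap_len[of "x \<otimes> w" x] x w len_inv[of w] IH c x by (simp add: algebra_simps)
    qed
    ultimately show ?thesis by (simp add: word_prod_def w_def)
  qed
qed simp

text \<open>Displacement in a tree does not exceed its bound at the ends anywhere along a
  segment.\<close>

lemma moves_between:
  assumes "p \<in> V" "q \<in> V" "r \<in> V" "w \<in> carrier G" "D p r + D r q = D p q"
    "D p (act w p) \<le> \<eta>" "D q (act w q) \<le> \<eta>"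
  shows "D r (act w r) \<le> \<eta>"
proof -
  have "D r (act w r) + D p q \<le> max (D r p + D (act w r) q) (D r q + D (act w r) p)"
    using four_pointD[OF tree, of r "act w r" p q] assms by simp
  moreover have "D (act w r) q \<le> D (act w r) (act w q) + D (act w q) q" "D (act w r) p \<le> D (act w r) (act w p) + D (act w p) p"
    using assms by (intro D_triangle; simp)+
  ultimately show ?thesis
    using assms D_sym[of r p] D_sym[of "act w q" q] D_sym[of "act w p" p] by (auto simp: max_def split: if_splits)
qed

text \<open>The segment follows the axis of \<open>g1\<close> up to \<open>y\<close> and then that
  of \<open>k\<close>, the conjugate of \<open>g2\<close> by \<open>c\<close>. Finitely many
  commutators with \<open>g1\<close> and \<open>k\<close> occur, so infinitely many elements would
  include infinitely many with equal commutators. Their quotients commute with \<open>g1\<close> and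
  \<open>k\<close> and therefore almost fix a tripod around \<open>y\<close>, contradicting
  \<open>finite_tripod_stabilizer\<close>.\<close>

lemma finite_coarse_stabilizer:
  assumes g: "g1 \<in> carrier G" "g2 \<in> carrier G" and L: "L > 0" and \<eta>: "0 \<le> \<eta>" "\<eta> \<le> L / 100"
    and len: "\<And>xs. xs \<noteq> [] \<Longrightarrow> set xs \<subseteq> {g1, g2, inv g1, inv g2} \<Longrightarrow>
      successively (\<lambda>x y. y \<noteq> inv x) xs \<Longrightarrow> len (word_prod xs) = L * real (length xs)"
    and ne: "inv g1 \<noteq> g1" "inv g2 \<noteq> g2" "g1 \<noteq> g2" "inv g1 \<noteq> g2"
  shows "finite {w \<in> carrier G. D base (act w base) \<le> \<eta> \<and>
    D (orb (word_prod [g1, g1, g2, g2])) (act w (orb (word_prod [g1, g1, g2, g2]))) \<le> \<eta>}" (is "finite ?W")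
proof -
  define c where "c = g1 \<otimes> g1"
  define y where "y = orb c"
  define k where "k = c \<otimes> g2 \<otimes> inv c"
  have c: "c \<in> carrier G" using g by (simp add: c_def)
  have k: "k \<in> carrier G" using g c by (simp add: k_def)
  have y: "y \<in> V" using c by (simp add: y_def)
  have ne': "inv g2 \<noteq> g1" "inv g2 \<noteq> inv g1" using ne g by (metis inv_inv)+
  have b: "word_prod [g1, g1, g2, g2] = c \<otimes> (g2 \<otimes> g2)" using g by (simp add: word_prod_def c_def m_assoc)
  let ?b = "c \<otimes> (g2 \<otimes> g2)"
  have l1: "len g1 = L" "len (g1 \<otimes> g1) = 2 * L" "len (g1 \<otimes> g1 \<otimes> g1) = 3 * L"
    "len g2 = L" "len (g2 \<otimes> g2) = 2 * L" "len (g2 \<otimes> g2 \<otimes> g2) = 3 * L" "len ?b = 4 * L"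
    "len (inv g1 \<otimes> g2) = 2 * L" "len (g1 \<otimes> g2) = 2 * L"
    using len[of "[g1]"] len[of "[g1, g1]"] len[of "[g1, g1, g1]"] len[of "[g2]"] len[of "[g2, g2]"] len[of "[g2, g2, g2]"]
      len[of "[g1, g1, g2, g2]"] len[of "[inv g1, g2]"] len[of "[g1, g2]"] ne g b
    by (auto simp: word_prod_def m_assoc)
  have pw: "act (k [^] n) y = orb (c \<otimes> g2 [^] (n::nat))" for n
  proof -
    have "k [^] n \<otimes> c = c \<otimes> g2 [^] n"
    proof (induction n)
      case (Suc n)
      have "k [^] Suc n \<otimes> c = k [^] n \<otimes> c \<otimes> g2" using c g k by (simp add: k_def m_assoc)
      then show ?case using Suc c g by (simp add: m_assoc)
    qed (use c in simp)
    then show ?thesis using c k g by (simp add: y_def flip: act_mult)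
  qed
  have Dy: "D y (orb (c \<otimes> u)) = len u" if "u \<in> carrier G" for u
    using that c D_orb[of c "c \<otimes> u"] by (simp add: y_def flip: m_assoc)
  have kk: "act k y = orb (c \<otimes> g2)" "act (k \<otimes> k) y = orb ?b" "act (k \<otimes> k \<otimes> k) y = orb (c \<otimes> (g2 \<otimes> g2 \<otimes> g2))"
    using pw[of 1] pw[of 2] pw[of 3] g c k by (simp_all add: numeral_2_eq_2 numeral_3_eq_3)
  have Z1: "finite ((\<lambda>w. inv g1 \<otimes> (inv w \<otimes> (g1 \<otimes> w))) `
    {w \<in> carrier G. D base (act w base) \<le> \<eta> \<and> D (act (g1 \<otimes> g1) base) (act w (act (g1 \<otimes> g1) base)) \<le> \<eta>})"
    by (rule finite_commutators[OF _ g(1) L]) (use l1 \<eta> in \<open>simp_all add: len_def\<close>)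
  have Z2: "finite ((\<lambda>w. inv k \<otimes> (inv w \<otimes> (k \<otimes> w))) `
    {w \<in> carrier G. D y (act w y) \<le> \<eta> \<and> D (act (k \<otimes> k) y) (act w (act (k \<otimes> k) y)) \<le> \<eta>})"
    by (rule finite_commutators[OF y k L]) (use l1 \<eta> g in \<open>simp_all add: kk Dy\<close>)
  have W_y: "D y (act w y) \<le> \<eta>" if "w \<in> ?W" for w
  proof (rule moves_between[of base "orb ?b"])
    show "D base y + D y (orb ?b) = D base (orb ?b)"
      using l1 Dy[of "g2 \<otimes> g2"] g by (simp add: y_def c_def len_def)
  qed (use that g c y b in auto)
  define f where "f w = (inv g1 \<otimes> (inv w \<otimes> (g1 \<otimes> w)), inv k \<otimes> (inv w \<otimes> (k \<otimes> w)))" for w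
  have "f ` ?W \<subseteq> ((\<lambda>w. inv g1 \<otimes> (inv w \<otimes> (g1 \<otimes> w))) `
    {w \<in> carrier G. D base (act w base) \<le> \<eta> \<and> D (act (g1 \<otimes> g1) base) (act w (act (g1 \<otimes> g1) base)) \<le> \<eta>}) \<times>
    ((\<lambda>w. inv k \<otimes> (inv w \<otimes> (k \<otimes> w))) `
    {w \<in> carrier G. D y (act w y) \<le> \<eta> \<and> D (act (k \<otimes> k) y) (act w (act (k \<otimes> k) y)) \<le> \<eta>})"
  proof
    fix z assume "z \<in> f ` ?W"
    then obtain w where w: "w \<in> ?W" "z = f w" by blast
    show "z \<in> ((\<lambda>w. inv g1 \<otimes> (inv w \<otimes> (g1 \<otimes> w))) `
      {w \<in> carrier G. D base (act w base) \<le> \<eta> \<and> D (act (g1 \<otimes> g1) base) (act w (act (g1 \<otimes> g1) base)) \<le> \<eta>}) \<times>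
      ((\<lambda>w. inv k \<otimes> (inv w \<otimes> (k \<otimes> w))) `
      {w \<in> carrier G. D y (act w y) \<le> \<eta> \<and> D (act (k \<otimes> k) y) (act w (act (k \<otimes> k) y)) \<le> \<eta>})"
    proof -
      have e: "act (g1 \<otimes> g1) base = y" by (simp add: y_def c_def)
      have "w \<in> carrier G" "D base (act w base) \<le> \<eta>" "D (orb ?b) (act w (orb ?b)) \<le> \<eta>"
        using w(1) by (simp_all add: b)
      then show ?thesis
        unfolding w(2) f_def e kk by (intro SigmaI imageI) (use W_y[OF w(1)] in simp_all)
    qed
  qed
  then have fin_f: "finite (f ` ?W)" by (rule finite_subset) (use Z1 Z2 in blast)
  \<comment> \<open>The images of \<open>y\<close> under \<open>g1\<close>, its inverse and
    \<open>k\<close>: they leave \<open>y\<close> in three different directions, each at distance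
    \<open>L\<close>.\<close>
  define y0 y1 y2 where "y0 = orb (c \<otimes> g1)" and "y1 = orb (c \<otimes> inv g1)" and "y2 = orb (c \<otimes> g2)"
  have yy: "D y0 y1 = 2 * L" "D y0 y2 = 2 * L" "D y1 y2 = 2 * L"
  proof -
    have e: "D (orb (c \<otimes> u)) (orb (c \<otimes> v)) = len (inv u \<otimes> v)" if "u \<in> carrier G" "v \<in> carrier G" for u v
      using D_act[of c "orb u" "orb v"] D_orb[OF that] that c by (simp add: act_mult)
    show "D y0 y1 = 2 * L" "D y0 y2 = 2 * L" "D y1 y2 = 2 * L"
      using g l1 len_inv[of "g1 \<otimes> g1"] by (simp_all add: y0_def y1_def y2_def e inv_mult_group)
  qed
  have yV: "y0 \<in> V" "y1 \<in> V" "y2 \<in> V" using c g by (auto simp: y0_def y1_def y2_def)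
  have tri: "finite {v \<in> carrier G. D y0 (act v y0) \<le> 2 * \<eta> \<and> D y1 (act v y1) \<le> 2 * \<eta> \<and> D y2 (act v y2) \<le> 2 * \<eta>}"
    by (rule finite_tripod_stabilizer[OF yV])
      (use yy yV L \<eta> D_sym[OF yV(1,2)] D_sym[OF yV(1,3)] D_sym[OF yV(2,3)] in \<open>auto simp: gromov_product_def\<close>)
  show ?thesis
  proof (rule ccontr)
    assume inf: "infinite ?W"
    obtain w0 where w0': "w0 \<in> ?W" "infinite {w \<in> ?W. f w = f w0}"
      using pigeonhole_infinite[OF inf fin_f] by (rule bexE)
    define z where "z = f w0"
    note w0 = w0'(1) z_def[symmetric] and z = w0'(2)[folded z_def]
    have "finite {w \<in> ?W. f w = z}"
    proof (rule inj_on_finite[OF _ _ tri])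
      show "inj_on (\<lambda>w. w \<otimes> inv w0) {w \<in> ?W. f w = z}" using w0 by (intro inj_onI) simp
      show "(\<lambda>w. w \<otimes> inv w0) ` {w \<in> ?W. f w = z} \<subseteq>
        {v \<in> carrier G. D y0 (act v y0) \<le> 2 * \<eta> \<and> D y1 (act v y1) \<le> 2 * \<eta> \<and> D y2 (act v y2) \<le> 2 * \<eta>}"
      proof
        fix v assume "v \<in> (\<lambda>w. w \<otimes> inv w0) ` {w \<in> ?W. f w = z}"
        then obtain w where w: "w \<in> ?W" "f w = f w0" "v = w \<otimes> inv w0" using w0 by auto
        have wc: "w \<in> carrier G" "w0 \<in> carrier G" using w w0 by auto
        then have v: "v \<in> carrier G" using w by simp
        \<comment> \<open>Equal commutators with \<open>a\<close> mean that \<open>w\<close> and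
          \<open>w0\<close> conjugate \<open>a\<close> to the same element.\<close>
        have comm: "v \<otimes> a = a \<otimes> v"
          if a: "a \<in> carrier G" "inv a \<otimes> (inv w \<otimes> (a \<otimes> w)) = inv a \<otimes> (inv w0 \<otimes> (a \<otimes> w0))" for a
        proof -
          have "inv w \<otimes> (a \<otimes> w) = inv w0 \<otimes> (a \<otimes> w0)" using a wc by simp
          then have "w \<otimes> (inv w \<otimes> (a \<otimes> w)) \<otimes> inv w0 = w \<otimes> (inv w0 \<otimes> (a \<otimes> w0)) \<otimes> inv w0" by simp
          moreover have "w \<otimes> (inv w \<otimes> (a \<otimes> w)) = a \<otimes> w" using a wc by (simp flip: m_assoc)
          moreover have "w \<otimes> (inv w0 \<otimes> (a \<otimes> w0)) \<otimes> inv w0 = w \<otimes> inv w0 \<otimes> a" using a wc by (simp add: m_assoc)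
          ultimately show ?thesis using a wc w(3) by (simp add: m_assoc)
        qed
        have c1: "v \<otimes> g1 = g1 \<otimes> v" and c2: "v \<otimes> k = k \<otimes> v"
          using w(2) comm g k by (simp_all add: f_def)
        have c3: "v \<otimes> inv g1 = inv g1 \<otimes> v"
        proof -
          have "inv g1 \<otimes> v = inv g1 \<otimes> (v \<otimes> g1) \<otimes> inv g1" using g v by (simp add: m_assoc)
          also have "\<dots> = inv g1 \<otimes> (g1 \<otimes> v) \<otimes> inv g1" by (simp only: c1)
          also have "\<dots> = v \<otimes> inv g1" using g v by (simp flip: m_assoc)
          finally show ?thesis ..
        qed
        have Dv: "D y (act v y) \<le> 2 * \<eta>"
        proof -
          have "D y (act v y) \<le> D y (act w y) + D (act w y) (act v y)" using y v wc by (intro D_triangle) auto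
          also have "D (act w y) (act v y) = D y (act (inv w0) y)" using w(3) wc y by (simp add: act_mult)
          also have "\<dots> = D (act w0 y) (act w0 (act (inv w0) y))" using wc y by simp
          also have "act w0 (act (inv w0) y) = y" using wc y by (simp flip: act_mult)
          finally show ?thesis using W_y[OF w(1)] W_y[OF w0(1)] D_sym[of y "act w0 y"] y wc by simp
        qed
        have moved: "D (act u y) (act v (act u y)) \<le> 2 * \<eta>" if "u \<in> carrier G" "v \<otimes> u = u \<otimes> v" for u
        proof -
          have "act v (act u y) = act u (act v y)" using that v y by (metis act_mult)
          then show ?thesis using Dv that v y by simp
        qed
        have i: "inv g1 \<otimes> (g1 \<otimes> g1) = g1" using g by (simp flip: m_assoc)
        have "y0 = act g1 y" "y1 = act (inv g1) y" "y2 = act k y"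
          using c g kk i by (simp_all add: y0_def y1_def y2_def y_def c_def m_assoc flip: act_mult)
        then show "v \<in> {v \<in> carrier G. D y0 (act v y0) \<le> 2 * \<eta> \<and> D y1 (act v y1) \<le> 2 * \<eta> \<and> D y2 (act v y2) \<le> 2 * \<eta>}"
          using moved[OF _ c1] moved[OF _ c3] moved[OF _ c2] v g k by simp
      qed
    qed
    with z show False by simp
  qed
qed

text \<open>If positive powers of both \<open>h1\<close> and \<open>h2\<close> preserved the
  direction of \<open>u\<close> at \<open>base\<close>, \<open>common_germ_powers\<close> would make
  nontrivial powers of \<open>h1\<close> and \<open>h2\<close> agree.\<close>

lemma free_direction:
  assumes u: "u \<in> carrier G" and h: "h1 \<in> carrier G" "h2 \<in> carrier G"
    and bdd: "\<And>n. d x0 (T n h1 x0) \<le> \<beta>g" "\<And>n. d x0 (T n h2 x0) \<le> \<beta>h"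
    and inj: "\<And>(i::int) (j::int). h1 [^] i = h1 [^] j \<Longrightarrow> i = j"
    and indep: "\<And>(i::int) (j::int). h1 [^] i = h2 [^] j \<Longrightarrow> j = 0"
  shows "\<exists>h\<in>{h1, h2}. \<forall>m::nat. m > 0 \<longrightarrow> overlap u (h [^] m \<otimes> u) = 0"
proof (rule ccontr)
  assume contra: "\<not> ?thesis"
  have ex: "\<exists>m::nat. m > 0 \<and> overlap u (h [^] m \<otimes> u) \<noteq> 0" if "h \<in> {h1, h2}" for h
  proof (rule ccontr)
    assume "\<not> ?thesis"
    then have "\<forall>m::nat. m > 0 \<longrightarrow> overlap u (h [^] m \<otimes> u) = 0" by blast
    then show False using contra that by (meson bexI)
  qed
  obtain m1 :: nat where m1: "m1 > 0" "overlap u (h1 [^] m1 \<otimes> u) \<noteq> 0" using ex[of h1] by auto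
  obtain m2 :: nat where m2: "m2 > 0" "overlap u (h2 [^] m2 \<otimes> u) \<noteq> 0" using ex[of h2] by auto
  note m = m1(1) m2(1) m1(2) m2(2)
  have pos: "0 < gromov_product D base (orb u) (act (h1 [^] m1) (orb u))" "0 < gromov_product D base (orb u) (act (h2 [^] m2) (orb u))"
    using overlap_nonneg[of u "h1 [^] m1 \<otimes> u"] overlap_nonneg[of u "h2 [^] m2 \<otimes> u"] m u h
    by (simp_all add: overlap_def act_mult)
  have bd: "d x0 (T n (h [^] (m::nat)) x0) \<le> real m * \<beta>" if "h \<in> carrier G" "\<And>n. d x0 (T n h x0) \<le> \<beta>" for h m n \<beta>
    using int_pow_displacement[OF that(1) that(2)[of n], of "int m"] by (simp add: int_pow_int)
  have "\<exists>(i::int) (j::int). j \<noteq> 0 \<and> (h1 [^] m1) [^] i = (h2 [^] m2) [^] j"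
  proof (rule common_germ_powers[where Q = "orb u" and \<beta>A = "real m1 * \<beta>g" and \<beta>B = "real m2 * \<beta>h"])
    fix i j :: int assume "(h1 [^] m1) [^] i = (h1 [^] m1) [^] j"
    then have "h1 [^] (int m1 * i) = h1 [^] (int m1 * j)" using h by (simp add: int_pow_pow flip: int_pow_int)
    then show "i = j" using inj m by fastforce
  qed (use u h pos bd[OF h(1) bdd(1)] bd[OF h(2) bdd(2)] in auto)
  then obtain i j :: int where "j \<noteq> 0" "(h1 [^] m1) [^] i = (h2 [^] m2) [^] j" by blast
  then have "h1 [^] (int m1 * i) = h2 [^] (int m2 * j)" using h by (simp add: int_pow_pow flip: int_pow_int)
  then show False using indep m \<open>j \<noteq> 0\<close> by fastforce
qed

lemma overlap_shift:
  assumes "z \<in> carrier G" "len z = 0" "u \<in> carrier G" "v \<in> carrier G"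
  shows "overlap (z \<otimes> u) (z \<otimes> v) = overlap u v"
proof -
  have "inv (z \<otimes> u) \<otimes> (z \<otimes> v) = inv u \<otimes> (inv z \<otimes> (z \<otimes> v))" using assms by (simp add: inv_mult_group m_assoc)
  also have "inv z \<otimes> (z \<otimes> v) = v" using assms by (simp flip: m_assoc)
  finally show ?thesis using assms by (simp add: overlap_len len_mult_zero)
qed

text \<open>That \<open>bs @ bs\<close> is reduced says that \<open>bs\<close> is cyclically
  reduced, so copies of it concatenate without cancellation and \<open>base\<close> lies on the axis
  of the product.\<close>

lemma reduced_power_length:
  assumes X: "X \<subseteq> carrier G" "\<And>x. x \<in> X \<Longrightarrow> inv x \<in> X"
    and c: "c > 0" "\<And>x. x \<in> X \<Longrightarrow> len x = c"
    and sep: "\<And>x y. x \<in> X \<Longrightarrow> y \<in> X \<Longrightarrow> x \<noteq> y \<Longrightarrow> overlap x y = 0"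
    and bs: "bs \<noteq> []" "set bs \<subseteq> X" "successively (\<lambda>x y. y \<noteq> inv x) (bs @ bs)" and n: "n > 0"
  shows "len (word_prod bs [^] (n::nat)) = c * real (n * length bs)" "0 < overlap (word_prod bs [^] n) (hd bs)"
proof -
  define r where "r n = concat (replicate n bs)" for n
  have rs: "set (r n) \<subseteq> X" for n using bs by (auto simp: r_def)
  have sc: "successively (\<lambda>x y. y \<noteq> inv x) (r n)" and hd: "n > 0 \<Longrightarrow> hd (r n) = hd bs \<and> r n \<noteq> []" for n
  proof (induction n)
    case (Suc n)
    { case 1
      have "successively (\<lambda>x y. y \<noteq> inv x) (bs @ r n)"
        using bs Suc by (cases "n = 0") (auto simp: successively_append_iff r_def)
      then show ?case by (simp add: r_def)
    next
      case 2
      show ?case using bs by (simp add: r_def)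
    }
  qed (auto simp: r_def)
  have wp: "word_prod (r n) = word_prod bs [^] n" for n
  proof (induction n)
    case (Suc n)
    have "word_prod (bs @ r n) = word_prod bs \<otimes> word_prod (r n)"
      using bs X rs[of n] by (intro word_prod_append) auto
    then show ?case using Suc nat_pow_Suc2[of "word_prod bs" n] word_prod_closed[of bs] bs X by (simp add: r_def)
  qed (simp add: r_def word_prod_def)
  have "length (r n) = n * length bs" by (simp add: r_def length_concat sum_list_replicate)
  then show "len (word_prod bs [^] (n::nat)) = c * real (n * length bs)" "0 < overlap (word_prod bs [^] n) (hd bs)"
    using reduced_word_length[OF X c sep, of "r n"] hd[OF n] rs sc wp[of n] by auto
qed

text \<open>\<open>h\<close> rotates about \<open>base\<close> and moves the direction towards its
  translate by \<open>s\<close>; the conjugate of \<open>k\<close> by \<open>s\<close> rotates about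
  that translate and moves the direction back to \<open>base\<close>. The product \<open>g1\<close>
  of the latter with the inverse of \<open>h\<close> translates by \<open>2 * len s\<close>;
  conjugating it by a power of \<open>h\<close> gives an independent translation
  \<open>g2\<close>.\<close>

lemma unbounded_scale_acylindrically_hyperbolic:
  assumes cV: "countable V"
    and medians: "\<And>p q r. p \<in> V \<Longrightarrow> q \<in> V \<Longrightarrow> r \<in> V \<Longrightarrow> \<exists>z\<in>V. \<forall>n. d (p n) (z n) = gromov_product d (p n) (q n) (r n) \<and>
        d (z n) (q n) = d (p n) (q n) - gromov_product d (p n) (q n) (r n)"
    and s: "s \<in> carrier G" "len s > 0" and h12: "h1 \<in> carrier G" "h2 \<in> carrier G"
    and bdd: "\<And>n. d x0 (T n h1 x0) \<le> \<beta>g" "\<And>n. d x0 (T n h2 x0) \<le> \<beta>h"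
    and inj: "\<And>(i::int) (j::int). h1 [^] i = h1 [^] j \<Longrightarrow> i = j"
    and indep: "\<And>(i::int) (j::int). h1 [^] i = h2 [^] j \<Longrightarrow> j = 0"
  shows "acylindrically_hyperbolic TYPE('g \<times> real) G"
proof -
  define l where "l = len s"
  have l: "l > 0" using s by (simp add: l_def)
  have zero: "len h = 0" if "h \<in> {h1, h2}" for h
    using that D_base_bounded[OF h12(1) bdd(1)] D_base_bounded[OF h12(2) bdd(2)] by (auto simp: len_def)
  obtain h where h': "h \<in> {h1, h2}" "\<forall>m::nat. m > 0 \<longrightarrow> overlap s (h [^] m \<otimes> s) = 0"
    by (rule bexE[OF free_direction[OF s(1) h12 bdd inj indep]])
  obtain k where k': "k \<in> {h1, h2}" "\<forall>m::nat. m > 0 \<longrightarrow> overlap (inv s) (k [^] m \<otimes> inv s) = 0"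
    by (rule bexE[OF free_direction[OF inv_closed[OF s(1)] h12 bdd inj indep]])
  note h = h'(1) h'(2)[rule_format] and k = k'(1) k'(2)[rule_format]
  have hk [simp]: "h \<in> carrier G" "k \<in> carrier G" "s \<in> carrier G" using h k h12 s by auto
  have len_hk: "len h = 0" "len k = 0" using zero h k by auto
  have len_hn: "len (h [^] (m::nat)) = 0" for m
    by (induction m) (auto simp: len_mult_zero len_hk)
  \<comment> \<open>The second power of \<open>h\<close> makes the letters \<open>x 0\<close>,
    \<open>x 1\<close>, \<open>x 2\<close>, \<open>x 3\<close> leave \<open>base\<close> in the
    directions of \<open>e 0\<close>, \<open>e 1\<close>, \<open>e 2\<close>, \<open>e 3\<close>,
    which are distinct because every positive power of \<open>h\<close> moves the direction of
    \<open>s\<close>.\<close>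
  define g1 where "g1 = s \<otimes> k \<otimes> inv s \<otimes> inv h"
  define hh where "hh = h [^] (2::nat)"
  define g2 where "g2 = hh \<otimes> g1 \<otimes> inv hh"
  have hh [simp]: "hh \<in> carrier G" by (simp add: hh_def)
  have g [simp]: "g1 \<in> carrier G" "g2 \<in> carrier G" by (simp_all add: g1_def g2_def)
  define e where "e i = h [^] (i::nat) \<otimes> s" for i
  define x where "x i = [g1, inv g1, g2, inv g2] ! i" for i
  have e_closed [simp]: "e i \<in> carrier G" for i by (simp add: e_def)
  have x_all: "P (x i)" if "i < 4" "P g1" "P (inv g1)" "P g2" "P (inv g2)" for P i
    using that by (auto simp: x_def less_Suc_eq numeral_eq_Suc)
  have x_closed: "x i \<in> carrier G" if "i < 4" for i by (rule x_all[OF that]) auto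
  have len_e: "len (e i) = l" for i by (simp add: e_def len_mult_zero len_hn l_def)
  have sep_e: "overlap (e i) (e j) = 0" if "i < j" for i j
  proof -
    have "e j = h [^] i \<otimes> (h [^] (j - i) \<otimes> s)" using that by (simp add: e_def nat_pow_mult flip: m_assoc)
    then show ?thesis using overlap_shift[of "h [^] i" s "h [^] (j - i) \<otimes> s"] h(2)[of "j - i"] that len_hn by (simp add: e_def)
  qed
  have sep_e': "overlap (e i) (e j) = 0" if "i \<noteq> j" for i j
    using sep_e[of i j] sep_e[of j i] overlap_sym[of "e i" "e j"] that by (cases "i < j") auto
  have len_g1: "len g1 = 2 * l"
  proof -
    have "len g1 = len (s \<otimes> k \<otimes> inv s)" using len_mult_zero(1)[of "s \<otimes> k \<otimes> inv s" "inv h"] len_hk len_inv[of h] by (simp add: g1_def)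
    moreover have "len (k \<otimes> inv s) = l" using len_mult_zero(2)[of "inv s" k] len_hk len_inv[of s] by (simp add: l_def)
    ultimately show ?thesis using k(2)[of 1] overlap_len[of "inv s" "k \<otimes> inv s"] len_inv[of s] by (simp add: l_def m_assoc)
  qed
  have len_hh: "len hh = 0" "len (inv hh) = 0" using len_hn len_inv[of hh] by (simp_all add: hh_def)
  have len_g2: "len g2 = 2 * l" using len_g1 len_hh by (simp add: g2_def len_mult_zero)
  have len_x: "len (x i) = 2 * l" if "i < 4" for i
    by (rule x_all[OF that]) (simp_all add: len_g1 len_g2 len_inv)
  have d0: "inv g1 \<otimes> s = h \<otimes> (s \<otimes> inv k)" and d1: "g1 \<otimes> (h \<otimes> s) = s \<otimes> k"
    by (simp_all add: g1_def inv_mult_group m_assoc)  (simp_all flip: m_assoc[of "inv h"])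
  have l0: "len (inv g1 \<otimes> s) = l" using d0 len_hk len_inv[of k] by (simp add: len_mult_zero l_def)
  have l1: "len (g1 \<otimes> (h \<otimes> s)) = l" using d1 len_hk by (simp add: len_mult_zero l_def)
  have cancel: "inv hh \<otimes> (hh \<otimes> y) = y" if "y \<in> carrier G" for y using that by (simp flip: m_assoc)
  have e_expl: "e 0 = s" "e (Suc 0) = h \<otimes> s" "e 2 = hh \<otimes> s" "e 3 = hh \<otimes> (h \<otimes> s)"
    by (simp_all add: e_def hh_def numeral_3_eq_3 numeral_2_eq_2 m_assoc)
  have "len (inv (x i) \<otimes> e i) = l" if "i < 4" for i
  proof -
    from that have "i = 0 \<or> i = 1 \<or> i = 2 \<or> i = 3" by auto
    then show ?thesis
      using l0 l1 len_hh by (auto simp: x_def e_expl g2_def inv_mult_group m_assoc cancel len_mult_zero)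
  qed
  then have xe: "overlap (x i) (e i) > 0" if "i < 4" for i
    using that overlap_len[of "x i" "e i"] x_closed len_x len_e l by simp
  have sep_x: "overlap (x i) (x j) = 0" if "i < 4" "j < 4" "i \<noteq> j" for i j
  proof (rule ccontr)
    assume "overlap (x i) (x j) \<noteq> 0"
    then have "0 < overlap (x i) (x j)" using overlap_nonneg[of "x i" "x j"] x_closed that by simp
    then have "0 < overlap (e i) (e j)"
      using overlap_trans[of "e i" "x i" "x j"] overlap_trans[of "e i" "x j" "e j"] xe[of i] xe[of j]
        overlap_sym[of "x i" "e i"] x_closed that by simp
    then show False using sep_e'[OF that(3)] by simp
  qed
  have x_neq: "x i \<noteq> x j" if "i < 4" "j < 4" "i \<noteq> j" for i j
    using sep_x[OF that] overlap_len[of "x i" "x i"] x_closed len_x that l by force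
  define X where "X = {g1, g2, inv g1, inv g2}"
  have X_x: "X = x ` {..<4}" by (auto simp: X_def x_def lessThan_Suc numeral_eq_Suc)
  have X: "X \<subseteq> carrier G" "\<And>y. y \<in> X \<Longrightarrow> inv y \<in> X" by (auto simp: X_def)
  have c: "2 * l > 0" "\<And>y. y \<in> X \<Longrightarrow> len y = 2 * l" using l len_x by (auto simp: X_x)
  have sep: "overlap y z = 0" if "y \<in> X" "z \<in> X" "y \<noteq> z" for y z using that sep_x by (auto simp: X_x)
  have neq: "g1 \<noteq> inv g1" "g1 \<noteq> g2" "g1 \<noteq> inv g2" "g2 \<noteq> inv g1" "g2 \<noteq> inv g2" "inv g1 \<noteq> inv g2"
    using x_neq[of 0 1] x_neq[of 0 2] x_neq[of 0 3] x_neq[of 2 1] x_neq[of 2 3] x_neq[of 1 3] by (simp_all add: x_def)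
  have words: "len (word_prod xs) = 2 * l * real (length xs)"
    if "xs \<noteq> []" "set xs \<subseteq> {g1, g2, inv g1, inv g2}" "successively (\<lambda>x y. y \<noteq> inv x) xs" for xs
    using reduced_word_length[OF X c sep that[folded X_def]] by blast
  define b where "b = word_prod [g1, g1, g2, g2]"
  define b' where "b' = word_prod [g2, g2, g1, g1]"
  have b: "b \<in> carrier G" "b' \<in> carrier G" by (auto simp: b_def b'_def intro!: word_prod_closed)
  have inv_b: "inv b = word_prod [inv g2, inv g2, inv g1, inv g1]" "inv b' = word_prod [inv g1, inv g1, inv g2, inv g2]"
    by (simp_all add: b_def b'_def word_prod_def inv_mult_group m_assoc)
  have pow_b: "len (b [^] n) = 8 * l * real n" "overlap (b [^] n) g1 > 0"
    "overlap (inv b [^] n) (inv g2) > 0" "overlap (b' [^] n) g2 > 0" "overlap (inv b' [^] n) (inv g1) > 0"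
    if n: "n > 0" for n :: nat
  proof -
    note P = reduced_power_length[OF X c sep _ _ _ n]
    show "len (b [^] n) = 8 * l * real n" "overlap (b [^] n) g1 > 0"
      using P[of "[g1, g1, g2, g2]"] neq by (auto simp: b_def X_def)
    show "overlap (inv b [^] n) (inv g2) > 0"
      using P(2)[of "[inv g2, inv g2, inv g1, inv g1]"] neq by (auto simp: inv_b X_def)
    show "overlap (b' [^] n) g2 > 0"
      using P(2)[of "[g2, g2, g1, g1]"] neq by (auto simp: b'_def X_def)
    show "overlap (inv b' [^] n) (inv g1) > 0"
      using P(2)[of "[inv g1, inv g1, inv g2, inv g2]"] neq by (auto simp: inv_b X_def)
  qed
  have len_pow: "len (b [^] (n::nat)) = 8 * l * real n" for n using pow_b(1)[of n] by (cases "n = 0") auto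
  \<comment> \<open>The largest value allowed for letters of length \<open>2 * l\<close>.\<close>
  define \<eta> where "\<eta> = 2 * l / 100"
  interpret S: segment_action G V D act base "orb b" \<eta>
  proof unfold_locales
    show "\<exists>c\<in>V. D p c = gromov_product D p q r \<and> D c q = D p q - gromov_product D p q r"
      if pqr: "p \<in> V" "q \<in> V" "r \<in> V" for p q r
    proof -
      obtain z where z: "z \<in> V" "\<And>n. d (p n) (z n) = gromov_product d (p n) (q n) (r n)"
        "\<And>n. d (z n) (q n) = d (p n) (q n) - gromov_product d (p n) (q n) (r n)" using medians[OF pqr] by blast
      have gp: "((\<lambda>n. gromov_product d (p n) (q n) (r n) / \<mu> n) \<longlongrightarrow> gromov_product D p q r) \<F>"
      proof -
        have "((\<lambda>n. (d (p n) (q n) / \<mu> n + d (p n) (r n) / \<mu> n - d (q n) (r n) / \<mu> n) / 2) \<longlongrightarrow> gromov_product D p q r) \<F>"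
          unfolding gromov_product_def using pqr by (intro tendsto_intros limit) auto
        then show ?thesis by (simp add: gromov_product_def add_divide_distrib diff_divide_distrib mult.commute)
      qed
      have "D p z = gromov_product D p q r" using gp z by (intro limit_unique[OF pqr(1) z(1)]) simp
      moreover have "D z q = D p q - gromov_product D p q r"
        by (rule limit_unique[OF z(1) pqr(2)]) (use gp z pqr limit in \<open>auto simp: diff_divide_distrib intro!: tendsto_intros\<close>)
      ultimately show ?thesis using z(1) by blast
    qed
    show "D base (orb b) > 0" using len_pow[of 1] l b by (simp add: len_def)
    show "finite {g \<in> carrier G. D base (orb g) \<le> \<eta> \<and> D (orb b) (act g (orb b)) \<le> \<eta>}"
      unfolding b_def
      by (rule finite_coarse_stabilizer[where L = "2 * l"]) (use l words neq in \<open>auto simp: \<eta>_def\<close>)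
  qed (use b l in \<open>auto simp: tree act_mult \<eta>_def\<close>)
  have L: "D base (orb b) = 8 * l" using len_pow[of 1] b by (simp add: len_def)
  \<comment> \<open>The segment and its translates by powers of \<open>b\<close> line up along the
    axis of \<open>b\<close>, so the count grows by exactly 1 per power.\<close>
  have chain: "S.chain n base (orb (b [^] n))" for n :: nat
  proof (induction n)
    case (Suc n)
    have e: "orb (b [^] Suc n) = act b (orb (b [^] n))" using nat_pow_Suc2[of b n] b by (simp add: act_mult)
    have "S.chain n (orb b) (orb (b [^] Suc n))" unfolding e by (rule S.chain_act[OF b(1) _ _ Suc]) (use b in auto)
    moreover have "S.seg base (orb b)" unfolding S.seg_def by (rule bexI[of _ \<one>]) (use b in auto)
    moreover have "D (orb b) (orb (b [^] Suc n)) = 8 * l * real n"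
      unfolding e using b len_pow[of n] by (simp add: len_def)
    then have "D base base + D base (orb b) + D (orb b) (orb (b [^] Suc n)) = D base (orb (b [^] Suc n))"
      using len_pow[of "Suc n"] L by (simp add: len_def algebra_simps)
    ultimately show ?case by (intro S.chain_SucI)
  qed simp
  have cnt: "S.cnt base (orb (b [^] n)) = n" for n :: nat
  proof (rule antisym)
    show "n \<le> S.cnt base (orb (b [^] n))" using chain S.chain_iff b by simp
    have "real (S.cnt base (orb (b [^] n))) * (8 * l) \<le> 8 * l * real n"
      using S.cnt_length[of base "orb (b [^] n)"] L len_pow[of n] b by (simp add: len_def)
    then show "S.cnt base (orb (b [^] n)) \<le> n" using l by (simp add: mult.commute)
  qed
  interpret N: pseudo_metric_space V S.N by (rule S.pseudo_metric_N)
  have N_nat: "real n \<le> S.N base (orb (b [^] n)) \<and> S.N base (orb (b [^] n)) \<le> real n + 1" for n :: nat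
    using S.N_bounds[of base "orb (b [^] n)"] cnt[of n] by simp
  have N_pow: "\<bar>real_of_int m - real_of_int n\<bar> \<le> S.N (orb (b [^] (m::int))) (orb (b [^] n)) \<and>
    S.N (orb (b [^] m)) (orb (b [^] n)) \<le> \<bar>real_of_int m - real_of_int n\<bar> + 1" for m n
  proof -
    have le: "real_of_int n - real_of_int m \<le> S.N (orb (b [^] m)) (orb (b [^] n)) \<and>
      S.N (orb (b [^] m)) (orb (b [^] n)) \<le> real_of_int n - real_of_int m + 1" if "m \<le> n" for m n :: int
    proof -
      define j where "j = nat (n - m)"
      then have j: "n = m + int j" using that by simp
      have "orb (b [^] n) = act (b [^] m) (orb (b [^] j))" using b by (simp add: j int_pow_mult int_pow_int flip: act_mult)
      then have "S.N (orb (b [^] m)) (orb (b [^] n)) = S.N base (orb (b [^] j))" using b by (simp add: S.N_act)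
      then show ?thesis using N_nat[of j] by (simp add: j)
    qed
    show ?thesis using le[of m n] le[of n m] N.D_sym[of "orb (b [^] m)" "orb (b [^] n)"] b by (cases "m \<le> n") auto
  qed
  \<comment> \<open>\<open>b'\<close> is the conjugate of \<open>b\<close> by \<open>c\<close>, so
    the orbit distances of its powers differ from those of \<open>b\<close> by at most twice
    \<open>S.N base q\<close>.\<close>
  define c where "c = g2 \<otimes> g2"
  have cc: "c \<in> carrier G" by (simp add: c_def)
  have b'_conj: "b' [^] (m::int) = c \<otimes> (b [^] m \<otimes> inv c)" for m
  proof -
    have "b' = c \<otimes> (b \<otimes> inv c)" by (simp add: b_def b'_def c_def word_prod_def inv_mult_group m_assoc) (simp flip: m_assoc)
    then have nat: "b' [^] (n::nat) = c \<otimes> (b [^] n \<otimes> inv c)" for n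
    proof (induction n)
      case (Suc n)
      have "inv c \<otimes> (c \<otimes> (b \<otimes> inv c)) = b \<otimes> inv c" using cc b by (simp flip: m_assoc)
      then show ?case using Suc cc b by (simp add: m_assoc)
    qed (use cc in simp)
    show ?thesis
    proof (cases "m \<ge> 0")
      case True
      then obtain n where "m = int n" by (rule nonneg_int_cases)
      then show ?thesis using nat by (simp add: int_pow_int)
    next
      case False
      then have "0 \<le> - m" by simp
      then obtain n where "- m = int n" by (rule nonneg_int_cases)
      then have "m = - int n" by simp
      then show ?thesis using nat[of n] b cc by (simp add: int_pow_neg int_pow_int inv_mult_group m_assoc)
    qed
  qed
  define q where "q = orb (inv c)"
  have q: "q \<in> V" using cc by (simp add: q_def)
  have b'_orb: "orb (b' [^] (m::int)) = act c (act (b [^] m) q)" for m using b cc by (simp add: b'_conj q_def act_mult)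
  have N_pow': "\<bar>S.N (orb (b' [^] (m::int))) (orb (b' [^] (n::int))) - S.N (orb (b [^] m)) (orb (b [^] n))\<bar> \<le> 2 * S.N base q" for m n
  proof -
    have V: "act (b [^] (m::int)) q \<in> V" "orb (b [^] m) \<in> V" for m using b q by auto
    have eq: "S.N (orb (b [^] (m::int))) (act (b [^] m) q) = S.N base q" for m using b q by (simp add: S.N_act)
    show ?thesis
      using b cc V eq[of m] eq[of n] N.D_sym[OF V(2)[of m] V(1)[of m]] N.D_sym[OF V(2)[of n] V(1)[of n]]
        N.D_triangle[OF V(2)[of m] V(1)[of m] V(2)[of n]] N.D_triangle[OF V(1)[of m] V(1)[of n] V(2)[of n]]
        N.D_triangle[OF V(1)[of m] V(2)[of m] V(1)[of n]] N.D_triangle[OF V(2)[of m] V(2)[of n] V(1)[of n]]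
      by (simp add: b'_orb S.N_act abs_le_iff)
  qed
  show ?thesis
  proof (rule S.acylindrically_hyperbolic_of_segment[OF cV b base_V])
    fix k assume "k \<in> {b, b'}"
    then consider "k = b" | "k = b'" by blast
    then show "\<exists>K\<ge>1. \<exists>C\<ge>0. \<forall>m n :: int.
        \<bar>real_of_int m - real_of_int n\<bar> / K - C \<le> S.N (orb (k [^] m)) (orb (k [^] n)) \<and>
        S.N (orb (k [^] m)) (orb (k [^] n)) \<le> K * \<bar>real_of_int m - real_of_int n\<bar> + C"
    proof cases
      case 1
      have "\<bar>real_of_int m - real_of_int n\<bar> / 1 - 1 \<le> S.N (orb (k [^] m)) (orb (k [^] n)) \<and>
        S.N (orb (k [^] m)) (orb (k [^] n)) \<le> 1 * \<bar>real_of_int m - real_of_int n\<bar> + 1" for m n :: int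
        using N_pow[of m n] 1 by auto
      then show ?thesis by (metis order_refl zero_le_one)
    next
      case 2
      define C where "C = 1 + 2 * S.N base q"
      have "C \<ge> 0" using N.D_nonneg[of base q] q by (simp add: C_def)
      moreover have "\<bar>real_of_int m - real_of_int n\<bar> / 1 - C \<le> S.N (orb (k [^] m)) (orb (k [^] n)) \<and>
        S.N (orb (k [^] m)) (orb (k [^] n)) \<le> 1 * \<bar>real_of_int m - real_of_int n\<bar> + C" for m n :: int
        using N_pow[of m n] N_pow'[of m n] 2 unfolding C_def by (auto simp: abs_le_iff)
      ultimately show ?thesis by (metis order_refl)
    qed
  next
    fix \<sigma> \<tau> :: int and m n :: nat assume st: "\<sigma> \<in> {1, -1}" "\<tau> \<in> {1, -1}"
    show "S.betw (orb (b [^] (\<sigma> * int m))) base (orb (b' [^] (\<tau> * int n)))"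
    proof (cases "m = 0 \<or> n = 0")
      case True
      then show ?thesis using b by (auto simp: S.betw_def)
    next
      case False
      \<comment> \<open>Powers of \<open>b\<close> leave \<open>base\<close> towards
        \<open>g1\<close> or \<open>inv g2\<close>, those of \<open>b'\<close> towards
        \<open>g2\<close> or \<open>inv g1\<close>; the two pairs are disjoint, so
        \<open>base\<close> lies between the orbits.\<close>
      have "\<exists>y\<in>{g1, inv g2}. overlap (b [^] (\<sigma> * int m)) y > 0"
        using st(1) pow_b(2,3)[of m] False b by (auto simp: int_pow_int int_pow_neg nat_pow_inv)
      then obtain y where y: "y \<in> {g1, inv g2}" "overlap (b [^] (\<sigma> * int m)) y > 0" by (rule bexE)
      have "\<exists>z\<in>{g2, inv g1}. overlap (b' [^] (\<tau> * int n)) z > 0"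
        using st(2) pow_b(4,5)[of n] False b by (auto simp: int_pow_int int_pow_neg nat_pow_inv)
      then obtain z where z: "z \<in> {g2, inv g1}" "overlap (b' [^] (\<tau> * int n)) z > 0" by (rule bexE)
      let ?u = "b [^] (\<sigma> * int m)" and ?v = "b' [^] (\<tau> * int n)"
      have yz: "y \<in> carrier G" "z \<in> carrier G" "y \<in> X" "z \<in> X" "y \<noteq> z" using y z neq by (auto simp: X_def)
      have uv: "?u \<in> carrier G" "?v \<in> carrier G" using b by auto
      have "overlap ?u ?v = 0"
      proof (rule ccontr)
        assume "overlap ?u ?v \<noteq> 0"
        then have "0 < overlap ?u ?v" using overlap_nonneg uv by (simp add: less_le)
        then have "0 < overlap y z"
          using overlap_trans[of y ?u ?v] overlap_trans[of y ?v z] overlap_sym[of ?u y] y z yz uv by simp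
        then show False using sep[of y z] yz by simp
      qed
      then show ?thesis using D_sym[of "orb ?u" base] uv by (simp add: overlap_def gromov_product_def S.betw_def)
    qed
  qed
qed

end

section \<open>Acylindrical hyperbolicity of the overgroup\<close>

context isometric_group_action
begin

lemma loxodromic_at:
  assumes "loxodromic G M d \<alpha> g" "x \<in> M"
  shows "\<exists>K\<ge>1. \<exists>C\<ge>0. \<forall>m n :: int.
        \<bar>real_of_int m - real_of_int n\<bar> / K - C \<le> d (\<alpha> (g [^] m) x) (\<alpha> (g [^] n) x) \<and>
        d (\<alpha> (g [^] m) x) (\<alpha> (g [^] n) x) \<le> K * \<bar>real_of_int m - real_of_int n\<bar> + C"
proof -
  have g: "g \<in> carrier G" using assms by (simp add: loxodromic_def)
  obtain y K C where y: "y \<in> M" "K \<ge> 1" "C \<ge> 0" and K: "\<forall>m n :: int.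
      \<bar>real_of_int m - real_of_int n\<bar> / K - C \<le> d (\<alpha> (g [^] m) y) (\<alpha> (g [^] n) y) \<and>
      d (\<alpha> (g [^] m) y) (\<alpha> (g [^] n) y) \<le> K * \<bar>real_of_int m - real_of_int n\<bar> + C"
    using assms unfolding loxodromic_def by blast
  have diff: "\<bar>d (\<alpha> (g [^] m) x) (\<alpha> (g [^] n) x) - d (\<alpha> (g [^] m) y) (\<alpha> (g [^] n) y)\<bar> \<le> 2 * d x y" for m n :: int
  proof -
    have V: "\<alpha> (g [^] m) z \<in> M" "d (\<alpha> (g [^] m) x) (\<alpha> (g [^] m) y) = d x y" if "z \<in> M" for m :: int and z
      using g assms y that by auto
    show ?thesis
      using V[OF assms(2), of m] V[OF y(1), of m] V[OF assms(2), of n] V[OF y(1), of n]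
        triangle[of "\<alpha> (g [^] m) x" "\<alpha> (g [^] m) y" "\<alpha> (g [^] n) x"] triangle[of "\<alpha> (g [^] m) y" "\<alpha> (g [^] n) y" "\<alpha> (g [^] n) x"]
        triangle[of "\<alpha> (g [^] m) y" "\<alpha> (g [^] m) x" "\<alpha> (g [^] n) y"] triangle[of "\<alpha> (g [^] m) x" "\<alpha> (g [^] n) x" "\<alpha> (g [^] n) y"]
        commute[of "\<alpha> (g [^] m) x" "\<alpha> (g [^] m) y"] commute[of "\<alpha> (g [^] n) x" "\<alpha> (g [^] n) y"]
      by linarith
  qed
  have "\<bar>real_of_int m - real_of_int n\<bar> / K - (C + 2 * d x y) \<le> d (\<alpha> (g [^] m) x) (\<alpha> (g [^] n) x) \<and>
      d (\<alpha> (g [^] m) x) (\<alpha> (g [^] n) x) \<le> K * \<bar>real_of_int m - real_of_int n\<bar> + (C + 2 * d x y)" for m n :: int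
    using K[rule_format, of m n] diff[of m n] by linarith
  moreover have "0 \<le> C + 2 * d x y" using y by simp
  ultimately show ?thesis using y(2) by blast
qed

end

lemma (in group) isometric_group_action_hom:
  assumes "isometric_group_action K M d \<alpha>" "\<phi> \<in> hom G K"
  shows "isometric_group_action G M d (\<lambda>g. \<alpha> (\<phi> g))"
proof -
  interpret K: isometric_group_action K M d \<alpha> by fact
  interpret h: group_hom G K \<phi> by unfold_locales (rule assms(2))
  show ?thesis
    by unfold_locales (auto simp: K.act_mult)
qed

text \<open>The constants are those of the action of \<open>K\<close>; once the homomorphism is
  injective on \<open>A\<close>, its image is too large to move two distant points by
  little.\<close>

lemma (in group) discriminating_asymptotically_acylindrical:
  assumes acyl: "acylindrical_action K M d \<alpha>" and K: "group K"
    and \<phi>: "\<And>n. \<phi> n \<in> hom G K" and disc: "\<And>g. g \<in> carrier G \<Longrightarrow> g \<noteq> \<one> \<Longrightarrow> eventually (\<lambda>n. \<phi> n g \<noteq> \<one>\<^bsub>K\<^esub>) sequentially"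
    and \<epsilon>: "\<epsilon> \<ge> 0"
  shows "\<exists>N::nat. \<exists>R. \<forall>A. finite A \<longrightarrow> A \<subseteq> carrier G \<longrightarrow> card A > N \<longrightarrow>
    eventually (\<lambda>n::nat. \<forall>x\<in>M. \<forall>y\<in>M. d x y \<ge> R \<longrightarrow>
      (\<exists>g\<in>A. d x (\<alpha> (\<phi> n g) x) > \<epsilon> \<or> d y (\<alpha> (\<phi> n g) y) > \<epsilon>)) sequentially"
proof -
  obtain N R where NR: "\<forall>x\<in>M. \<forall>y\<in>M. d x y \<ge> R \<longrightarrow>
      finite {g \<in> carrier K. d x (\<alpha> g x) \<le> \<epsilon> \<and> d y (\<alpha> g y) \<le> \<epsilon>} \<and>
      card {g \<in> carrier K. d x (\<alpha> g x) \<le> \<epsilon> \<and> d y (\<alpha> g y) \<le> \<epsilon>} \<le> N"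
    using acyl \<epsilon> unfolding acylindrical_action_def by meson
  show ?thesis
  proof (intro exI[of _ N] exI[of _ R] allI impI)
    fix A assume A: "finite A" "A \<subseteq> carrier G" "card A > N"
    have "eventually (\<lambda>n. \<forall>u\<in>A. \<forall>v\<in>A. u \<noteq> v \<longrightarrow> \<phi> n u \<noteq> \<phi> n v) sequentially"
    proof (intro eventually_ball_finite ballI A(1))
      fix u v assume uv: "u \<in> A" "v \<in> A"
      show "eventually (\<lambda>n. u \<noteq> v \<longrightarrow> \<phi> n u \<noteq> \<phi> n v) sequentially"
      proof (cases "u = v")
        case False
        have c: "u \<in> carrier G" "v \<in> carrier G" using uv A by auto
        have "inv u \<otimes> v \<noteq> \<one>" using False c by (metis inv_equality inv_inv inv_closed)
        then have "eventually (\<lambda>n. \<phi> n (inv u \<otimes> v) \<noteq> \<one>\<^bsub>K\<^esub>) sequentially" using disc c by simp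
        then show ?thesis
        proof eventually_elim
          case (elim n)
          interpret h: group_hom G K "\<phi> n" by (intro group_hom.intro group_hom_axioms.intro group_axioms K \<phi>)
          show ?case using elim c by auto
        qed
      qed simp
    qed
    then show "eventually (\<lambda>n. \<forall>x\<in>M. \<forall>y\<in>M. d x y \<ge> R \<longrightarrow>
      (\<exists>g\<in>A. d x (\<alpha> (\<phi> n g) x) > \<epsilon> \<or> d y (\<alpha> (\<phi> n g) y) > \<epsilon>)) sequentially"
    proof eventually_elim
      case (elim n)
      show ?case
      proof (intro ballI impI, rule ccontr)
        fix x y assume xy: "x \<in> M" "y \<in> M" "d x y \<ge> R"
          and contra: "\<not> (\<exists>g\<in>A. d x (\<alpha> (\<phi> n g) x) > \<epsilon> \<or> d y (\<alpha> (\<phi> n g) y) > \<epsilon>)"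
        have "\<phi> n g \<in> carrier K" if "g \<in> A" for g using that A \<phi>[of n] by (auto simp: hom_def)
        then have "\<phi> n ` A \<subseteq> {g \<in> carrier K. d x (\<alpha> g x) \<le> \<epsilon> \<and> d y (\<alpha> g y) \<le> \<epsilon>}"
          using contra by (auto simp: not_less)
        then have "card (\<phi> n ` A) \<le> N" using NR xy by (meson card_mono order_trans)
        moreover have "inj_on (\<phi> n) A" using elim by (auto simp: inj_on_def)
        ultimately show False using A by (simp add: card_image)
      qed
    qed
  qed
qed

theorem theorem1p3:
  fixes G :: "('g, 'm) monoid_scheme" and H :: "'g set"
  assumes "finitely_generated_group G"
    and "subgroup H G"
    and "acylindrically_hyperbolic TYPE('x) (G\<lparr>carrier := H\<rparr>)"
    and "equationally_noetherian (G\<lparr>carrier := H\<rparr>)"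
    and "existentially_closed_in H G"
  shows "acylindrically_hyperbolic TYPE('g \<times> real) G"
proof -
  define K where "K = G\<lparr>carrier := H\<rparr>"
  interpret group G using assms(1) by (simp add: finitely_generated_group_def)
  interpret K: group K unfolding K_def using assms(2) by (rule subgroup_imp_group)
  obtain \<delta> and M :: "'x set" and d \<alpha> g h where hyp: "hyperbolic_space \<delta> M d"
    and acyl: "acylindrical_action K M d \<alpha>" and ind: "independent_loxodromics K M d \<alpha> g h"
    using assms(3) unfolding acylindrically_hyperbolic_def K_def by blast
  have four: "four_point M d \<delta>" and \<delta>: "\<delta> \<ge> 0" and geo: "geodesic_space M d"
    using hyp by (auto simp: hyperbolic_space_iff)
  have iso: "Metric_space M d" "group_action K M \<alpha>" "\<And>g x y. g \<in> carrier K \<Longrightarrow> x \<in> M \<Longrightarrow> y \<in> M \<Longrightarrow> d (\<alpha> g x) (\<alpha> g y) = d x y"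
    using acyl by (auto simp: acylindrical_action_def isometric_action_def)
  have act_K: "isometric_group_action K M d \<alpha>"
    using iso group_action_facts[OF iso(2)] K.group_axioms
    by (intro isometric_group_action.intro isometric_group_action_axioms.intro) auto
  interpret A: isometric_group_action K M d \<alpha> by (rule act_K)
  have lox: "loxodromic K M d \<alpha> g" "loxodromic K M d \<alpha> h" using ind by (auto simp: independent_loxodromics_def)
  then have ghK: "g \<in> carrier K" "h \<in> carrier K" by (auto simp: loxodromic_def)
  then have ghH: "g \<in> H" "h \<in> H" by (auto simp: K_def)
  then have gh: "g \<in> carrier G" "h \<in> carrier G" using subgroup.subset[OF assms(2)] by auto
  obtain x0 where x0: "x0 \<in> M" using lox by (auto simp: loxodromic_def)
  have pow: "k [^]\<^bsub>K\<^esub> (m::int) = k [^]\<^bsub>G\<^esub> m" if "k \<in> H" for k m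
    unfolding K_def using int_pow_consistent[OF assms(2) that] by simp
  obtain \<phi> where \<phi>: "\<And>n::nat. \<phi> n \<in> hom G K" and \<phi>g: "\<And>n. \<phi> n g = g" "\<And>n. \<phi> n h = h"
    and disc: "\<And>u. u \<in> carrier G \<Longrightarrow> u \<noteq> \<one>\<^bsub>G\<^esub> \<Longrightarrow> eventually (\<lambda>n. \<phi> n u \<noteq> \<one>\<^bsub>G\<^esub>) sequentially"
    using discriminating_sequence[OF assms(1,2,4,5) ghH] unfolding K_def by blast
  have disc': "eventually (\<lambda>n. \<phi> n u \<noteq> \<one>\<^bsub>K\<^esub>) sequentially" if "u \<in> carrier G" "u \<noteq> \<one>\<^bsub>G\<^esub>" for u
    using disc[OF that] by (simp add: K_def)
  define T where "T n u = \<alpha> (\<phi> n u)" for n u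
  have T_iso: "isometric_group_action G M d (T n)" for n
    unfolding T_def by (rule isometric_group_action_hom[OF act_K \<phi>])
  have T_pow: "T n (k [^]\<^bsub>G\<^esub> (m::int)) x0 = \<alpha> (k [^]\<^bsub>K\<^esub> m) x0" if "k \<in> {g, h}" for k n m
  proof -
    interpret hm: group_hom G K "\<phi> n" by (intro group_hom.intro group_hom_axioms.intro group_axioms K.group_axioms \<phi>)
    have "\<phi> n (k [^]\<^bsub>G\<^esub> m) = \<phi> n k [^]\<^bsub>K\<^esub> m" using that gh by (intro hm.hom_int_pow[symmetric, THEN sym]) auto
    then show ?thesis using that \<phi>g by (auto simp: T_def)
  qed
  have T_gh: "T n g x0 = \<alpha> g x0" "T n h x0 = \<alpha> h x0" for n by (simp_all add: T_def \<phi>g)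
  have acyl_seq: "\<exists>N::nat. \<exists>R. \<forall>A. finite A \<longrightarrow> A \<subseteq> carrier G \<longrightarrow> card A > N \<longrightarrow>
      eventually (\<lambda>n. \<forall>x\<in>M. \<forall>y\<in>M. d x y \<ge> R \<longrightarrow>
        (\<exists>g\<in>A. d x (T n g x) > \<epsilon> \<or> d y (T n g y) > \<epsilon>)) sequentially" if "\<epsilon> \<ge> 0" for \<epsilon>
    unfolding T_def by (rule discriminating_asymptotically_acylindrical[OF acyl K.group_axioms \<phi> disc' that])
  have acyl_sub: "\<exists>N::nat. \<exists>R. \<forall>A. finite A \<longrightarrow> A \<subseteq> carrier G \<longrightarrow> card A > N \<longrightarrow>
      eventually (\<lambda>n. \<forall>x\<in>M. \<forall>y\<in>M. d x y \<ge> R \<longrightarrow>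
        (\<exists>g\<in>A. d x (T (r n) g x) > \<epsilon> \<or> d y (T (r n) g y) > \<epsilon>)) (filtermap r' sequentially)"
    if e: "\<epsilon> \<ge> 0" and r: "strict_mono r" "strict_mono r'" for \<epsilon> and r r' :: "nat \<Rightarrow> nat"
  proof -
    obtain N R where NR: "\<And>A. finite A \<Longrightarrow> A \<subseteq> carrier G \<Longrightarrow> card A > N \<Longrightarrow>
      eventually (\<lambda>n. \<forall>x\<in>M. \<forall>y\<in>M. d x y \<ge> R \<longrightarrow>
        (\<exists>g\<in>A. d x (T n g x) > \<epsilon> \<or> d y (T n g y) > \<epsilon>)) sequentially" using acyl_seq[OF e] by blast
    have "strict_mono (r \<circ> r')" using r by (simp add: strict_mono_def)
    then have "eventually (\<lambda>n. P (r n)) (filtermap r' sequentially)" if "eventually P sequentially" for P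
      using eventually_subseq[of "r \<circ> r'" P] that by (simp add: eventually_filtermap)
    with NR show ?thesis by blast
  qed
  obtain S where S: "finite S" "S \<subseteq> carrier G" "generate G S = carrier G"
    using assms(1) by (auto simp: finitely_generated_group_def)
  \<comment> \<open>A sum, so that its rescaled limit is the sum of the displacements of
    \<open>base\<close> in the tree.\<close>
  define a where "a n = (\<Sum>s\<in>S. d x0 (T n s x0))" for n
  have a_nonneg: "0 \<le> a n" for n unfolding a_def by (intro sum_nonneg) simp
  have a_bound: "\<exists>C\<ge>0. \<forall>n. d x0 (T n u x0) \<le> C * a n" if "u \<in> carrier G" for u
  proof -
    have gen: "d x0 (T n s x0) \<le> a n" if "s \<in> S" for s n
      unfolding a_def by (rule member_le_sum) (use that S in auto)
    have "u \<in> generate G S" using that S by simp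
    then show ?thesis
    proof induction
      case one
      interpret Tn: isometric_group_action G M d "T n" for n by (rule T_iso)
      show ?case using x0 by (intro exI[of _ 0]) simp
    next
      case (incl s)
      then show ?case using gen by (intro exI[of _ 1]) simp
    next
      case (inv s)
      have "d x0 (T n (inv\<^bsub>G\<^esub> s) x0) \<le> a n" for n
      proof -
        interpret Tn: isometric_group_action G M d "T n" by (rule T_iso)
        have s: "s \<in> carrier G" using inv S by auto
        have "d x0 (T n (inv\<^bsub>G\<^esub> s) x0) = d (T n s x0) (T n s (T n (inv\<^bsub>G\<^esub> s) x0))" using s x0 by simp
        also have "T n s (T n (inv\<^bsub>G\<^esub> s) x0) = x0" using s x0 by (simp flip: Tn.act_mult)
        finally show ?thesis using gen[OF inv, of n] A.commute[of x0 "T n s x0"] by simp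
      qed
      then show ?case by (intro exI[of _ 1]) simp
    next
      case (eng u v)
      then obtain C C' where C: "C \<ge> 0" "\<And>n. d x0 (T n u x0) \<le> C * a n" "C' \<ge> 0" "\<And>n. d x0 (T n v x0) \<le> C' * a n" by blast
      have uv: "u \<in> carrier G" "v \<in> carrier G" using eng generate_incl S by auto
      have "d x0 (T n (u \<otimes>\<^bsub>G\<^esub> v) x0) \<le> (C + C') * a n" for n
      proof -
        interpret Tn: isometric_group_action G M d "T n" by (rule T_iso)
        show ?thesis
          using A.triangle[of x0 "T n u x0" "T n u (T n v x0)"] uv x0 C(2)[of n] C(4)[of n]
          by (simp add: Tn.act_mult algebra_simps)
      qed
      then show ?case using C by (intro exI[of _ "C + C'"]) simp
    qed
  qed
  have seq: "action_sequence G M d (\<lambda>n. T (r n)) \<delta> x0" for r :: "nat \<Rightarrow> nat"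
    by (intro action_sequence.intro action_sequence_axioms.intro group_axioms iso(1) T_iso geo \<delta> four x0)
  have inj: "i = j" if "g [^]\<^bsub>G\<^esub> (i::int) = g [^]\<^bsub>G\<^esub> (j::int)" for i j
    using A.loxodromic_pow_eq[OF lox(1), of i j] that pow[OF ghH(1)] by simp
  have indep: "j = 0" if "g [^]\<^bsub>G\<^esub> (i::int) = h [^]\<^bsub>G\<^esub> (j::int)" for i j
    using A.independent_pow_neq[OF four ind, of i j] that pow[OF ghH(1)] pow[OF ghH(2)] by simp
  have cG: "countable (carrier G)" by (rule countable_carrier[OF assms(1)])
  show ?thesis
  proof (cases "filterlim a at_top sequentially")
    case True
    \<comment> \<open>Adding 1 makes the scale positive and leaves the limit of
      \<open>a n / \<mu> n\<close> equal to 1.\<close>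
    define \<mu> where "\<mu> n = a n + 1" for n
    have \<mu>: "\<mu> n > 0" for n using a_nonneg[of n] by (simp add: \<mu>_def)
    interpret Q: action_sequence G M d T \<delta> x0 using seq[of id] by simp
    have bd: "\<exists>C. \<forall>n. d x0 (T n u x0) \<le> C * \<mu> n" if u: "u \<in> carrier G" for u
    proof -
      obtain C where C: "C \<ge> 0" "\<And>n. d x0 (T n u x0) \<le> C * a n" using a_bound[OF u] by blast
      then have "d x0 (T n u x0) \<le> C * \<mu> n" for n by (rule_tac order_trans[OF C(2)]) (simp add: \<mu>_def algebra_simps)
      then show ?thesis by blast
    qed
    obtain V D and r :: "nat \<Rightarrow> nat" where V: "strict_mono r" "countable V" "(\<lambda>_. x0) \<in> V" "\<And>p n. p \<in> V \<Longrightarrow> p n \<in> M"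
      "\<And>g p. g \<in> carrier G \<Longrightarrow> p \<in> V \<Longrightarrow> Q.act g p \<in> V"
      and points: "\<And>p q k. p \<in> V \<Longrightarrow> q \<in> V \<Longrightarrow> \<exists>z\<in>V. \<forall>n. d (p n) (z n) = min (real k) (d (p n) (q n)) \<and>
        d (z n) (q n) = d (p n) (q n) - min (real k) (d (p n) (q n))"
      and med: "\<And>p q r. p \<in> V \<Longrightarrow> q \<in> V \<Longrightarrow> r \<in> V \<Longrightarrow> \<exists>z\<in>V. \<forall>n. d (p n) (z n) = gromov_product d (p n) (q n) (r n) \<and>
        d (z n) (q n) = d (p n) (q n) - gromov_product d (p n) (q n) (r n)"
      and lim: "\<And>p q. p \<in> V \<Longrightarrow> q \<in> V \<Longrightarrow> ((\<lambda>n. d (p n) (q n) / \<mu> n) \<longlongrightarrow> D p q) (filtermap r sequentially)"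
    proof (rule Q.limit_exists[where \<mu> = \<mu>, OF cG \<mu>])
      show "\<exists>C. \<forall>n. d x0 (T n u x0) \<le> C * \<mu> n" if "u \<in> carrier G" for u by (rule bd[OF that])
    qed (rule that)
    define \<F> where "\<F> = filtermap r sequentially"
    have a_lim: "filterlim a at_top \<F>" unfolding \<F>_def filterlim_filtermap
      by (rule filterlim_compose[OF True filterlim_subseq[OF V(1)]])
    interpret L: tree_limit G M d T \<delta> x0 \<F> \<mu> V D
    proof (unfold_locales)
      show "\<F> \<noteq> bot" by (simp add: \<F>_def filtermap_bot_iff)
      show "filterlim \<mu> at_top \<F>" unfolding \<mu>_def
        by (rule filterlim_at_top_mono[OF a_lim]) simp
      show "((\<lambda>n. d (p n) (q n) / \<mu> n) \<longlongrightarrow> D p q) \<F>" if "p \<in> V" "q \<in> V" for p q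
        unfolding \<F>_def by (rule lim[OF that])
      show "\<exists>N::nat. \<exists>R. \<forall>A. finite A \<longrightarrow> A \<subseteq> carrier G \<longrightarrow> card A > N \<longrightarrow>
        eventually (\<lambda>n. \<forall>x\<in>M. \<forall>y\<in>M. d x y \<ge> R \<longrightarrow>
        (\<exists>g\<in>A. d x (T n g x) > \<epsilon> \<or> d y (T n g y) > \<epsilon>)) \<F>" if "\<epsilon> \<ge> 0" for \<epsilon>
        unfolding \<F>_def using acyl_sub[OF that strict_mono_id V(1)] by simp
    qed (use V \<mu> in auto)
    \<comment> \<open>The displacements of \<open>base\<close> by the generators add up to 1, so one
      of them is positive.\<close>
    have "\<exists>s\<in>S. L.len s > 0"
    proof (rule ccontr)
      assume "\<not> ?thesis"
      then have le: "(\<Sum>s\<in>S. L.len s) \<le> 0" by (intro sum_nonpos) (auto simp: not_less)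
      have "((\<lambda>n. \<Sum>s\<in>S. d x0 (Q.act s (\<lambda>_. x0) n) / \<mu> n) \<longlongrightarrow> (\<Sum>s\<in>S. L.len s)) \<F>"
        unfolding L.len_def using S(2) by (intro tendsto_sum L.limit) auto
      then have sum: "((\<lambda>n. a n / \<mu> n) \<longlongrightarrow> (\<Sum>s\<in>S. L.len s)) \<F>"
        by (simp add: a_def sum_divide_distrib Q.act_def)
      have "((\<lambda>n. 1 - 1 / \<mu> n) \<longlongrightarrow> 1 - 0) \<F>" by (intro tendsto_intros L.const_over_scale)
      moreover have "1 - 1 / \<mu> n = a n / \<mu> n" for n using \<mu>[of n] by (simp add: \<mu>_def field_simps)
      ultimately have "((\<lambda>n. a n / \<mu> n) \<longlongrightarrow> 1) \<F>" by simp
      with tendsto_unique[OF L.\<F>_nontrivial sum] le show False by fastforce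
    qed
    then obtain s where s: "s \<in> S" "L.len s > 0" by blast
    then have sG: "s \<in> carrier G" using S by auto
    show ?thesis
      by (rule L.unbounded_scale_acylindrically_hyperbolic[OF V(2) med sG s(2) gh, where \<beta>g = "d x0 (\<alpha> g x0)" and \<beta>h = "d x0 (\<alpha> h x0)"])
        (auto simp: T_gh intro: inj indep)
  next
    case False
    then obtain Z where "\<not> eventually (\<lambda>n. Z \<le> a n) sequentially" by (auto simp: filterlim_at_top)
    then have "\<exists>\<^sub>F n in sequentially. a n < Z" by (simp add: not_eventually not_le)
    then obtain r0 :: "nat \<Rightarrow> nat" where r0: "strict_mono r0" "\<And>n. a (r0 n) < Z"
      using infinite_enumerate[of "{n. a n < Z}"] by (auto simp: frequently_sequentially infinite_nat_iff_unbounded_le)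
    interpret Q: action_sequence G M d "\<lambda>n. T (r0 n)" \<delta> x0 by (rule seq)
    have bd: "\<exists>C. \<forall>n. d x0 (T (r0 n) u x0) \<le> C * 1" if u: "u \<in> carrier G" for u
    proof -
      obtain C where C: "C \<ge> 0" "\<And>n. d x0 (T n u x0) \<le> C * a n" using a_bound[OF u] by blast
      have "d x0 (T (r0 n) u x0) \<le> C * Z * 1" for n
        using C(2)[of "r0 n"] mult_left_mono[OF less_imp_le[OF r0(2)[of n]] C(1)] by simp
      then show ?thesis by blast
    qed
    obtain V D and r :: "nat \<Rightarrow> nat" where V: "strict_mono r" "countable V" "(\<lambda>_. x0) \<in> V" "\<And>p n. p \<in> V \<Longrightarrow> p n \<in> M"
      "\<And>g p. g \<in> carrier G \<Longrightarrow> p \<in> V \<Longrightarrow> Q.act g p \<in> V"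
      and points: "\<And>p q k. p \<in> V \<Longrightarrow> q \<in> V \<Longrightarrow> \<exists>z\<in>V. \<forall>n. d (p n) (z n) = min (real k) (d (p n) (q n)) \<and>
        d (z n) (q n) = d (p n) (q n) - min (real k) (d (p n) (q n))"
      and med: "\<And>p q r. p \<in> V \<Longrightarrow> q \<in> V \<Longrightarrow> r \<in> V \<Longrightarrow> \<exists>z\<in>V. \<forall>n. d (p n) (z n) = gromov_product d (p n) (q n) (r n) \<and>
        d (z n) (q n) = d (p n) (q n) - gromov_product d (p n) (q n) (r n)"
      and lim: "\<And>p q. p \<in> V \<Longrightarrow> q \<in> V \<Longrightarrow> ((\<lambda>n. d (p n) (q n) / 1) \<longlongrightarrow> D p q) (filtermap r sequentially)"
    proof (rule Q.limit_exists[where \<mu> = "\<lambda>_. 1", OF cG zero_less_one])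
      show "\<exists>C. \<forall>n. d x0 (T (r0 n) u x0) \<le> C * 1" if "u \<in> carrier G" for u by (rule bd[OF that])
    qed (rule that)
    interpret L: limit_action G M d "\<lambda>n. T (r0 n)" \<delta> x0 "filtermap r sequentially" "\<lambda>_. 1" V D
    proof (unfold_locales)
      show "\<exists>N::nat. \<exists>R. \<forall>A. finite A \<longrightarrow> A \<subseteq> carrier G \<longrightarrow> card A > N \<longrightarrow>
        eventually (\<lambda>n. \<forall>x\<in>M. \<forall>y\<in>M. d x y \<ge> R \<longrightarrow>
        (\<exists>g\<in>A. d x (T (r0 n) g x) > \<epsilon> \<or> d y (T (r0 n) g y) > \<epsilon>)) (filtermap r sequentially)" if "\<epsilon> \<ge> 0" for \<epsilon>
        by (rule acyl_sub[OF that r0(1) V(1)])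
    qed (use V lim in \<open>auto simp: filtermap_bot_iff\<close>)
    show ?thesis
    proof (rule L.bounded_scale_acylindrically_hyperbolic[OF V(2) refl points gh, where y = "\<lambda>k m. \<alpha> (k [^]\<^bsub>K\<^esub> m) x0"])
      show "T (r0 n) (k [^]\<^bsub>G\<^esub> m) x0 = \<alpha> (k [^]\<^bsub>K\<^esub> m) x0" if "k \<in> {g, h}" for k n and m :: int
        by (rule T_pow[OF that])
      show "\<exists>L\<ge>1. \<exists>C\<ge>0. \<forall>m n :: int.
        \<bar>real_of_int m - real_of_int n\<bar> / L - C \<le> d (\<alpha> (k [^]\<^bsub>K\<^esub> m) x0) (\<alpha> (k [^]\<^bsub>K\<^esub> n) x0) \<and>
        d (\<alpha> (k [^]\<^bsub>K\<^esub> m) x0) (\<alpha> (k [^]\<^bsub>K\<^esub> n) x0) \<le> L * \<bar>real_of_int m - real_of_int n\<bar> + C" if "k \<in> {g, h}" for k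
        using A.loxodromic_at[OF lox(1) x0] A.loxodromic_at[OF lox(2) x0] that by blast
      show "\<not> diverges_together d x0 (\<lambda>n. \<alpha> (g [^]\<^bsub>K\<^esub> (s * int n)) x0) (\<lambda>n. \<alpha> (h [^]\<^bsub>K\<^esub> (t * int n)) x0)"
        if "s \<in> {1, -1}" "t \<in> {1, -1}" for s t
        using A.independent_not_diverge[OF four ind x0 that] by (simp add: A.orbit_seq_def[abs_def])
    qed
  qed
qed

end
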